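(* Let $p\ge 3$ and let $\mathbf X_1,\dots,\mathbf X_n$ be iid random vectors in $\mathbb R^p$ with distribution $F$. Let $h:\mathbb R^p\times\mathbb R^p\to\mathbb R^{p\times p}$ be a measurable kernel which is symmetric ($h(\mathbf x_1,\mathbf x_2)=h(\mathbf x_2,\mathbf x_1)$), takes values in symmetric matrices, and satisfies $\mathbb E\|h(\mathbf X,\mathbf X')\|<\infty$. Let $U=\binom n2^{-1}\sum_{1\le i<j\le n}h(\mathbf X_i,\mathbf X_j)$ be non-degenerate. Let $B_n\ge 1$. Assume there exist constants $C_1,C_2\in(0,\infty)$ and $K\in(0,1)$ such that: (GA.1') for all $1\le m,k\le p$, $\mathbb E g_{mk}^2\ge C_1$ and $$\max_{\ell=0,1,2}\mathbb E\big(|h_{mk}|^{2+\ell}/B_n^{\ell}\big)\vee \mathbb E\big[(\|h\|/B_n)^4\big]\le 1;$$ (GA.2') $B_n^4\log^7(pn)/n\le C_2 n^{-K}$. Then there exists a constant $C>0$ depending only on $C_1,C_2$ such that $$\rho(\bar T_0,\bar Z_0):=\sup_{t\in\mathbb R}\big|\mathbb P(\bar T_0\le t)-\mathbb P(\bar Z_0\le t)\big|\le C n^{-K/8}.$$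
   Context: For a matrix $A$, $\|A\|=\max_{m,k}|A_{mk}|$. $\mathbf X,\mathbf X'$ denote independent random vectors with distribution $F$, independent of the sample. $\mathbb E h=\mathbb E[h(\mathbf X,\mathbf X')]$, $h_{mk}=h_{mk}(\mathbf X,\mathbf X')$, $\|h\|=\|h(\mathbf X,\mathbf X')\|$; $g(\mathbf x)=\mathbb E[h(\mathbf x,\mathbf X')]-\mathbb E h$ and $g_{mk}=g_{mk}(\mathbf X)$. "Non-degenerate" means $\mathrm{Var}(g_{mk}(\mathbf X))>0$ for all $m,k$. $T=\sqrt n(U-\mathbb EU)/2$ and $\bar T_0=\max_{1\le m,k\le p}T_{mk}$. With $p'=p(p+1)/2$, $\Gamma_g$ is the $p'\times p'$ covariance matrix of $\mathrm{vech}(g(\mathbf X))$ (the vector of lower-triangular entries $g_{jk}$, $j\ge k$); $Z_1,\dots,Z_n$ are iid $N(\mathbf 0,\Gamma_g)$, each identified with a symmetric $p\times p$ matrix, and $\bar Z_0=\max_{1\le m,k\le p} n^{-1/2}\sum_{i=1}^n Z_{i,mk}$. *)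

theory Defs
  imports "HOL-Probability.Probability"
begin

type_synonym vec = "nat \<Rightarrow> real"
type_synonym mkernel = "vec \<Rightarrow> vec \<Rightarrow> nat \<Rightarrow> nat \<Rightarrow> real"

text \<open>R^p as extensional functions on indices 0..p-1 (paper's 1..p shifted).\<close>
definition vecM :: "nat \<Rightarrow> vec measure" where
  "vecM p = PiM {..<p} (\<lambda>_. borel)"

definition mnorm :: "nat \<Rightarrow> (nat \<Rightarrow> nat \<Rightarrow> real) \<Rightarrow> real" where
  "mnorm p A = Max ((\<lambda>(m,k). \<bar>A m k\<bar>) ` ({..<p} \<times> {..<p}))"

definition Eh :: "vec measure \<Rightarrow> mkernel \<Rightarrow> nat \<Rightarrow> nat \<Rightarrow> real" where
  "Eh F h m k = (\<integral>z. h (fst z) (snd z) m k \<partial>(F \<Otimes>\<^sub>M F))"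

definition gk :: "vec measure \<Rightarrow> mkernel \<Rightarrow> vec \<Rightarrow> nat \<Rightarrow> nat \<Rightarrow> real" where
  "gk F h x m k = (\<integral>y. h x y m k \<partial>F) - Eh F h m k"

definition sampleM :: "nat \<Rightarrow> 'a measure \<Rightarrow> (nat \<Rightarrow> 'a) measure" where
  "sampleM n F = PiM {..<n} (\<lambda>_. F)"

definition Ustat :: "nat \<Rightarrow> mkernel \<Rightarrow> (nat \<Rightarrow> vec) \<Rightarrow> nat \<Rightarrow> nat \<Rightarrow> real" where
  "Ustat n h xs m k =
     (\<Sum>(i,j)\<in>{(i,j). i < j \<and> j < n}. h (xs i) (xs j) m k) / real (n choose 2)"

definition T0stat :: "nat \<Rightarrow> nat \<Rightarrow> vec measure \<Rightarrow> mkernel \<Rightarrow> (nat \<Rightarrow> vec) \<Rightarrow> real" where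
  "T0stat n p F h xs = Max ((\<lambda>(m,k). sqrt (real n) *
       (Ustat n h xs m k - (\<integral>ys. Ustat n h ys m k \<partial>(sampleM n F))) / 2)
     ` ({..<p} \<times> {..<p}))"

text \<open>Index set of vech: lower-triangular pairs (j,k), k <= j.\<close>
definition vidx :: "nat \<Rightarrow> (nat \<times> nat) set" where
  "vidx p = {(j,k). k \<le> j \<and> j < p}"

text \<open>Entry (m,k) of the symmetric matrix identified with a vech vector.\<close>
definition sidx :: "nat \<Rightarrow> nat \<Rightarrow> nat \<times> nat" where
  "sidx m k = (max m k, min m k)"

definition Gamma_g :: "vec measure \<Rightarrow> mkernel \<Rightarrow> nat \<times> nat \<Rightarrow> nat \<times> nat \<Rightarrow> real" where
  "Gamma_g F h a b =
     (\<integral>x. (gk F h x (fst a) (snd a) - (\<integral>y. gk F h y (fst a) (snd a) \<partial>F)) *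
          (gk F h x (fst b) (snd b) - (\<integral>y. gk F h y (fst b) (snd b) \<partial>F)) \<partial>F)"

definition is_centered_gaussian :: "'i set \<Rightarrow> ('i \<Rightarrow> 'i \<Rightarrow> real) \<Rightarrow> ('i \<Rightarrow> real) measure \<Rightarrow> bool" where
  "is_centered_gaussian I S G \<longleftrightarrow>
     prob_space G \<and> sets G = sets (PiM I (\<lambda>_. borel)) \<and>
     (\<forall>a :: 'i \<Rightarrow> real.
        let v = (\<Sum>i\<in>I. \<Sum>j\<in>I. a i * a j * S i j) in
        distr G borel (\<lambda>z. \<Sum>i\<in>I. a i * z i) =
          (if v = 0 then return borel 0 else density lborel (normal_density 0 (sqrt v))))"

definition Z0stat :: "nat \<Rightarrow> nat \<Rightarrow> (nat \<Rightarrow> (nat \<times> nat) \<Rightarrow> real) \<Rightarrow> real" where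
  "Z0stat n p zs = Max ((\<lambda>(m,k). (\<Sum>i<n. zs i (sidx m k)) / sqrt (real n))
     ` ({..<p} \<times> {..<p}))"

definition rho :: "'a measure \<Rightarrow> ('a \<Rightarrow> real) \<Rightarrow> 'b measure \<Rightarrow> ('b \<Rightarrow> real) \<Rightarrow> real" where
  "rho M S N R = (SUP t. \<bar>measure M {x \<in> space M. S x \<le> t} - measure N {y \<in> space N. R y \<le> t}\<bar>)"

end

theory Submission
  imports Defs
begin

text \<open>By the Hoeffding decomposition, \<open>T\<close> is \<open>\<Sum> g(X\<^sub>i) / sqrt n\<close> plus a completely degenerate U-statistic
  \<open>R\<close>. Martingale versions of the second-order expansion of the smooth maximum
  \<open>ln (\<Sum> exp (\<beta> w\<^sub>k)) / \<beta>\<close>, applied first in the last and then in the other variables, show that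
  \<open>E max \<bar>R\<bar>\<close> is at most of order \<open>B ln (pn) / sqrt n\<close>. For the linear part, the indicator of \<open>max \<le> t\<close> is replaced by a
  smooth step of width \<open>\<delta>\<close> applied to the smooth maximum, and the summands are swapped one at a time
  for Gaussian ones. The third-order remainder only sees \<open>max\<^sub>k E \<bar>g\<^sub>k\<bar>\<^sup>3\<close>, because the
  third derivative in direction \<open>y\<close> is bounded by a soft-max average of \<open>\<bar>y\<^sub>k\<bar>\<^sup>3\<close> and the soft-max
  weights are stable under shifts of size \<open>1 / \<beta>\<close>; larger summands are handled by the fourth moment of
  the envelope. Smoothing costs at most \<open>\<delta> sqrt (ln (pn))\<close> by Nazarov's inequality for Gaussian maxima.
  With \<open>\<beta> = ln (pn) / \<delta>\<close>, \<open>\<delta> sqrt (ln (pn)) = r\<close> and \<open>r\<^sup>8 = B\<^sup>4 (ln (pn))\<^sup>7 / n\<close> all errors are of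
  order \<open>r\<close>.\<close>

section \<open>Smooth maximum and soft-max weights\<close>

text \<open>Write L for ln (pn). With \<open>\<beta> = L / \<delta>\<close> and
  \<open>\<delta> = r / sqrt L\<close> the swapping error has a third-order part B L^(7/2) / (r^3
  sqrt n) and a fourth-order part (B^4 + L^2) L^5 / (r^4 n), the degenerate part contributes B
  L^(3/2) / (r sqrt n), and smoothing contributes r / sqrt C1. Since r^4 = B^2 L^(7/2) / sqrt n, the
  first three are, up to constants, at most r / B, r^4 and r^3. Balancing third order against
  smoothing thus produces the power 7 of the logarithm and the exponent 1/8. The envelope does the
  work of a truncation: a summand is either below 1 / \<beta>, where the third-order expansion is
  accurate, or it is paid for by its fourth power, so no truncated variable has to be centered
  again. The lower variance bound C1 is felt only in the anti-concentration width, and only for the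
  Gaussian maximum. K stays out of all estimates until r is replaced by (C2 n^(-K))^(1/8), which is
  why the constant depends on C1 and C2 alone. For r > 1 the claim is trivial, a difference of
  probabilities being at most 1.\<close>

definition smax :: "real \<Rightarrow> 'i set \<Rightarrow> ('i \<Rightarrow> real) \<Rightarrow> real" where
  "smax \<beta> I w = ln (\<Sum>k\<in>I. exp (\<beta> * w k)) / \<beta>"

definition softmax :: "real \<Rightarrow> 'i set \<Rightarrow> ('i \<Rightarrow> real) \<Rightarrow> 'i \<Rightarrow> real" where
  "softmax \<beta> I w k = exp (\<beta> * w k) / (\<Sum>j\<in>I. exp (\<beta> * w j))"

text \<open>Moments of the coordinates of \<open>y\<close> under the soft-max weights at
  \<open>w\<close>. The derivatives of \<open>smax\<close> along \<open>y\<close> are powers of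
  \<beta> times the cumulants built from them, so all calculus takes place on a line.\<close>

definition smom :: "real \<Rightarrow> 'i set \<Rightarrow> ('i \<Rightarrow> real) \<Rightarrow> ('i \<Rightarrow> real) \<Rightarrow> nat \<Rightarrow> real" where
  "smom \<beta> I w y j = (\<Sum>k\<in>I. softmax \<beta> I w k * y k ^ j)"

lemma sum_exp_pos:
  assumes "finite I" "I \<noteq> {}"
  shows "(\<Sum>k\<in>I. exp (\<beta> * w k :: real)) > 0"
  using assms by (intro sum_pos) auto

lemma softmax_nonneg: "softmax \<beta> I w k \<ge> 0"
  unfolding softmax_def by (intro divide_nonneg_nonneg sum_nonneg) auto

lemma sum_softmax:
  assumes "finite I" "I \<noteq> {}"
  shows "(\<Sum>k\<in>I. softmax \<beta> I w k) = 1"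
  using sum_exp_pos[OF assms, of \<beta> w] unfolding softmax_def
  by (simp add: sum_divide_distrib[symmetric])

lemma softmax_avg_le:
  assumes "finite I" "I \<noteq> {}" "\<And>k. k \<in> I \<Longrightarrow> y k \<le> c"
  shows "(\<Sum>k\<in>I. softmax \<beta> I w k * y k) \<le> c"
proof -
  have "(\<Sum>k\<in>I. softmax \<beta> I w k * y k) \<le> (\<Sum>k\<in>I. softmax \<beta> I w k * c)"
    by (intro sum_mono mult_left_mono assms softmax_nonneg)
  also have "\<dots> = c" using sum_softmax[OF assms(1,2)] by (simp flip: sum_distrib_right)
  finally show ?thesis .
qed

lemma smax_ge:
  assumes "finite I" "k \<in> I" "\<beta> > 0"
  shows "w k \<le> smax \<beta> I w"
proof -
  have "exp (\<beta> * w k) \<le> (\<Sum>k\<in>I. exp (\<beta> * w k))"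
    using assms by (intro member_le_sum) auto
  then have "\<beta> * w k \<le> ln (\<Sum>k\<in>I. exp (\<beta> * w k))"
    by (subst ln_ge_iff) (use assms in \<open>auto intro!: sum_exp_pos\<close>)
  then show ?thesis using assms by (simp add: smax_def field_simps)
qed

lemma smax_le:
  assumes "finite I" "I \<noteq> {}" "\<beta> > 0" "\<And>k. k \<in> I \<Longrightarrow> w k \<le> c"
  shows "smax \<beta> I w \<le> c + ln (real (card I)) / \<beta>"
proof -
  have c: "real (card I) > 0" using assms by (simp add: card_gt_0_iff)
  have "(\<Sum>k\<in>I. exp (\<beta> * w k)) \<le> (\<Sum>k\<in>I. exp (\<beta> * c))"
    using assms by (intro sum_mono) auto
  then have "ln (\<Sum>k\<in>I. exp (\<beta> * w k)) \<le> ln (real (card I) * exp (\<beta> * c))"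
    by (subst ln_le_cancel_iff) (use assms c in \<open>auto intro!: sum_exp_pos\<close>)
  also have "\<dots> = ln (real (card I)) + \<beta> * c"
    using c by (simp add: ln_mult)
  finally show ?thesis using assms by (simp add: smax_def field_simps)
qed

lemma smax_add_le:
  assumes "finite I" "I \<noteq> {}" "\<beta> > 0" "\<And>k. k \<in> I \<Longrightarrow> y k \<le> b"
  shows "smax \<beta> I (\<lambda>k. w k + y k) \<le> smax \<beta> I w + b"
proof -
  have "(\<Sum>k\<in>I. exp (\<beta> * (w k + y k))) \<le> (\<Sum>k\<in>I. exp (\<beta> * w k) * exp (\<beta> * b))"
    using assms by (intro sum_mono) (auto simp flip: exp_add simp: ring_distribs)
  then have "(\<Sum>k\<in>I. exp (\<beta> * (w k + y k))) \<le> (\<Sum>k\<in>I. exp (\<beta> * w k)) * exp (\<beta> * b)"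
    by (simp add: sum_distrib_right)
  then have "ln (\<Sum>k\<in>I. exp (\<beta> * (w k + y k))) \<le> ln ((\<Sum>k\<in>I. exp (\<beta> * w k)) * exp (\<beta> * b))"
    by (subst ln_le_cancel_iff) (use assms in \<open>auto intro!: sum_exp_pos mult_pos_pos\<close>)
  also have "\<dots> = ln (\<Sum>k\<in>I. exp (\<beta> * w k)) + \<beta> * b"
    using sum_exp_pos[OF assms(1,2), of \<beta> w] by (simp add: ln_mult)
  finally show ?thesis using assms by (simp add: smax_def field_simps)
qed

lemma smax_measurable[measurable (raw)]:
  assumes "\<And>k. k \<in> I \<Longrightarrow> (\<lambda>x. W x k) \<in> borel_measurable M"
  shows "(\<lambda>x. smax \<beta> I (W x)) \<in> borel_measurable M"
  unfolding smax_def using assms by measurable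

lemma softmax_measurable[measurable (raw)]:
  assumes "\<And>k. k \<in> I \<Longrightarrow> (\<lambda>x. W x k) \<in> borel_measurable M" "k \<in> I"
  shows "(\<lambda>x. softmax \<beta> I (W x) k) \<in> borel_measurable M"
  unfolding softmax_def using assms by measurable

lemma smom_measurable[measurable (raw)]:
  assumes "\<And>k. k \<in> I \<Longrightarrow> (\<lambda>x. W x k) \<in> borel_measurable M"
  assumes "\<And>k. k \<in> I \<Longrightarrow> (\<lambda>x. Y x k) \<in> borel_measurable M"
  shows "(\<lambda>x. smom \<beta> I (W x) (Y x) j) \<in> borel_measurable M"
  unfolding smom_def using assms by measurable

lemma smax_deriv:
  fixes w y :: "'i \<Rightarrow> real"
  assumes "finite I" "I \<noteq> {}" "\<beta> > 0"
  shows "((\<lambda>t. smax \<beta> I (\<lambda>k. w k + t * y k)) has_real_derivative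
           smom \<beta> I (\<lambda>k. w k + t * y k) y 1) (at t)"
proof -
  have p: "(\<Sum>k\<in>I. exp (\<beta> * (w k + t * y k))) > 0" by (rule sum_exp_pos[OF assms(1,2)])
  have "((\<lambda>t. smax \<beta> I (\<lambda>k. w k + t * y k)) has_real_derivative
     (\<Sum>k\<in>I. exp (\<beta> * (w k + t * y k)) * (\<beta> * y k)) / (\<Sum>k\<in>I. exp (\<beta> * (w k + t * y k))) / \<beta>) (at t)"
    unfolding smax_def using p assms(3)
    by (auto intro!: derivative_eq_intros simp: mult_ac)
  also have "(\<Sum>k\<in>I. exp (\<beta> * (w k + t * y k)) * (\<beta> * y k)) = \<beta> * (\<Sum>k\<in>I. exp (\<beta> * (w k + t * y k)) * y k)"
    by (simp add: sum_distrib_left mult_ac)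
  also have "\<beta> * (\<Sum>k\<in>I. exp (\<beta> * (w k + t * y k)) * y k) / (\<Sum>k\<in>I. exp (\<beta> * (w k + t * y k))) / \<beta>
      = smom \<beta> I (\<lambda>k. w k + t * y k) y 1"
    using assms(3) by (simp add: smom_def softmax_def sum_divide_distrib)
  finally show ?thesis .
qed

text \<open>Quotient rule for \<open>E j / E 0\<close>: differentiating a soft-max mean gives
  \<beta> times the covariance of \<open>y ^ j\<close> and \<open>y\<close>. The family of moments
  is therefore closed under differentiation.\<close>

lemma smom_deriv:
  fixes w y :: "'i \<Rightarrow> real"
  assumes "finite I" "I \<noteq> {}"
  shows "((\<lambda>t. smom \<beta> I (\<lambda>k. w k + t * y k) y j) has_real_derivative
           \<beta> * (smom \<beta> I (\<lambda>k. w k + t * y k) y (Suc j)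
             - smom \<beta> I (\<lambda>k. w k + t * y k) y j * smom \<beta> I (\<lambda>k. w k + t * y k) y 1)) (at t)"
proof -
  define E where "E j t = (\<Sum>k\<in>I. exp (\<beta> * (w k + t * y k)) * y k ^ j)" for j t
  have sm: "smom \<beta> I (\<lambda>k. w k + t * y k) y j = E j t / E 0 t" for j t
    by (simp add: smom_def softmax_def E_def sum_divide_distrib)
  have E0: "E 0 t > 0" for t using sum_exp_pos[OF assms] by (simp add: E_def)
  have dE: "(E j has_real_derivative \<beta> * E (Suc j) t) (at t)" for j t
    unfolding E_def by (auto intro!: derivative_eq_intros simp: sum_distrib_left mult_ac)
  have "((\<lambda>t. E j t / E 0 t) has_real_derivative
     ((\<beta> * E (Suc j) t) * E 0 t - E j t * (\<beta> * E (Suc 0) t)) / (E 0 t * E 0 t)) (at t)"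
    by (rule DERIV_divide[OF dE dE]) (use E0[of t] in auto)
  also have "((\<beta> * E (Suc j) t) * E 0 t - E j t * (\<beta> * E (Suc 0) t)) / (E 0 t * E 0 t)
     = \<beta> * (E (Suc j) t / E 0 t - E j t / E 0 t * (E (Suc 0) t / E 0 t))"
    using E0[of t] by (simp add: field_simps)
  finally show ?thesis unfolding sm by simp
qed

lemma smom_abs_le:
  assumes "finite I" "I \<noteq> {}"
  shows "\<bar>smom \<beta> I w y j\<bar> \<le> smom \<beta> I w (\<lambda>k. \<bar>y k\<bar>) j"
  unfolding smom_def
  by (rule order_trans[OF sum_abs]) (auto simp: abs_mult power_abs softmax_nonneg)

lemma smom_power_le:
  assumes "finite I" "I \<noteq> {}" "\<And>k. k \<in> I \<Longrightarrow> \<bar>y k\<bar> \<le> b"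
  shows "\<bar>smom \<beta> I w y j\<bar> \<le> b ^ j"
proof -
  have "\<bar>smom \<beta> I w y j\<bar> \<le> smom \<beta> I w (\<lambda>k. \<bar>y k\<bar>) j" by (rule smom_abs_le[OF assms(1,2)])
  also have "\<dots> \<le> b ^ j" unfolding smom_def
    by (rule softmax_avg_le[OF assms(1,2)]) (auto intro: power_mono assms(3))
  finally show ?thesis .
qed

lemma smom_var:
  assumes "finite I" "I \<noteq> {}"
  shows "(smom \<beta> I w y 1)\<^sup>2 \<le> smom \<beta> I w y 2"
proof -
  let ?m = "smom \<beta> I w y 1"
  have "0 \<le> (\<Sum>k\<in>I. softmax \<beta> I w k * (y k - ?m)\<^sup>2)"
    by (intro sum_nonneg mult_nonneg_nonneg softmax_nonneg) auto
  also have "\<dots> = (\<Sum>k\<in>I. softmax \<beta> I w k * y k ^ 2 - 2 * ?m * (softmax \<beta> I w k * y k) + ?m\<^sup>2 * softmax \<beta> I w k)"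
    by (intro sum.cong) (auto simp: power2_eq_square algebra_simps)
  also have "\<dots> = smom \<beta> I w y 2 - 2 * ?m * ?m + ?m\<^sup>2 * 1"
    unfolding sum.distrib sum_subtractf sum_distrib_left[symmetric] sum_softmax[OF assms]
    by (simp add: smom_def)
  also have "\<dots> = smom \<beta> I w y 2 - ?m\<^sup>2" by (simp add: power2_eq_square)
  finally show ?thesis by simp
qed

text \<open>Written as a double sum over two independent soft-max indices, the product is handled
  term by term with a b^2 \<le> a^3 + b^3. Mixed terms of the third derivative thereby become
  averages of cubes rather than powers of the maximum norm.\<close>

lemma smom_12_le_3:
  assumes "finite I" "I \<noteq> {}"
  shows "\<bar>smom \<beta> I w y 1\<bar> * smom \<beta> I w y 2 \<le> 2 * smom \<beta> I w (\<lambda>k. \<bar>y k\<bar>) 3"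
proof -
  let ?s = "softmax \<beta> I w"
  have ab: "a * b\<^sup>2 \<le> a^3 + b^3" if "a \<ge> 0" "b \<ge> 0" for a b :: real
  proof (cases "a \<le> b")
    case True
    then have "a * b\<^sup>2 \<le> b * b\<^sup>2" by (intro mult_right_mono) auto
    also have "\<dots> \<le> a^3 + b^3" using that by (simp add: power2_eq_square power3_eq_cube)
    finally show ?thesis .
  next
    case False
    then have "a * b\<^sup>2 \<le> a * a\<^sup>2" using that by (intro mult_left_mono power_mono) auto
    also have "\<dots> \<le> a^3 + b^3" using that by (simp add: power2_eq_square power3_eq_cube)
    finally show ?thesis .
  qed
  have y2: "smom \<beta> I w y 2 = smom \<beta> I w (\<lambda>k. \<bar>y k\<bar>) 2" by (simp add: smom_def)
  have nn: "smom \<beta> I w y 2 \<ge> 0" unfolding smom_def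
    by (intro sum_nonneg mult_nonneg_nonneg softmax_nonneg) auto
  have "\<bar>smom \<beta> I w y 1\<bar> * smom \<beta> I w y 2 \<le> smom \<beta> I w (\<lambda>k. \<bar>y k\<bar>) 1 * smom \<beta> I w (\<lambda>k. \<bar>y k\<bar>) 2"
    unfolding y2[symmetric] by (intro mult_right_mono smom_abs_le assms nn)
  also have "\<dots> = (\<Sum>j\<in>I. \<Sum>k\<in>I. ?s j * ?s k * (\<bar>y j\<bar> * \<bar>y k\<bar>\<^sup>2))"
    by (simp add: smom_def sum_product mult_ac)
  also have "\<dots> \<le> (\<Sum>j\<in>I. \<Sum>k\<in>I. ?s j * ?s k * (\<bar>y j\<bar>^3 + \<bar>y k\<bar>^3))"
    by (intro sum_mono mult_left_mono ab mult_nonneg_nonneg softmax_nonneg) auto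
  also have "\<dots> = (\<Sum>j\<in>I. \<Sum>k\<in>I. ?s k * (?s j * \<bar>y j\<bar>^3)) + (\<Sum>j\<in>I. \<Sum>k\<in>I. ?s j * (?s k * \<bar>y k\<bar>^3))"
    by (simp add: ring_distribs sum.distrib mult_ac)
  also have "\<dots> = 2 * smom \<beta> I w (\<lambda>k. \<bar>y k\<bar>) 3"
    unfolding sum_product[symmetric] sum_distrib_left[symmetric] sum_distrib_right[symmetric] sum_softmax[OF assms]
    by (simp add: smom_def)
  finally show ?thesis .
qed

lemma smom_1_cubed_le_3:
  assumes "finite I" "I \<noteq> {}"
  shows "\<bar>smom \<beta> I w y 1\<bar> ^ 3 \<le> 2 * smom \<beta> I w (\<lambda>k. \<bar>y k\<bar>) 3"
proof -
  have "\<bar>smom \<beta> I w y 1\<bar> ^ 3 = \<bar>smom \<beta> I w y 1\<bar> * (smom \<beta> I w y 1)\<^sup>2"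
    by (simp add: power3_eq_cube power2_eq_square abs_mult)
  also have "\<dots> \<le> \<bar>smom \<beta> I w y 1\<bar> * smom \<beta> I w y 2"
    by (intro mult_left_mono smom_var assms) auto
  also have "\<dots> \<le> 2 * smom \<beta> I w (\<lambda>k. \<bar>y k\<bar>) 3" by (rule smom_12_le_3[OF assms])
  finally show ?thesis .
qed

text \<open>A shift of size at most \<open>1 / \<beta>\<close> changes the weights by at most a constant factor; this lets
  the third-order remainder be evaluated at the unshifted point.\<close>
lemma softmax_stable:
  assumes "finite I" "I \<noteq> {}" "k \<in> I" "\<beta> > 0" "\<And>k. k \<in> I \<Longrightarrow> \<bar>y k\<bar> \<le> 1 / \<beta>"
  shows "softmax \<beta> I (\<lambda>k. w k + y k) k \<le> exp 2 * softmax \<beta> I w k"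
proof -
  have b: "\<bar>\<beta> * y k\<bar> \<le> 1" if "k \<in> I" for k
    using assms(4) assms(5)[OF that] by (simp add: abs_mult field_simps)
  have "exp (-1) * (\<Sum>j\<in>I. exp (\<beta> * w j)) \<le> (\<Sum>j\<in>I. exp (\<beta> * (w j + y j)))"
    unfolding sum_distrib_left
  proof (intro sum_mono)
    fix j assume "j \<in> I"
    from b[OF this] show "exp (-1) * exp (\<beta> * w j) \<le> exp (\<beta> * (w j + y j))"
      by (simp add: ring_distribs flip: exp_add)
  qed
  moreover have "exp (\<beta> * (w k + y k)) \<le> exp 1 * exp (\<beta> * w k)"
    using b[OF assms(3)] by (simp add: ring_distribs flip: exp_add)
  ultimately have "softmax \<beta> I (\<lambda>k. w k + y k) k \<le> exp 1 * exp (\<beta> * w k) / (exp (-1) * (\<Sum>j\<in>I. exp (\<beta> * w j)))"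
    unfolding softmax_def using sum_exp_pos[OF assms(1,2), of \<beta> w]
    by (intro frac_le) auto
  also have "\<dots> = exp 2 * softmax \<beta> I w k"
    by (simp add: softmax_def exp_minus field_simps flip: exp_add)
  finally show ?thesis .
qed

lemma smom_stable:
  assumes "finite I" "I \<noteq> {}" "\<beta> > 0" "0 \<le> t" "t \<le> 1" "\<And>k. k \<in> I \<Longrightarrow> \<bar>y k\<bar> \<le> 1 / \<beta>"
  shows "smom \<beta> I (\<lambda>k. w k + t * y k) (\<lambda>k. \<bar>y k\<bar>) j \<le> exp 2 * smom \<beta> I w (\<lambda>k. \<bar>y k\<bar>) j"
  unfolding smom_def sum_distrib_left mult.assoc[symmetric]
proof (intro sum_mono mult_right_mono softmax_stable assms)
  fix k assume "k \<in> I"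
  have "\<bar>t * y k\<bar> \<le> 1 * \<bar>y k\<bar>" unfolding abs_mult using assms(4,5) by (intro mult_right_mono) auto
  then show "\<bar>t * y k\<bar> \<le> 1 / \<beta>" using assms(6)[OF \<open>k \<in> I\<close>] by simp
qed auto

text \<open>The second derivative is \<beta> times a soft-max variance, hence at most
  \<open>\<beta> * b\<^sup>2\<close>. Only an upper bound is stated because it serves to bound
  expected growth.\<close>

lemma smax_second_order:
  assumes "finite I" "I \<noteq> {}" "\<beta> > 0" "\<And>k. k \<in> I \<Longrightarrow> \<bar>y k\<bar> \<le> b"
  shows "smax \<beta> I (\<lambda>k. w k + y k) \<le> smax \<beta> I w + smom \<beta> I w y 1 + \<beta> / 2 * b\<^sup>2"
proof -
  \<comment> \<open>Successive derivatives in the indexed form that \<open>Maclaurin\<close>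
    expects; the last branch stands for order 2.\<close>
  define d where "d m t = (if m = 0 then smax \<beta> I (\<lambda>k. w k + t * y k) else if m = 1 then smom \<beta> I (\<lambda>k. w k + t * y k) y 1
     else \<beta> * (smom \<beta> I (\<lambda>k. w k + t * y k) y 2
             - smom \<beta> I (\<lambda>k. w k + t * y k) y 1 * smom \<beta> I (\<lambda>k. w k + t * y k) y 1))" for m :: nat and t
  have "\<exists>t. 0 < t \<and> t < 1 \<and> d 0 1 = (\<Sum>m<2. d m 0 / fact m * 1 ^ m) + d 2 t / fact 2 * 1 ^ 2"
  proof (rule Maclaurin)
    show "\<forall>m t. m < 2 \<and> 0 \<le> t \<and> t \<le> 1 \<longrightarrow> (d m has_real_derivative d (Suc m) t) (at t)"
    proof (intro allI impI)
      fix m t assume "m < (2::nat) \<and> 0 \<le> t \<and> t \<le> (1::real)"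
      then consider "m = 0" | "m = 1" by linarith
      then show "(d m has_real_derivative d (Suc m) t) (at t)"
        using smax_deriv[OF assms(1-3), of w y t] smom_deriv[OF assms(1,2), of \<beta> w y 1 t]
        by cases (simp_all add: d_def[abs_def] numeral_2_eq_2)
    qed
  qed auto
  then obtain t where t: "d 0 1 = d 0 0 + d 1 0 + d 2 t / 2"
    by (auto simp: numeral_2_eq_2)
  have "smom \<beta> I (\<lambda>k. w k + t * y k) y 2
             - smom \<beta> I (\<lambda>k. w k + t * y k) y 1 * smom \<beta> I (\<lambda>k. w k + t * y k) y 1 \<le> b\<^sup>2"
    using smom_power_le[OF assms(1,2), of y b \<beta> "\<lambda>k. w k + t * y k" 2, OF assms(4)]
      zero_le_square[of "smom \<beta> I (\<lambda>k. w k + t * y k) y 1"] by linarith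
  then have "d 2 t \<le> \<beta> * b\<^sup>2" using assms(3) by (simp add: d_def)
  then show ?thesis using t by (simp add: d_def)
qed

text \<open>The subtracted terms are the second-order Taylor polynomial of \<open>m\<close> composed
  with \<open>smax\<close> at \<open>w\<close>: by the chain rule the second derivative is m2 times
  the squared mean plus m1 times \<beta> times the variance.\<close>

definition taylor_rem :: "real \<Rightarrow> 'i set \<Rightarrow> (real \<Rightarrow> real) \<Rightarrow> (real \<Rightarrow> real) \<Rightarrow> (real \<Rightarrow> real) \<Rightarrow> ('i \<Rightarrow> real) \<Rightarrow> ('i \<Rightarrow> real) \<Rightarrow> real" where
  "taylor_rem \<beta> I m m1 m2 w y = m (smax \<beta> I (\<lambda>k. w k + y k)) - m (smax \<beta> I w)
     - m1 (smax \<beta> I w) * smom \<beta> I w y 1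
     - (m2 (smax \<beta> I w) * (smom \<beta> I w y 1)\<^sup>2
        + m1 (smax \<beta> I w) * \<beta> * (smom \<beta> I w y 2 - (smom \<beta> I w y 1)\<^sup>2)) / 2"

text \<open>If \<open>b \<le> 1 / \<beta>\<close>, the third derivative is controlled by a soft-max
  average of cubes. Otherwise the expansion stops one order earlier, and
  \<open>\<beta> * b \<ge> 1\<close> pays for the missing order. Both terms on the right are
  nonnegative, so their sum covers either case.\<close>

lemma taylor_rem_bound:
  fixes w y :: "'i \<Rightarrow> real"
  assumes I: "finite I" "I \<noteq> {}" and \<beta>: "\<beta> > 0" and \<delta>: "\<delta> > 0" "\<beta> * \<delta> \<ge> 1" and A: "A \<ge> 0"
    and m: "\<And>s. (m has_real_derivative m1 s) (at s)"
    and m1: "\<And>s. (m1 has_real_derivative m2 s) (at s)"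
    and m2: "\<And>s. (m2 has_real_derivative m3 s) (at s)"
    and b1: "\<And>s. \<bar>m1 s\<bar> \<le> A / \<delta>" and b2: "\<And>s. \<bar>m2 s\<bar> \<le> A / \<delta>\<^sup>2" and b3: "\<And>s. \<bar>m3 s\<bar> \<le> A / \<delta>^3"
    and y: "\<And>k. k \<in> I \<Longrightarrow> \<bar>y k\<bar> \<le> b"
  shows "\<bar>taylor_rem \<beta> I m m1 m2 w y\<bar> \<le> A * \<beta>\<^sup>2 / \<delta> * (3 * exp 2 * smom \<beta> I w (\<lambda>k. \<bar>y k\<bar>) 3) + 2 * A * \<beta>^3 / \<delta> * b ^ 4"
proof -
  define M where "M j t = smom \<beta> I (\<lambda>k. w k + t * y k) y j" for j t
  define s where "s t = smax \<beta> I (\<lambda>k. w k + t * y k)" for t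
  define f2 where "f2 t = m2 (s t) * (M 1 t)\<^sup>2 + m1 (s t) * (\<beta> * (M 2 t - M 1 t * M 1 t))" for t
  define f3 where "f3 t = m3 (s t) * (M 1 t)^3 + 3 * (m2 (s t) * (M 1 t * (\<beta> * (M 2 t - M 1 t * M 1 t))))
      + m1 (s t) * (\<beta> * (\<beta> * (M 3 t - M 2 t * M 1 t) - 2 * (M 1 t * (\<beta> * (M 2 t - M 1 t * M 1 t)))))" for t
  define d where "d n t = (if n = 0 then m (s t) else if n = 1 then m1 (s t) * M 1 t
     else if n = 2 then f2 t else f3 t)" for n :: nat and t
  have ds: "(s has_real_derivative M 1 t) (at t)" for t
    unfolding s_def M_def by (rule smax_deriv[OF I \<beta>])
  have dM: "(M j has_real_derivative \<beta> * (M (Suc j) t - M j t * M 1 t)) (at t)" for j t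
    unfolding M_def by (rule smom_deriv[OF I])
  have dM1: "(M 1 has_real_derivative \<beta> * (M 2 t - M 1 t * M 1 t)) (at t)"
    and dM2: "(M 2 has_real_derivative \<beta> * (M 3 t - M 2 t * M 1 t)) (at t)" for t
    using dM[of 1 t] dM[of 2 t] by (simp_all add: numeral_2_eq_2 numeral_3_eq_3)
  note dm = DERIV_chain2[OF m ds] and dm1 = DERIV_chain2[OF m1 ds] and dm2 = DERIV_chain2[OF m2 ds]
  have D: "\<forall>n t. n < N \<and> 0 \<le> t \<and> t \<le> 1 \<longrightarrow> (d n has_real_derivative d (Suc n) t) (at t)" if "N \<le> 3" for N
  proof (intro allI impI)
    fix n and t :: real assume "n < N \<and> 0 \<le> t \<and> t \<le> 1"
    then have "n = 0 \<or> n = 1 \<or> n = 2" using that by arith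
    then consider "n = 0" | "n = 1" | "n = 2" by blast
    then show "(d n has_real_derivative d (Suc n) t) (at t)"
    proof cases
      case 1 then show ?thesis using dm[of t] by (simp add: d_def[abs_def])
    next
      case 2
      then have [simp]: "n = Suc 0" by simp
      have "((\<lambda>t. m1 (s t) * M 1 t) has_real_derivative f2 t) (at t)"
        unfolding f2_def
        using DERIV_mult[OF dm1[of t] dM1[of t]] by (simp add: power2_eq_square algebra_simps)
      then show ?thesis by (simp add: d_def[abs_def] numeral_2_eq_2)
    next
      case 3
      have "(f2 has_real_derivative f3 t) (at t)"
        unfolding f2_def f3_def
        by (rule derivative_eq_intros dm1 dm2 dM1 dM2 refl)+
          (simp add: power2_eq_square power3_eq_cube algebra_simps numeral_2_eq_2 numeral_3_eq_3)
      then show ?thesis using 3 by (simp add: d_def[abs_def])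
    qed
  qed
  have rem: "taylor_rem \<beta> I m m1 m2 w y = d 0 1 - d 0 0 - d 1 0 - d 2 0 / 2"
    by (simp add: taylor_rem_def d_def f2_def s_def M_def power2_eq_square algebra_simps)
  have M3: "smom \<beta> I w' (\<lambda>k. \<bar>y k\<bar>) 3 \<ge> 0" for w'
    unfolding smom_def by (intro sum_nonneg mult_nonneg_nonneg softmax_nonneg) auto
  have var: "0 \<le> M 2 t - M 1 t * M 1 t" "M 2 t - M 1 t * M 1 t \<le> M 2 t" for t
    using smom_var[OF I, of \<beta> "\<lambda>k. w k + t * y k" y] by (auto simp: M_def power2_eq_square)
  \<comment> \<open>Since 1 / \<delta> is at most \<beta>, the term with the highest power of
    \<beta> and a single 1 / \<delta> dominates in every derivative.\<close>
  have id: "1 / \<delta> \<le> \<beta>" using \<delta> by (simp add: field_simps)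
  have id2: "1 / \<delta>\<^sup>2 \<le> \<beta> / \<delta>" and id3: "1 / \<delta>^3 \<le> \<beta>\<^sup>2 / \<delta>" "\<beta> / \<delta>\<^sup>2 \<le> \<beta>\<^sup>2 / \<delta>"
  proof -
    have "1 / \<delta> * (1 / \<delta>) \<le> \<beta> * (1 / \<delta>)" using id \<delta> by (intro mult_right_mono) auto
    then show 1: "1 / \<delta>\<^sup>2 \<le> \<beta> / \<delta>" by (simp add: power2_eq_square)
    have "\<beta> * (1 / \<delta>\<^sup>2) \<le> \<beta> * (\<beta> / \<delta>)" using 1 \<beta> by (intro mult_left_mono) auto
    then show 2: "\<beta> / \<delta>\<^sup>2 \<le> \<beta>\<^sup>2 / \<delta>" by (simp add: power2_eq_square)
    have "1 / \<delta> * (1 / \<delta>\<^sup>2) \<le> \<beta> * (1 / \<delta>\<^sup>2)" using id \<delta> by (intro mult_right_mono) auto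
    then show "1 / \<delta>^3 \<le> \<beta>\<^sup>2 / \<delta>" using 2 by (simp add: power2_eq_square power3_eq_cube)
  qed
  have f2b: "\<bar>f2 t\<bar> \<le> 2 * A * \<beta> / \<delta> * b\<^sup>2" for t
  proof -
    have "M 2 t \<le> b\<^sup>2" using smom_power_le[OF I, of y b \<beta> "\<lambda>k. w k + t * y k" 2, OF y]
      by (simp add: M_def)
    then have v: "\<bar>(M 1 t)\<^sup>2\<bar> \<le> b\<^sup>2" "\<bar>M 2 t - M 1 t * M 1 t\<bar> \<le> b\<^sup>2"
      using var[of t] zero_le_square[of "M 1 t"] unfolding power2_eq_square[of "M 1 t"] by linarith+
    have "\<bar>f2 t\<bar> \<le> \<bar>m2 (s t)\<bar> * \<bar>(M 1 t)\<^sup>2\<bar> + \<bar>m1 (s t)\<bar> * (\<beta> * \<bar>M 2 t - M 1 t * M 1 t\<bar>)"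
      unfolding f2_def using \<beta> by (intro order_trans[OF abs_triangle_ineq]) (simp add: abs_mult)
    also have "\<dots> \<le> A / \<delta>\<^sup>2 * b\<^sup>2 + A / \<delta> * (\<beta> * b\<^sup>2)"
      using \<beta> \<delta> A by (intro add_mono mult_mono b1 b2 v mult_nonneg_nonneg) auto
    also have "\<dots> \<le> A * (\<beta> / \<delta>) * b\<^sup>2 + A / \<delta> * (\<beta> * b\<^sup>2)"
      using mult_left_mono[OF id2 A] \<beta> by (intro add_mono mult_right_mono) auto
    finally show ?thesis by (simp add: algebra_simps)
  qed
  show ?thesis
  proof (cases "b \<le> 1 / \<beta>")
    case True
    have "\<exists>t. 0 < t \<and> t < 1 \<and> d 0 1 = (\<Sum>m<3. d m 0 / fact m * 1 ^ m) + d 3 t / fact 3 * 1 ^ 3"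
      by (rule Maclaurin) (use D[of 3] in auto)
    then obtain t where t: "0 < t" "t < 1" and "d 0 1 = d 0 0 + d 1 0 + d 2 0 / 2 + d 3 t / 6"
      by (auto simp: numeral_3_eq_3 numeral_2_eq_2 fact_numeral)
    then have R: "taylor_rem \<beta> I m m1 m2 w y = f3 t / 6" unfolding rem by (simp add: d_def)
    define V where "V = smom \<beta> I (\<lambda>k. w k + t * y k) (\<lambda>k. \<bar>y k\<bar>) 3"
    have V0: "V \<ge> 0" unfolding V_def by (rule M3)
    \<comment> \<open>The intermediate point differs from \<open>w\<close> by at most 1 / \<beta> in
      each coordinate. Replacing its weights by those at \<open>w\<close> makes them independent of
      \<open>y\<close>, so that the expectation can later be taken inside the average.\<close>
    have V: "V \<le> exp 2 * smom \<beta> I w (\<lambda>k. \<bar>y k\<bar>) 3"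
      unfolding V_def using t True y by (intro smom_stable[OF I \<beta>]) fastforce+
    have a1: "\<bar>M 1 t ^ 3\<bar> \<le> 2 * V" unfolding V_def M_def power_abs by (rule smom_1_cubed_le_3[OF I])
    have a2: "\<bar>M 1 t\<bar> * M 2 t \<le> 2 * V" unfolding V_def M_def by (rule smom_12_le_3[OF I])
    have "M 2 t \<ge> 0" using var[of t] zero_le_square[of "M 1 t"] by linarith
    then have a2': "\<bar>M 2 t * M 1 t\<bar> \<le> 2 * V" using a2 by (simp add: abs_mult mult.commute)
    have a3: "\<bar>M 1 t * (M 2 t - M 1 t * M 1 t)\<bar> \<le> 2 * V"
    proof -
      have "\<bar>M 1 t * (M 2 t - M 1 t * M 1 t)\<bar> = \<bar>M 1 t\<bar> * (M 2 t - M 1 t * M 1 t)"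
        using var[of t] by (simp add: abs_mult)
      also have "\<dots> \<le> \<bar>M 1 t\<bar> * M 2 t" using var[of t] by (intro mult_left_mono) auto
      finally show ?thesis using a2 by simp
    qed
    have a4: "\<bar>M 3 t\<bar> \<le> V" unfolding V_def M_def by (rule smom_abs_le[OF I])
    \<comment> \<open>7 = 1 + 2 + 2 * 2, from \<open>a4\<close>, \<open>a2'\<close> and twice
      \<open>a3\<close>.\<close>
    have a5: "\<bar>(M 3 t - M 2 t * M 1 t) - 2 * (M 1 t * (M 2 t - M 1 t * M 1 t))\<bar> \<le> 7 * V"
      using a2' a3 a4 by linarith
    have "\<bar>f3 t\<bar> = \<bar>m3 (s t) * (M 1 t)^3 + 3 * \<beta> * (m2 (s t) * (M 1 t * (M 2 t - M 1 t * M 1 t)))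
      + \<beta>\<^sup>2 * (m1 (s t) * ((M 3 t - M 2 t * M 1 t) - 2 * (M 1 t * (M 2 t - M 1 t * M 1 t))))\<bar>"
      unfolding f3_def by (rule arg_cong[where f=abs]) (simp add: algebra_simps power2_eq_square)
    also have "\<dots> \<le> \<bar>m3 (s t)\<bar> * \<bar>(M 1 t)^3\<bar> + 3 * \<beta> * (\<bar>m2 (s t)\<bar> * \<bar>M 1 t * (M 2 t - M 1 t * M 1 t)\<bar>)
      + \<beta>\<^sup>2 * (\<bar>m1 (s t)\<bar> * \<bar>(M 3 t - M 2 t * M 1 t) - 2 * (M 1 t * (M 2 t - M 1 t * M 1 t))\<bar>)"
      using \<beta> by (intro order_trans[OF abs_triangle_ineq] add_mono) (simp_all add: abs_mult)
    also have "\<dots> \<le> A / \<delta>^3 * (2 * V) + 3 * \<beta> * (A / \<delta>\<^sup>2 * (2 * V)) + \<beta>\<^sup>2 * (A / \<delta> * (7 * V))"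
      using \<beta> \<delta> A V0 by (intro add_mono mult_left_mono mult_mono b1 b2 b3 a1 a3 a5) auto
    also have "\<dots> = A * (1 / \<delta>^3) * (2 * V) + A * (\<beta> / \<delta>\<^sup>2) * (6 * V) + A * (\<beta>\<^sup>2 / \<delta>) * (7 * V)"
      by (simp add: algebra_simps)
    also have "\<dots> \<le> A * (\<beta>\<^sup>2 / \<delta>) * (2 * V) + A * (\<beta>\<^sup>2 / \<delta>) * (6 * V) + A * (\<beta>\<^sup>2 / \<delta>) * (7 * V)"
      using V0 by (intro add_mono mult_right_mono mult_left_mono id3 A) auto
    \<comment> \<open>15 = 2 + 6 + 7; division by 3! leaves 5/2, rounded up to 3 below.\<close>
    also have "\<dots> = A * \<beta>\<^sup>2 / \<delta> * (15 * V)" by (simp add: algebra_simps)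
    also have "\<dots> \<le> A * \<beta>\<^sup>2 / \<delta> * (15 * (exp 2 * smom \<beta> I w (\<lambda>k. \<bar>y k\<bar>) 3))"
      using V A \<delta> by (intro mult_left_mono) auto
    finally have "\<bar>taylor_rem \<beta> I m m1 m2 w y\<bar> \<le> A * \<beta>\<^sup>2 / \<delta> * (5/2 * (exp 2 * smom \<beta> I w (\<lambda>k. \<bar>y k\<bar>) 3))"
      unfolding R by (simp add: mult_ac)
    also have "\<dots> \<le> A * \<beta>\<^sup>2 / \<delta> * (3 * exp 2 * smom \<beta> I w (\<lambda>k. \<bar>y k\<bar>) 3)"
      using M3[of w] A \<delta> by (intro mult_left_mono) auto
    also have "\<dots> \<le> A * \<beta>\<^sup>2 / \<delta> * (3 * exp 2 * smom \<beta> I w (\<lambda>k. \<bar>y k\<bar>) 3) + 2 * A * \<beta>^3 / \<delta> * b ^ 4"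
      using A \<beta> \<delta> by simp
    finally show ?thesis .
  next
    case False
    have "\<exists>t. 0 < t \<and> t < 1 \<and> d 0 1 = (\<Sum>m<2. d m 0 / fact m * 1 ^ m) + d 2 t / fact 2 * 1 ^ 2"
      by (rule Maclaurin) (use D[of 2] in auto)
    then obtain t where t: "0 < t" "t < 1" and "d 0 1 = d 0 0 + d 1 0 + d 2 t / 2"
      by (auto simp: numeral_2_eq_2 fact_numeral)
    \<comment> \<open>The Lagrange remainder of order 2 against the quadratic term at 0 leaves half
      an increment of the second derivative, so the two uniform bounds \<open>f2b\<close>
      suffice.\<close>
    then have R: "taylor_rem \<beta> I m m1 m2 w y = (f2 t - f2 0) / 2" unfolding rem by (simp add: d_def field_simps)
    have "\<bar>taylor_rem \<beta> I m m1 m2 w y\<bar> \<le> 2 * A * \<beta> / \<delta> * b\<^sup>2" 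
    proof -
      define e where "e = 2 * A * \<beta> / \<delta> * b\<^sup>2"
      have "\<bar>f2 t\<bar> \<le> e" "\<bar>f2 0\<bar> \<le> e" using f2b unfolding e_def by auto
      then show ?thesis unfolding R e_def[symmetric] by (simp add: abs_le_iff)
    qed
    also have "\<dots> \<le> 2 * A * \<beta> / \<delta> * (b\<^sup>2 * (\<beta> * b)\<^sup>2)"
    proof (intro mult_left_mono)
      have "1 \<le> \<beta> * b" using False \<beta> by (simp add: field_simps)
      then have "b\<^sup>2 * 1 \<le> b\<^sup>2 * (\<beta> * b)\<^sup>2" by (intro mult_left_mono) auto
      then show "b\<^sup>2 \<le> b\<^sup>2 * (\<beta> * b)\<^sup>2" by simp
    qed (use A \<beta> \<delta> in auto)
    also have "\<dots> = 2 * A * \<beta>^3 / \<delta> * b ^ 4"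
      by (simp add: power2_eq_square power3_eq_cube power4_eq_xxxx)
    also have "\<dots> \<le> A * \<beta>\<^sup>2 / \<delta> * (3 * exp 2 * smom \<beta> I w (\<lambda>k. \<bar>y k\<bar>) 3) + 2 * A * \<beta>^3 / \<delta> * b ^ 4"
      using A \<beta> \<delta> M3[of w] by simp
    finally show ?thesis .
  qed
qed

section \<open>A smooth step function\<close>

definition clamp01 :: "real \<Rightarrow> real" where "clamp01 s = max 0 (min 1 s)"

text \<open>The kinks of \<open>clamp01\<close> sit at 0 and 1, where \<open>f'\<close> vanishes, so
  composing with the clamp stays differentiable. Applied to successive derivatives, this makes the
  clamped polynomial below three times differentiable on the whole line.\<close>

lemma clamp01_deriv:
  assumes f: "\<And>u. (f has_real_derivative f' u) (at u)" and 0: "f' 0 = 0" "f' 1 = 0"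
  shows "((\<lambda>s. f (clamp01 s)) has_real_derivative f' (clamp01 s)) (at s)"
proof -
  \<comment> \<open>At an endpoint c, Caratheodory's form f z - f c = g z (z - c) has g continuous
    with g c = 0. The clamp fixes c and does not increase distances to it, so the difference
    quotient is at most |g (clamp01 z)|, which tends to 0.\<close>
  have flat: "((\<lambda>s. f (clamp01 s)) has_real_derivative 0) (at c)" if c: "clamp01 c = c" "f' c = 0" for c
  proof -
    obtain g where g: "\<And>z. f z - f c = g z * (z - c)" "isCont g c" "g c = 0"
      using f[of c] c unfolding CARAT_DERIV by metis
    have cl: "\<bar>clamp01 z - c\<bar> \<le> \<bar>z - c\<bar>" for z
      using c(1) by (auto simp: clamp01_def max_def min_def split: if_splits)
    have cc: "isCont clamp01 c" unfolding clamp01_def[abs_def] by (intro continuous_intros)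
    have g0: "(\<lambda>z. g (clamp01 z)) \<midarrow>c\<rightarrow> 0"
      using isCont_o2[OF cc, of g] g c by (simp add: isCont_def)
    have "(\<lambda>z. (f (clamp01 z) - f (clamp01 c)) / (z - c)) \<midarrow>c\<rightarrow> 0"
    proof (rule Lim_null_comparison[OF _ tendsto_norm_zero[OF g0]])
      show "\<forall>\<^sub>F z in at c. norm ((f (clamp01 z) - f (clamp01 c)) / (z - c)) \<le> norm (g (clamp01 z))"
      proof (rule eventually_mono[OF eventually_at_ball'[of 1 c UNIV]])
        fix z :: real assume "z \<in> ball c 1 \<and> z \<noteq> c \<and> z \<in> UNIV"
        then have z: "z \<noteq> c" by simp
        have "norm ((f (clamp01 z) - f (clamp01 c)) / (z - c)) = \<bar>g (clamp01 z)\<bar> * (\<bar>clamp01 z - c\<bar> / \<bar>z - c\<bar>)"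
          by (simp add: c g abs_mult)
        also have "\<dots> \<le> \<bar>g (clamp01 z)\<bar> * 1" using cl[of z] z by (intro mult_left_mono) (auto simp: divide_simps)
        finally show "norm ((f (clamp01 z) - f (clamp01 c)) / (z - c)) \<le> norm (g (clamp01 z))" by simp
      qed auto
    qed
    then show ?thesis by (simp add: has_field_derivative_iff)
  qed
  consider "s < 0" | "s = 0" | "0 < s \<and> s < 1" | "s = 1" | "s > 1" by linarith
  then show ?thesis
  proof cases
    case 1
    have "((\<lambda>s. f 0) has_real_derivative 0) (at s)" by simp
    then have "((\<lambda>s. f (clamp01 s)) has_real_derivative 0) (at s)"
      by (rule has_field_derivative_transform_within_open[of _ _ _ "{..<0}"]) (use 1 in \<open>auto simp: clamp01_def\<close>)
    then show ?thesis using 1 0 by (simp add: clamp01_def)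
  next
    case 2 then show ?thesis using flat[of 0] 0 by (simp add: clamp01_def)
  next
    case 3
    have "((\<lambda>s. f (clamp01 s)) has_real_derivative f' s) (at s)"
      by (rule has_field_derivative_transform_within_open[OF f, of "{0<..<1}"]) (use 3 in \<open>auto simp: clamp01_def\<close>)
    then show ?thesis using 3 by (simp add: clamp01_def)
  next
    case 4 then show ?thesis using flat[of 1] 0 by (simp add: clamp01_def)
  next
    case 5
    have "((\<lambda>s. f 1) has_real_derivative 0) (at s)" by simp
    then have "((\<lambda>s. f (clamp01 s)) has_real_derivative 0) (at s)"
      by (rule has_field_derivative_transform_within_open[of _ _ _ "{1<..}"]) (use 5 in \<open>auto simp: clamp01_def\<close>)
    then show ?thesis using 5 0 by (simp add: clamp01_def)
  qed
qed

text \<open>A \<open>C\<^sup>3\<close> step from 1 down to 0 on the unit interval: \<open>-140 u\<^sup>3 (1 - u)\<^sup>3\<close> is minus the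
  normalised beta density, so its primitive vanishes to third order at both ends.\<close>
definition step0 :: "real \<Rightarrow> real" where "step0 s = (let u = clamp01 s in (1 - u)^4 * (1 + 4*u + 10*u^2 + 20*u^3))"
definition step1 :: "real \<Rightarrow> real" where "step1 s = (let u = clamp01 s in - 140 * (u * (1 - u))^3)"
definition step2 :: "real \<Rightarrow> real" where "step2 s = (let u = clamp01 s in - 420 * (u * (1 - u))^2 * (1 - 2 * u))"
definition step3 :: "real \<Rightarrow> real" where
  "step3 s = (let u = clamp01 s in - 840 * (u * (1 - u)) * (1 - 2 * u)^2 + 840 * (u * (1 - u))^2)"

lemma clamp01_bounds: "0 \<le> clamp01 s" "clamp01 s \<le> 1" by (auto simp: clamp01_def)

lemma step0_deriv: "(step0 has_real_derivative step1 s) (at s)"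
  unfolding step0_def[abs_def] step1_def Let_def
  by (rule clamp01_deriv[where f'="\<lambda>u. - 140 * (u * (1 - u))^3"])
    (auto intro!: derivative_eq_intros simp: eval_nat_numeral algebra_simps)

lemma step1_deriv: "(step1 has_real_derivative step2 s) (at s)"
  unfolding step1_def[abs_def] step2_def Let_def
  by (rule clamp01_deriv[where f'="\<lambda>u. - 420 * (u * (1 - u))^2 * (1 - 2 * u)"])
    (auto intro!: derivative_eq_intros simp: eval_nat_numeral algebra_simps)

lemma step2_deriv: "(step2 has_real_derivative step3 s) (at s)"
  unfolding step2_def[abs_def] step3_def Let_def
  by (rule clamp01_deriv[where f'="\<lambda>u. - 840 * (u * (1 - u)) * (1 - 2 * u)^2 + 840 * (u * (1 - u))^2"])
    (auto intro!: derivative_eq_intros simp: eval_nat_numeral algebra_simps)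

lemma step_bounds:
  "0 \<le> step0 s" "step0 s \<le> 1" "\<bar>step1 s\<bar> \<le> 840" "\<bar>step2 s\<bar> \<le> 840" "\<bar>step3 s\<bar> \<le> 1680"
proof -
  define u where "u = clamp01 s"
  have u: "0 \<le> u" "u \<le> 1" using clamp01_bounds by (auto simp: u_def)
  define v where "v = u * (1 - u)"
  have v: "0 \<le> v" "v \<le> 1" using u by (auto simp: v_def mult_le_one)
  have vp: "v ^ j \<le> 1" "0 \<le> v ^ j" for j using v by (auto simp: power_le_one)
  have w: "\<bar>1 - 2 * u\<bar> \<le> 1" using u by auto
  have w2: "(1 - 2 * u)\<^sup>2 \<le> 1" "0 \<le> (1 - 2 * u)\<^sup>2" using w by (auto simp: abs_square_le_1)
  show "0 \<le> step0 s" unfolding step0_def Let_def u_def[symmetric] using u by auto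
  \<comment> \<open>The symmetry u \<mapsto> 1 - u of the beta density exhibits 1 minus the step as
    a polynomial with visibly nonnegative terms.\<close>
  have "1 - step0 s = u^4 * (1 + 4*(1-u) + 10*(1-u)^2 + 20*(1-u)^3)"
    unfolding step0_def Let_def u_def[symmetric] by (simp add: eval_nat_numeral algebra_simps)
  moreover have "\<dots> \<ge> 0" using u by auto
  ultimately show "step0 s \<le> 1" by simp
  show "\<bar>step1 s\<bar> \<le> 840" unfolding step1_def Let_def u_def[symmetric] v_def[symmetric] using vp[of 3] by (simp add: abs_mult)
  have "\<bar>v\<^sup>2 * (1 - 2 * u)\<bar> \<le> 1 * 1" unfolding abs_mult using vp[of 2] w by (intro mult_mono) auto
  then show "\<bar>step2 s\<bar> \<le> 840" unfolding step2_def Let_def u_def[symmetric] v_def[symmetric] by (simp add: abs_mult)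
  have "\<bar>v * (1 - 2 * u)\<^sup>2\<bar> \<le> 1 * 1" unfolding abs_mult using v w2 by (intro mult_mono) auto
  moreover have "step3 s = 840 * v\<^sup>2 - 840 * (v * (1 - 2 * u)\<^sup>2)"
    by (simp add: step3_def Let_def u_def[symmetric] v_def[symmetric])
  ultimately show "\<bar>step3 s\<bar> \<le> 1680" using vp[of 2] by linarith
qed

lemma step0_eq_1: "s \<le> 0 \<Longrightarrow> step0 s = 1" and step0_eq_0: "1 \<le> s \<Longrightarrow> step0 s = 0"
  by (auto simp: step0_def clamp01_def)

lemma step0_scaled_deriv:
  assumes "\<delta> > 0"
  shows "((\<lambda>s. step0 ((s - c) / \<delta>)) has_real_derivative step1 ((s - c) / \<delta>) / \<delta>) (at s)"
    "((\<lambda>s. step1 ((s - c) / \<delta>) / \<delta>) has_real_derivative step2 ((s - c) / \<delta>) / \<delta>\<^sup>2) (at s)"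
    "((\<lambda>s. step2 ((s - c) / \<delta>) / \<delta>\<^sup>2) has_real_derivative step3 ((s - c) / \<delta>) / \<delta>^3) (at s)"
proof -
  have d: "((\<lambda>s. (s - c) / \<delta>) has_real_derivative 1 / \<delta>) (at s)"
    using assms by (auto intro!: derivative_eq_intros)
  show "((\<lambda>s. step0 ((s - c) / \<delta>)) has_real_derivative step1 ((s - c) / \<delta>) / \<delta>) (at s)"
    using DERIV_chain2[OF step0_deriv d] by simp
  show "((\<lambda>s. step1 ((s - c) / \<delta>) / \<delta>) has_real_derivative step2 ((s - c) / \<delta>) / \<delta>\<^sup>2) (at s)"
    using DERIV_cdivide[OF DERIV_chain2[OF step1_deriv d], of \<delta>] by (simp add: power2_eq_square)
  show "((\<lambda>s. step2 ((s - c) / \<delta>) / \<delta>\<^sup>2) has_real_derivative step3 ((s - c) / \<delta>) / \<delta>^3) (at s)"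
    using DERIV_cdivide[OF DERIV_chain2[OF step2_deriv d], of "\<delta>\<^sup>2"] by (simp add: power2_eq_square power3_eq_cube mult.assoc)
qed

lemma step_measurable[measurable]:
  "step0 \<in> borel_measurable borel" "step1 \<in> borel_measurable borel" "step2 \<in> borel_measurable borel"
  unfolding step0_def[abs_def] step1_def[abs_def] step2_def[abs_def] clamp01_def[abs_def] Let_def by measurable

section \<open>Lindeberg swapping\<close>

text \<open>The second-moment matrix carried as a quadratic form. Equality of these forms for all
  \<open>a\<close> is exactly the moment matching used in a swap.\<close>

definition moment_form :: "'a measure \<Rightarrow> 'i set \<Rightarrow> ('a \<Rightarrow> 'i \<Rightarrow> real) \<Rightarrow> ('i \<Rightarrow> real) \<Rightarrow> real" where
  "moment_form M I Y a = (\<integral>x. (\<Sum>k\<in>I. a k * Y x k)\<^sup>2 \<partial>M)"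

lemma integrable_le_power4:
  fixes b :: "'a \<Rightarrow> real"
  assumes "finite_measure M" "b \<in> borel_measurable M" "integrable M (\<lambda>x. b x ^ 4)" "j \<le> 4"
  shows "integrable M (\<lambda>x. b x ^ j)"
proof (rule Bochner_Integration.integrable_bound)
  interpret finite_measure M by fact
  show "integrable M (\<lambda>x. 1 + b x ^ 4)" using assms by auto
  show "(\<lambda>x. b x ^ j) \<in> borel_measurable M" using assms by auto
  have "\<bar>b x\<bar> ^ j \<le> 1 + \<bar>b x\<bar> ^ 4" for x
  proof (cases "\<bar>b x\<bar> \<le> 1")
    case True then show ?thesis using power_le_one[of "\<bar>b x\<bar>" j] by (simp add: add_increasing2)
  next
    case False
    then have "\<bar>b x\<bar> ^ j \<le> \<bar>b x\<bar> ^ 4" using assms by (intro power_increasing) auto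
    then show ?thesis by simp
  qed
  then show "AE x in M. norm (b x ^ j) \<le> norm (1 + b x ^ 4)"
    by (simp add: power_abs)
qed

text \<open>\<kappa> bounds the third absolute moment of each single coordinate, \<tau> the fourth
  moment of an envelope of all coordinates. Keeping them apart is what avoids a maximum inside the
  third-moment expectation.\<close>

locale small_vector = prob_space M for M :: "'a measure" +
  fixes I :: "'i set" and Y :: "'a \<Rightarrow> 'i \<Rightarrow> real" and b :: "'a \<Rightarrow> real" and \<kappa> \<tau> :: real
  assumes I: "finite I" "I \<noteq> {}"
    and Y_meas[measurable]: "\<And>k. k \<in> I \<Longrightarrow> (\<lambda>x. Y x k) \<in> borel_measurable M"
    and b_meas[measurable]: "b \<in> borel_measurable M"
    and Y_le: "\<And>x k. x \<in> space M \<Longrightarrow> k \<in> I \<Longrightarrow> \<bar>Y x k\<bar> \<le> b x"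
    and b4: "integrable M (\<lambda>x. b x ^ 4)" "(\<integral>x. b x ^ 4 \<partial>M) \<le> \<tau>"
    and Y3: "\<And>k. k \<in> I \<Longrightarrow> (\<integral>x. \<bar>Y x k\<bar> ^ 3 \<partial>M) \<le> \<kappa>"
    and Y1: "\<And>k. k \<in> I \<Longrightarrow> (\<integral>x. Y x k \<partial>M) = 0"
begin

lemma integrable_dom:
  assumes "f \<in> borel_measurable M" "\<And>x. x \<in> space M \<Longrightarrow> \<bar>f x\<bar> \<le> b x ^ j" "j \<le> 4"
  shows "integrable M (f :: _ \<Rightarrow> real)"
  using integrable_le_power4[OF finite_measure_axioms b_meas b4(1) assms(3)] assms(1)
  by (rule Bochner_Integration.integrable_bound) (auto intro!: AE_I2 order_trans[OF assms(2)])

text \<open>The linear Taylor term integrates to 0 by centering, and the quadratic one depends on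
  the law of \<open>Y\<close> only through \<open>moment_form\<close>. Two vectors with the same
  form thus share the same approximation.\<close>

lemma taylor_expectation:
  assumes \<beta>: "\<beta> > 0" and \<delta>: "\<delta> > 0" "\<beta> * \<delta> \<ge> 1" and A: "A \<ge> 0"
    and m: "\<And>s. (m has_real_derivative m1 s) (at s)"
    and m1: "\<And>s. (m1 has_real_derivative m2 s) (at s)"
    and m2: "\<And>s. (m2 has_real_derivative m3 s) (at s)"
    and b0: "\<And>s. \<bar>m s\<bar> \<le> 1"
    and b1: "\<And>s. \<bar>m1 s\<bar> \<le> A / \<delta>" and b2: "\<And>s. \<bar>m2 s\<bar> \<le> A / \<delta>\<^sup>2" and b3: "\<And>s. \<bar>m3 s\<bar> \<le> A / \<delta>^3"
    and [measurable]: "m \<in> borel_measurable borel"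
  shows "\<bar>(\<integral>x. m (smax \<beta> I (\<lambda>k. w k + Y x k)) \<partial>M)
      - (m (smax \<beta> I w) + (m2 (smax \<beta> I w) * moment_form M I Y (softmax \<beta> I w)
        + m1 (smax \<beta> I w) * \<beta> * ((\<Sum>k\<in>I. softmax \<beta> I w k * moment_form M I Y (\<lambda>j. if j = k then 1 else 0))
             - moment_form M I Y (softmax \<beta> I w))) / 2)\<bar>
    \<le> A * \<beta>\<^sup>2 / \<delta> * (3 * exp 2 * \<kappa>) + 2 * A * \<beta>^3 / \<delta> * \<tau>"
proof -
  let ?s = "smax \<beta> I w" and ?w = "softmax \<beta> I w"
  have iY: "integrable M (\<lambda>x. Y x k)" "integrable M (\<lambda>x. (Y x k)\<^sup>2)" "integrable M (\<lambda>x. \<bar>Y x k\<bar> ^ 3)" if k: "k \<in> I" for k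
  proof -
    have p: "\<bar>Y x k\<bar> ^ j \<le> b x ^ j" if "x \<in> space M" for x j
      using Y_le[OF that k] by (intro power_mono) auto
    show "integrable M (\<lambda>x. Y x k)" using k p[of _ 1] by (intro integrable_dom[where j=1]) auto
    show "integrable M (\<lambda>x. (Y x k)\<^sup>2)" using k p[of _ 2] by (intro integrable_dom[where j=2]) auto
    show "integrable M (\<lambda>x. \<bar>Y x k\<bar> ^ 3)" using k p[of _ 3] by (intro integrable_dom[where j=3]) auto
  qed
  have im1: "integrable M (\<lambda>x. smom \<beta> I w (Y x) 1)" unfolding smom_def using iY by auto
  have im2: "integrable M (\<lambda>x. smom \<beta> I w (Y x) 2)" unfolding smom_def using iY by auto
  have im3: "integrable M (\<lambda>x. smom \<beta> I w (\<lambda>k. \<bar>Y x k\<bar>) 3)" unfolding smom_def using iY by auto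
  have im1s: "integrable M (\<lambda>x. (smom \<beta> I w (Y x) 1)\<^sup>2)"
  proof (rule integrable_dom[where j=2])
    fix x assume "x \<in> space M"
    then have "\<bar>smom \<beta> I w (Y x) 1\<bar> \<le> b x ^ 1" by (intro smom_power_le I Y_le)
    then have "\<bar>smom \<beta> I w (Y x) 1\<bar> ^ 2 \<le> b x ^ 2" by (intro power_mono) auto
    then show "\<bar>(smom \<beta> I w (Y x) 1)\<^sup>2\<bar> \<le> b x ^ 2" by simp
  qed auto
  have im: "integrable M (\<lambda>x. m (smax \<beta> I (\<lambda>k. w k + Y x k)))"
    by (rule integrable_const_bound[where B=1]) (use b0 in auto)
  have e1: "(\<integral>x. smom \<beta> I w (Y x) 1 \<partial>M) = 0"
    unfolding smom_def using iY Y1 by (subst Bochner_Integration.integral_sum) auto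
  have e1s: "(\<integral>x. (smom \<beta> I w (Y x) 1)\<^sup>2 \<partial>M) = moment_form M I Y ?w"
    by (simp add: smom_def moment_form_def)
  \<comment> \<open>Unit vectors recover the diagonal of the second-moment matrix from the
    form.\<close>
  have u: "moment_form M I Y (\<lambda>j. if j = k then 1 else 0) = (\<integral>x. (Y x k)\<^sup>2 \<partial>M)" if "k \<in> I" for k
    unfolding moment_form_def using that I by (intro Bochner_Integration.integral_cong refl) (simp add: if_distrib[of "\<lambda>z. z * _"] cong: if_cong)
  have e2: "(\<integral>x. smom \<beta> I w (Y x) 2 \<partial>M) = (\<Sum>k\<in>I. ?w k * moment_form M I Y (\<lambda>j. if j = k then 1 else 0))"
    unfolding smom_def using iY u by (subst Bochner_Integration.integral_sum) auto
  have e3: "(\<integral>x. smom \<beta> I w (\<lambda>k. \<bar>Y x k\<bar>) 3 \<partial>M) \<le> \<kappa>"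
  proof -
    have "(\<integral>x. smom \<beta> I w (\<lambda>k. \<bar>Y x k\<bar>) 3 \<partial>M) = (\<Sum>k\<in>I. ?w k * (\<integral>x. \<bar>Y x k\<bar> ^ 3 \<partial>M))"
      unfolding smom_def using iY by (subst Bochner_Integration.integral_sum) auto
    also have "\<dots> \<le> \<kappa>" by (rule softmax_avg_le[OF I Y3])
    finally show ?thesis .
  qed
  define R where "R x = taylor_rem \<beta> I m m1 m2 w (Y x)" for x
  have iR: "integrable M R" unfolding R_def[abs_def] taylor_rem_def using im im1 im2 im1s by auto
  have "(\<integral>x. R x \<partial>M) = (\<integral>x. m (smax \<beta> I (\<lambda>k. w k + Y x k)) \<partial>M) - m ?s - m1 ?s * 0
     - (m2 ?s * moment_form M I Y ?w + m1 ?s * \<beta> * ((\<Sum>k\<in>I. ?w k * moment_form M I Y (\<lambda>j. if j = k then 1 else 0)) - moment_form M I Y ?w)) / 2"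
    unfolding R_def taylor_rem_def using im im1 im2 im1s e1 e1s e2 by (simp add: prob_space del: One_nat_def)
  then have "\<bar>(\<integral>x. m (smax \<beta> I (\<lambda>k. w k + Y x k)) \<partial>M) - (m ?s
     + (m2 ?s * moment_form M I Y ?w + m1 ?s * \<beta> * ((\<Sum>k\<in>I. ?w k * moment_form M I Y (\<lambda>j. if j = k then 1 else 0)) - moment_form M I Y ?w)) / 2)\<bar>
     = \<bar>\<integral>x. R x \<partial>M\<bar>" by simp
  also have "\<dots> \<le> (\<integral>x. \<bar>R x\<bar> \<partial>M)" by (rule integral_abs_bound)
  also have "\<dots> \<le> (\<integral>x. A * \<beta>\<^sup>2 / \<delta> * (3 * exp 2 * smom \<beta> I w (\<lambda>k. \<bar>Y x k\<bar>) 3) + 2 * A * \<beta>^3 / \<delta> * b x ^ 4 \<partial>M)"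
  proof (rule integral_mono)
    fix x assume "x \<in> space M"
    then show "\<bar>R x\<bar> \<le> A * \<beta>\<^sup>2 / \<delta> * (3 * exp 2 * smom \<beta> I w (\<lambda>k. \<bar>Y x k\<bar>) 3) + 2 * A * \<beta>^3 / \<delta> * b x ^ 4"
      unfolding R_def by (intro taylor_rem_bound[OF I \<beta> \<delta> A m m1 m2 b1 b2 b3] Y_le)
  qed (use iR im3 b4 in auto)
  also have "\<dots> = A * \<beta>\<^sup>2 / \<delta> * (3 * exp 2 * (\<integral>x. smom \<beta> I w (\<lambda>k. \<bar>Y x k\<bar>) 3 \<partial>M)) + 2 * A * \<beta>^3 / \<delta> * (\<integral>x. b x ^ 4 \<partial>M)"
    using im3 b4 by simp
  also have "\<dots> \<le> A * \<beta>\<^sup>2 / \<delta> * (3 * exp 2 * \<kappa>) + 2 * A * \<beta>^3 / \<delta> * \<tau>"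
    using e3 b4 A \<beta> \<delta> by (intro add_mono mult_left_mono) auto
  finally show ?thesis .
qed

end

lemma PiM_lessThan_Suc_integral:
  fixes f :: "(nat \<Rightarrow> 'a) \<Rightarrow> real"
  assumes "prob_space M" "integrable (PiM {..<Suc n} (\<lambda>_. M)) f"
  shows "(\<integral>x. f x \<partial>PiM {..<Suc n} (\<lambda>_. M)) = (\<integral>x. (\<integral>y. f (x(n := y)) \<partial>M) \<partial>PiM {..<n} (\<lambda>_. M))"
proof -
  interpret M: prob_space M by fact
  interpret product_sigma_finite "\<lambda>_. M" ..
  show ?thesis using assms(2) unfolding lessThan_Suc by (intro product_integral_insert) auto
qed

lemma abs_integral_le_1:
  fixes u :: "'a \<Rightarrow> real"
  assumes "prob_space L" "\<And>x. \<bar>u x\<bar> \<le> 1"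
  shows "\<bar>\<integral>x. u x \<partial>L\<bar> \<le> 1"
proof (cases "integrable L u")
  case True
  interpret prob_space L by fact
  have "\<bar>\<integral>x. u x \<partial>L\<bar> \<le> (\<integral>x. \<bar>u x\<bar> \<partial>L)" by (rule integral_abs_bound)
  also have "\<dots> \<le> (\<integral>x. 1 \<partial>L)" by (rule integral_mono) (use True assms in auto)
  finally show ?thesis by (simp add: prob_space)
\<comment> \<open>Without integrability the Bochner integral is 0 by convention.\<close>
qed (simp add: not_integrable_integral_eq)

lemma abs_integral_diff_le:
  fixes u v :: "'a \<Rightarrow> real"
  assumes "prob_space L" and [measurable]: "u \<in> borel_measurable L" "v \<in> borel_measurable L"
    and "\<And>x. \<bar>u x\<bar> \<le> 1" "\<And>x. \<bar>v x\<bar> \<le> 1" "\<And>x. \<bar>u x - v x\<bar> \<le> e"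
  shows "\<bar>(\<integral>x. u x \<partial>L) - (\<integral>x. v x \<partial>L)\<bar> \<le> e"
proof -
  interpret prob_space L by fact
  have i: "integrable L u" "integrable L v"
    using assms by (auto intro!: integrable_const_bound[where B=1])
  then have "\<bar>(\<integral>x. u x \<partial>L) - (\<integral>x. v x \<partial>L)\<bar> = \<bar>\<integral>x. u x - v x \<partial>L\<bar>" by simp
  also have "\<dots> \<le> (\<integral>x. \<bar>u x - v x\<bar> \<partial>L)" by (rule integral_abs_bound)
  also have "\<dots> \<le> (\<integral>x. e \<partial>L)" by (rule integral_mono) (use i assms in auto)
  finally show ?thesis by (simp add: prob_space)
qed

lemma fubini_bounded:
  fixes g :: "'a \<Rightarrow> 'b \<Rightarrow> real"
  assumes "prob_space P" "prob_space M" and [measurable]: "(\<lambda>z. g (fst z) (snd z)) \<in> borel_measurable (P \<Otimes>\<^sub>M M)"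
    and "\<And>x y. \<bar>g x y\<bar> \<le> 1"
  shows "(\<integral>x. (\<integral>y. g x y \<partial>M) \<partial>P) = (\<integral>y. (\<integral>x. g x y \<partial>P) \<partial>M)"
    and "(\<lambda>y. \<integral>x. g x y \<partial>P) \<in> borel_measurable M"
    and "(\<lambda>x. \<integral>y. g x y \<partial>M) \<in> borel_measurable P"
proof -
  interpret P: prob_space P by fact
  interpret M: prob_space M by fact
  interpret PM: pair_prob_space P M ..
  have [measurable]: "case_prod g \<in> borel_measurable (P \<Otimes>\<^sub>M M)" using assms(3) by (simp add: case_prod_beta')
  have [measurable]: "(\<lambda>(y, x). g x y) \<in> borel_measurable (M \<Otimes>\<^sub>M P)" by (simp add: case_prod_beta')
  show "(\<lambda>y. \<integral>x. g x y \<partial>P) \<in> borel_measurable M"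
    by (rule P.borel_measurable_lebesgue_integral) measurable
  show "(\<lambda>x. \<integral>y. g x y \<partial>M) \<in> borel_measurable P"
    by (rule M.borel_measurable_lebesgue_integral) measurable
  show "(\<integral>x. (\<integral>y. g x y \<partial>M) \<partial>P) = (\<integral>y. (\<integral>x. g x y \<partial>P) \<partial>M)"
    by (rule PM.Fubini_integral[symmetric])
      (use assms in \<open>auto intro!: PM.P.integrable_const_bound[where B=1]\<close>)
qed

text \<open>The quadratic approximations of both sides agree by \<open>cov\<close>, so one swap
  costs only the two Taylor errors. The free shift \<open>w\<close> carries whatever is held fixed,
  and must be general for the induction on \<open>n\<close>.\<close>

lemma lindeberg:
  fixes Y :: "'a \<Rightarrow> 'i \<Rightarrow> real" and Z :: "'b \<Rightarrow> 'i \<Rightarrow> real"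
  assumes Y: "small_vector M I Y b \<kappa> \<tau>" and Z: "small_vector N I Z c \<kappa>' \<tau>'"
    and cov: "\<And>a. moment_form M I Y a = moment_form N I Z a"
    and \<beta>: "\<beta> > 0" and \<delta>: "\<delta> > 0" "\<beta> * \<delta> \<ge> 1" and A: "A \<ge> 0"
    and m: "\<And>s. (m has_real_derivative m1 s) (at s)"
    and m1: "\<And>s. (m1 has_real_derivative m2 s) (at s)"
    and m2: "\<And>s. (m2 has_real_derivative m3 s) (at s)"
    and b0: "\<And>s. \<bar>m s\<bar> \<le> 1"
    and b1: "\<And>s. \<bar>m1 s\<bar> \<le> A / \<delta>" and b2: "\<And>s. \<bar>m2 s\<bar> \<le> A / \<delta>\<^sup>2" and b3: "\<And>s. \<bar>m3 s\<bar> \<le> A / \<delta>^3"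
    and [measurable]: "m \<in> borel_measurable borel"
  shows "\<bar>(\<integral>x. m (smax \<beta> I (\<lambda>k. w k + (\<Sum>i<n. Y (x i) k))) \<partial>PiM {..<n} (\<lambda>_. M))
     - (\<integral>z. m (smax \<beta> I (\<lambda>k. w k + (\<Sum>i<n. Z (z i) k))) \<partial>PiM {..<n} (\<lambda>_. N))\<bar>
     \<le> real n * (A * \<beta>\<^sup>2 / \<delta> * (3 * exp 2 * (\<kappa> + \<kappa>')) + 2 * A * \<beta>^3 / \<delta> * (\<tau> + \<tau>'))"
proof -
  interpret Y: small_vector M I Y b \<kappa> \<tau> by fact
  interpret Z: small_vector N I Z c \<kappa>' \<tau>' by fact
  define f where "f w = m (smax \<beta> I w)" for w
  define err where "err = A * \<beta>\<^sup>2 / \<delta> * (3 * exp 2 * (\<kappa> + \<kappa>')) + 2 * A * \<beta>^3 / \<delta> * (\<tau> + \<tau>')"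
  have fb: "\<bar>f w\<bar> \<le> 1" for w using b0 by (simp add: f_def)
  have one: "\<bar>(\<integral>y. f (\<lambda>k. w k + Y y k) \<partial>M) - (\<integral>z. f (\<lambda>k. w k + Z z k) \<partial>N)\<bar> \<le> err" for w
    using Y.taylor_expectation[OF \<beta> \<delta> A m m1 m2 b0 b1 b2 b3, of w]
      Z.taylor_expectation[OF \<beta> \<delta> A m m1 m2 b0 b1 b2 b3, of w]
    unfolding cov f_def err_def by (simp add: algebra_simps add_divide_distrib diff_divide_distrib)
  have meas: "(\<lambda>x. f (W x)) \<in> borel_measurable L" if "\<And>k. k \<in> I \<Longrightarrow> (\<lambda>x. W x k) \<in> borel_measurable L"
    for W and L :: "(nat \<Rightarrow> 'a) measure"
    unfolding f_def using that by measurable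
  have measN: "(\<lambda>x. f (W x)) \<in> borel_measurable L" if "\<And>k. k \<in> I \<Longrightarrow> (\<lambda>x. W x k) \<in> borel_measurable L"
    for W and L :: "(nat \<Rightarrow> 'b) measure"
    unfolding f_def using that by measurable
  have "\<bar>(\<integral>x. f (\<lambda>k. w k + (\<Sum>i<n. Y (x i) k)) \<partial>PiM {..<n} (\<lambda>_. M))
     - (\<integral>z. f (\<lambda>k. w k + (\<Sum>i<n. Z (z i) k)) \<partial>PiM {..<n} (\<lambda>_. N))\<bar> \<le> real n * err" for w
  proof (induction n arbitrary: w)
    case 0
    show ?case by (simp add: PiM_empty lebesgue_integral_count_space_finite)
  next
    case (Suc n)
    let ?M = "PiM {..<n} (\<lambda>_. M)" and ?N = "PiM {..<n} (\<lambda>_. N)"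
    let ?S = "\<lambda>x k. \<Sum>i<n. Y (x i) k" and ?T = "\<lambda>x k. \<Sum>i<n. Z (x i) k"
    have P: "prob_space ?M" "prob_space ?N" "prob_space (PiM {..<Suc n} (\<lambda>_. M))" "prob_space (PiM {..<Suc n} (\<lambda>_. N))"
      by (auto intro!: prob_space_PiM Y.prob_space_axioms Z.prob_space_axioms)
    note PM = Y.prob_space_axioms and PN = Z.prob_space_axioms
    note ms = borel_measurable_add borel_measurable_sum measurable_compose[OF _ Y.Y_meas] measurable_compose[OF _ Z.Y_meas]
    have "(\<integral>x. f (\<lambda>k. w k + (\<Sum>i<Suc n. Y (x i) k)) \<partial>PiM {..<Suc n} (\<lambda>_. M))
        = (\<integral>x. (\<integral>y. f (\<lambda>k. w k + Y y k + ?S x k) \<partial>M) \<partial>?M)"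
    proof (subst PiM_lessThan_Suc_integral[OF PM])
      have "(\<lambda>x. f (\<lambda>k. w k + (\<Sum>i<Suc n. Y (x i) k))) \<in> borel_measurable (PiM {..<Suc n} (\<lambda>_. M))"
        by (intro meas ms) auto
      then show "integrable (PiM {..<Suc n} (\<lambda>_. M)) (\<lambda>x. f (\<lambda>k. w k + (\<Sum>i<Suc n. Y (x i) k)))"
        using fb by (intro finite_measure.integrable_const_bound[where B=1] prob_space.finite_measure P) auto
    qed (auto simp: add_ac)
    note 0 = this
    have 1: "(\<integral>x. (\<integral>y. f (\<lambda>k. w k + Y y k + ?S x k) \<partial>M) \<partial>?M) = (\<integral>y. (\<integral>x. f (\<lambda>k. w k + Y y k + ?S x k) \<partial>?M) \<partial>M)"
      and mA: "(\<lambda>y. (\<integral>x. f (\<lambda>k. w k + Y y k + ?S x k) \<partial>?M)) \<in> borel_measurable M"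
      by (rule fubini_bounded[OF P(1) PM]; (rule fb)?; unfold f_def; measurable)+
    note 1 = trans[OF 0 1]
    have 2: "(\<integral>z. (\<integral>y. f (\<lambda>k. w k + ?T z k + Y y k) \<partial>M) \<partial>?N) = (\<integral>y. (\<integral>z. f (\<lambda>k. w k + ?T z k + Y y k) \<partial>?N) \<partial>M)"
      and mB: "(\<lambda>y. (\<integral>z. f (\<lambda>k. w k + ?T z k + Y y k) \<partial>?N)) \<in> borel_measurable M"
      and mC: "(\<lambda>z. (\<integral>y. f (\<lambda>k. w k + ?T z k + Y y k) \<partial>M)) \<in> borel_measurable ?N"
      by (rule fubini_bounded[OF P(2) PM]; (rule fb)?; unfold f_def; measurable)+
    have mD: "(\<lambda>z. (\<integral>y. f (\<lambda>k. w k + ?T z k + Z y k) \<partial>N)) \<in> borel_measurable ?N"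
      by (rule fubini_bounded[OF P(2) PN]; (rule fb)?; unfold f_def; measurable)
    have 3: "(\<integral>z. f (\<lambda>k. w k + (\<Sum>i<Suc n. Z (z i) k)) \<partial>PiM {..<Suc n} (\<lambda>_. N))
        = (\<integral>z. (\<integral>y. f (\<lambda>k. w k + ?T z k + Z y k) \<partial>N) \<partial>?N)"
    proof (subst PiM_lessThan_Suc_integral[OF PN])
      have "(\<lambda>x. f (\<lambda>k. w k + (\<Sum>i<Suc n. Z (x i) k))) \<in> borel_measurable (PiM {..<Suc n} (\<lambda>_. N))"
        by (intro measN ms) auto
      then show "integrable (PiM {..<Suc n} (\<lambda>_. N)) (\<lambda>x. f (\<lambda>k. w k + (\<Sum>i<Suc n. Z (x i) k)))"
        using fb by (intro finite_measure.integrable_const_bound[where B=1] prob_space.finite_measure P) auto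
    qed (auto simp: add_ac)
    have ib: "\<bar>\<integral>x. f (W x) \<partial>?M\<bar> \<le> 1" "\<bar>\<integral>x. f (W' x) \<partial>?N\<bar> \<le> 1" "\<bar>\<integral>x. f (V x) \<partial>M\<bar> \<le> 1" "\<bar>\<integral>x. f (V' x) \<partial>N\<bar> \<le> 1"
      for W W' V V'
      by (intro abs_integral_le_1 P PM PN fb)+
    \<comment> \<open>The n earlier summands are swapped first, with the last \<open>Y\<close>
      frozen inside the shift; afterwards that \<open>Y\<close> is swapped, with the n summands
      \<open>Z\<close> frozen. Fubini changes the order of integration in between.\<close>
    have "\<bar>(\<integral>y. (\<integral>x. f (\<lambda>k. w k + Y y k + ?S x k) \<partial>?M) \<partial>M) - (\<integral>y. (\<integral>z. f (\<lambda>k. w k + ?T z k + Y y k) \<partial>?N) \<partial>M)\<bar> \<le> real n * err"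
    proof (rule abs_integral_diff_le[OF PM mA mB ib(1) ib(2)])
      show "\<bar>(\<integral>x. f (\<lambda>k. w k + Y y k + ?S x k) \<partial>?M) - (\<integral>z. f (\<lambda>k. w k + ?T z k + Y y k) \<partial>?N)\<bar> \<le> real n * err" for y
        using Suc.IH[of "\<lambda>k. w k + Y y k"] by (simp add: add_ac)
    qed
    moreover have "\<bar>(\<integral>z. (\<integral>y. f (\<lambda>k. w k + ?T z k + Y y k) \<partial>M) \<partial>?N) - (\<integral>z. (\<integral>y. f (\<lambda>k. w k + ?T z k + Z y k) \<partial>N) \<partial>?N)\<bar> \<le> err"
      by (rule abs_integral_diff_le[OF P(2) mC mD ib(3) ib(4)], rule one)
    ultimately show ?case unfolding 1 3 using 2 by (simp add: algebra_simps)
  qed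
  then show ?thesis unfolding f_def err_def .
qed

section \<open>Uniqueness of finite measures from cosine integrals\<close>

text \<open>Levy's uniqueness theorem after division by the common total mass, which is the case s =
  d = 0 of the hypothesis; zero mass is treated apart.\<close>

lemma finite_measure_eqI_cos:
  fixes M N :: "real measure"
  assumes "finite_measure M" "finite_measure N" and sets: "sets M = sets borel" "sets N = sets borel"
    and eq: "\<And>s d. (\<integral>x. cos (s * x + d) \<partial>M) = (\<integral>x. cos (s * x + d) \<partial>N)"
  shows "M = N"
proof -
  interpret M: finite_measure M by fact
  interpret N: finite_measure N by fact
  have sp: "space M = UNIV" "space N = UNIV" using sets[THEN sets_eq_imp_space_eq] by auto
  have mass: "measure M UNIV = measure N UNIV" using eq[of 0 0] by (simp add: sp)
  show ?thesis
  proof (cases "measure M UNIV = 0")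
    case True
    then have "emeasure M UNIV = 0" "emeasure N UNIV = 0"
      using mass by (simp_all add: M.emeasure_eq_measure N.emeasure_eq_measure)
    then have "emeasure M A = 0" "emeasure N A = 0" for A
      using emeasure_space[of M A] emeasure_space[of N A] sp by simp_all
    then show ?thesis by (intro measure_eqI) (auto simp: sets)
  next
    case False
    define r where "r = measure M UNIV"
    have r: "r > 0" using False by (simp add: r_def zero_less_measure_iff)
    define P where "P L = density L (\<lambda>_. ennreal (1 / r))" for L :: "real measure"
    have P: "real_distribution (P L)" "char (P L) t = complex_of_real (1 / r) * (complex_of_real (\<integral>x. cos (t * x) \<partial>L) + \<i> * complex_of_real (\<integral>x. sin (t * x) \<partial>L))"
      if L: "finite_measure L" "sets L = sets borel" "measure L UNIV = r" for L t
    proof -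
      interpret L: finite_measure L by fact
      have spL: "space L = UNIV" using L(2)[THEN sets_eq_imp_space_eq] by simp
      note [measurable_cong] = L(2)
      have "emeasure (P L) UNIV = 1"
        using r L(3) by (simp add: P_def emeasure_density_const L(2) L.emeasure_eq_measure flip: ennreal_mult)
      then have ps: "prob_space (P L)" by (intro prob_spaceI) (simp add: P_def spL)
      then show "real_distribution (P L)"
        by (simp add: real_distribution_def real_distribution_axioms_def P_def L(2))
      have i: "integrable L (\<lambda>x. cos (t * x))" "integrable L (\<lambda>x. sin (t * x))"
        by (auto intro!: L.integrable_const_bound[where B=1])
      have "char (P L) t = (CLINT x|L. (1 / r) *\<^sub>R iexp (t * x))"
        unfolding char_def P_def by (subst integral_density) (use r in auto)
      also have "\<dots> = (CLINT x|L. complex_of_real (1 / r) * (complex_of_real (cos (t * x)) + \<i> * complex_of_real (sin (t * x))))"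
          by (intro Bochner_Integration.integral_cong refl)
          (simp add: scaleR_conv_of_real exp_Euler cos_of_real sin_of_real del: of_real_mult add: of_real_mult[symmetric])
      also have "\<dots> = complex_of_real (1 / r) * (complex_of_real (\<integral>x. cos (t * x) \<partial>L) + \<i> * complex_of_real (\<integral>x. sin (t * x) \<partial>L))"
        using i by simp
      finally show "char (P L) t = complex_of_real (1 / r) * (complex_of_real (\<integral>x. cos (t * x) \<partial>L) + \<i> * complex_of_real (\<integral>x. sin (t * x) \<partial>L))" .
    qed
    have c: "(\<integral>x. cos (t * x) \<partial>M) = (\<integral>x. cos (t * x) \<partial>N)" for t using eq[of t 0] by simp
    \<comment> \<open>The phase -pi/2 turns the cosine into a sine, giving the imaginary part of the
      characteristic function.\<close>
    have s: "(\<integral>x. sin (t * x) \<partial>M) = (\<integral>x. sin (t * x) \<partial>N)" for t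
      using eq[of t "- (pi / 2)"] by (simp add: cos_diff flip: diff_conv_add_uminus)
    have "P M = P N"
      using P[OF assms(1) sets(1)] P[OF assms(2) sets(2)] mass c s
      by (intro Levy_uniqueness) (auto simp: r_def fun_eq_iff)
    show ?thesis
    proof (rule measure_eqI)
      fix A assume "A \<in> sets M"
      then have A: "A \<in> sets borel" using sets by simp
      have "emeasure (P M) A = emeasure (P N) A" by (simp add: \<open>P M = P N\<close>)
      then have "ennreal (1 / r) * emeasure M A = ennreal (1 / r) * emeasure N A"
        using A sets by (simp add: P_def emeasure_density_const)
      then have "measure M A = measure N A"
        using r by (simp add: M.emeasure_eq_measure N.emeasure_eq_measure flip: ennreal_mult)
      then show "emeasure M A = emeasure N A" by (simp add: M.emeasure_eq_measure N.emeasure_eq_measure)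
    qed (simp add: sets)
  qed
qed

lemma abs_prod_indicator_le_1: "\<bar>\<Prod>j\<in>J. indicator (A j) (x j) :: real\<bar> \<le> 1"
  unfolding abs_prod by (rule prod_le_1) (auto simp: indicator_def)

text \<open>Cramer--Wold. Coordinates are fixed one at a time: weighting by the nonnegative function
  \<open>1 + cos\<close> keeps the one-dimensional projections finite measures, to which Levy's theorem applies.\<close>
lemma PiM_finite_measure_eqI_cos:
  fixes M N :: "('i \<Rightarrow> real) measure"
  assumes I: "finite I" and fin: "finite_measure M" "finite_measure N"
    and sets: "sets M = sets (PiM I (\<lambda>_. borel))" "sets N = sets (PiM I (\<lambda>_. borel))"
    and eq: "\<And>a c. (\<integral>x. cos ((\<Sum>k\<in>I. a k * x k) + c) \<partial>M) = (\<integral>x. cos ((\<Sum>k\<in>I. a k * x k) + c) \<partial>N)"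
  shows "M = N"
proof -
  interpret M: finite_measure M by fact
  interpret N: finite_measure N by fact
  note [measurable_cong] = sets
  \<comment> \<open>Cosine integrals restricted to a cylinder. \<open>J\<close> collects the
    coordinates already localised to sets \<open>A j\<close>; the induction enlarges it until the
    cylinder is a full box.\<close>
  define T where "T L J A a c = (\<integral>x. cos ((\<Sum>k\<in>I. a k * x k) + c) * (\<Prod>j\<in>J. indicator (A j) (x j)) \<partial>L)"
    for L :: "('i \<Rightarrow> real) measure" and J and A :: "'i \<Rightarrow> real set" and a c
  have main: "T M J A a c = T N J A a c" if "J \<subseteq> I" "\<And>j. j \<in> J \<Longrightarrow> A j \<in> sets borel" for J A a c
    using finite_subset[OF that(1) I] that
  proof (induction J arbitrary: a c rule: finite_induct)
    case empty
    then show ?case using eq by (simp add: T_def)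
  next
    case (insert k J)
    have J: "finite J" "k \<notin> J" "k \<in> I" "J \<subseteq> I" and A: "\<And>j. j \<in> J \<Longrightarrow> A j \<in> sets borel" and Ak: "A k \<in> sets borel"
      using insert by auto
    have IH: "T M J A a c = T N J A a c" for a c
      using insert.IH[OF J(4) A] by simp
    define P :: "('i \<Rightarrow> real) \<Rightarrow> real" where "P x = (\<Prod>j\<in>J. indicator (A j) (x j))" for x
    have Pm: "P \<in> borel_measurable (PiM I (\<lambda>_. borel))"
      unfolding P_def[abs_def] using A J
      by (intro borel_measurable_prod measurable_compose[OF measurable_component_singleton borel_measurable_indicator]) auto
    have Pb: "\<bar>P x\<bar> \<le> 1" "0 \<le> P x" for x
      unfolding P_def using abs_prod_indicator_le_1 by (auto intro!: prod_nonneg)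
    have lin: "(\<lambda>x. (\<Sum>k\<in>I. a k * x k)) \<in> borel_measurable (PiM I (\<lambda>_. borel))" for a :: "'i \<Rightarrow> real" by measurable
    have k: "(\<lambda>x. x k) \<in> borel_measurable (PiM I (\<lambda>_. borel))" using J by measurable
    \<comment> \<open>A bounded nonnegative density, so its image under coordinate \<open>k\<close>
      is a finite measure; a bare cosine would only give a signed one.\<close>
    define g where "g a c x = (1 + cos ((\<Sum>k\<in>I. a k * x k) + c)) * P x" for a c x
    have g0: "0 \<le> g a c x" for a c x unfolding g_def using Pb[of x] cos_ge_minus_one[of "(\<Sum>k\<in>I. a k * x k) + c"]
      by (intro mult_nonneg_nonneg) (linarith, simp)
    have gb: "\<bar>g a c x\<bar> \<le> 2" for a c x
    proof -
      have "\<bar>1 + cos ((\<Sum>k\<in>I. a k * x k) + c)\<bar> \<le> 2"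
        using cos_le_one[of "(\<Sum>k\<in>I. a k * x k) + c"] cos_ge_minus_one[of "(\<Sum>k\<in>I. a k * x k) + c"] by linarith
      then have "\<bar>1 + cos ((\<Sum>k\<in>I. a k * x k) + c)\<bar> * \<bar>P x\<bar> \<le> 2 * 1"
        using Pb(1)[of x] by (intro mult_mono) auto
      then show ?thesis by (simp add: g_def abs_mult)
    qed
    have gm: "g a c \<in> borel_measurable (PiM I (\<lambda>_. borel))" for a c
      unfolding g_def[abs_def] using lin Pm by measurable
    define Q where "Q L a c = distr (density L (\<lambda>x. ennreal (g a c x))) borel (\<lambda>x. x k)" for L a c
    have int: "integrable L (\<lambda>x. u x * P x)" if "finite_measure L" "sets L = sets (PiM I (\<lambda>_. borel))"
       "u \<in> borel_measurable (PiM I (\<lambda>_. borel))" "\<And>x. \<bar>u x\<bar> \<le> 1" for u :: "('i \<Rightarrow> real) \<Rightarrow> real" and L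
    proof -
      note [measurable_cong] = that(2)
      show ?thesis
        by (rule finite_measure.integrable_const_bound[OF that(1), where B=1])
          (use that(3,4) Pm Pb in \<open>auto simp: abs_mult intro!: mult_le_one\<close>)
    qed
    have QL: "finite_measure (Q L a c)" "sets (Q L a c) = sets borel"
      "u \<in> borel_measurable borel \<Longrightarrow> (\<integral>t. u t \<partial>Q L a c) = (\<integral>x. u (x k) * g a c x \<partial>L)"
      if L: "finite_measure L" "sets L = sets (PiM I (\<lambda>_. borel))" for L a c and u :: "real \<Rightarrow> real"
    proof -
      interpret L: finite_measure L by fact
      note [measurable_cong] = L(2)
      note [measurable] = gm k
      have "(\<integral>\<^sup>+ x. ennreal (g a c x) \<partial>L) \<le> (\<integral>\<^sup>+ x. 2 \<partial>L)"
        using ennreal_leI[of _ 2] gb[of a c] g0[of a c] by (intro nn_integral_mono) (simp add: abs_of_nonneg)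
      also have "\<dots> < \<infinity>" by (simp add: L.emeasure_eq_measure ennreal_mult_less_top)
      finally have "finite_measure (density L (\<lambda>x. ennreal (g a c x)))"
        by (intro finite_measureI) (simp add: emeasure_density cong: nn_integral_cong)
      then show "finite_measure (Q L a c)" unfolding Q_def
        by (rule finite_measure.finite_measure_distr) simp
      show "sets (Q L a c) = sets borel" by (simp add: Q_def)
      show "(\<integral>t. u t \<partial>Q L a c) = (\<integral>x. u (x k) * g a c x \<partial>L)" if [measurable]: "u \<in> borel_measurable borel"
        unfolding Q_def by (subst integral_distr, simp, simp, subst integral_density) (auto simp: g0 mult.commute)
    qed
    have Qeq: "Q M a c = Q N a c" for a c
    proof (rule finite_measure_eqI_cos)
      fix s d :: real
      define e where "e = (\<lambda>j. if j = k then s else 0)"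
      have e: "(\<Sum>j\<in>I. e j * x j) = s * x k" for x :: "'i \<Rightarrow> real"
        using J I by (simp add: e_def if_distrib[of "\<lambda>z. z * _"] cong: if_cong)
      \<comment> \<open>The product of two cosines is half the sum of cosines with frequencies a + e
        and a - e. Every term is then a cosine integral over the smaller cylinder, where the
        induction hypothesis applies.\<close>
      have "(\<integral>t. cos (s * t + d) \<partial>Q L a c) = T L J A e d + (T L J A (\<lambda>j. a j + e j) (c + d) + T L J A (\<lambda>j. a j - e j) (c - d)) / 2"
        if L: "finite_measure L" "sets L = sets (PiM I (\<lambda>_. borel))" for L
      proof -
        note [measurable_cong] = L(2)
        have "(\<integral>t. cos (s * t + d) \<partial>Q L a c) = (\<integral>x. cos (s * x k + d) * g a c x \<partial>L)"
          by (rule QL(3)[OF L]) measurable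
        also have "\<dots> = (\<integral>x. cos ((\<Sum>j\<in>I. e j * x j) + d) * P x + (cos ((\<Sum>j\<in>I. (a j + e j) * x j) + (c + d)) * P x
             + cos ((\<Sum>j\<in>I. (a j - e j) * x j) + (c - d)) * P x) / 2 \<partial>L)"
        proof (intro Bochner_Integration.integral_cong refl)
          fix x
          define l where "l = (\<Sum>k\<in>I. a k * x k) + c"
          define m where "m = s * x k + d"
          have 1: "(\<Sum>j\<in>I. (a j + e j) * x j) + (c + d) = l + m" "(\<Sum>j\<in>I. (a j - e j) * x j) + (c - d) = l - m"
            by (simp_all add: l_def m_def e ring_distribs sum.distrib sum_subtractf)
          show "cos (s * x k + d) * g a c x = cos ((\<Sum>j\<in>I. e j * x j) + d) * P x + (cos ((\<Sum>j\<in>I. (a j + e j) * x j) + (c + d)) * P x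
             + cos ((\<Sum>j\<in>I. (a j - e j) * x j) + (c - d)) * P x) / 2"
            unfolding 1 e g_def l_def[symmetric] m_def[symmetric] by (simp add: cos_add cos_diff field_simps)
        qed
        also have "\<dots> = T L J A e d + (T L J A (\<lambda>j. a j + e j) (c + d) + T L J A (\<lambda>j. a j - e j) (c - d)) / 2"
          unfolding T_def P_def[symmetric]
        proof -
          have i: "integrable L (\<lambda>x. cos ((\<Sum>j\<in>I. e j * x j) + d) * P x)" for e d
            by (rule int[OF L]) auto
          show "(\<integral>x. cos ((\<Sum>j\<in>I. e j * x j) + d) * P x + (cos ((\<Sum>j\<in>I. (a j + e j) * x j) + (c + d)) * P x
             + cos ((\<Sum>j\<in>I. (a j - e j) * x j) + (c - d)) * P x) / 2 \<partial>L) =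
             (\<integral>x. cos ((\<Sum>j\<in>I. e j * x j) + d) * P x \<partial>L) + ((\<integral>x. cos ((\<Sum>j\<in>I. (a j + e j) * x j) + (c + d)) * P x \<partial>L)
             + (\<integral>x. cos ((\<Sum>j\<in>I. (a j - e j) * x j) + (c - d)) * P x \<partial>L)) / 2"
            using i[of e d] i[of "\<lambda>j. a j + e j" "c + d"] i[of "\<lambda>j. a j - e j" "c - d"]
            by (simp del: distrib_right_numeral)
        qed
        finally show ?thesis .
      qed
      from this[OF fin(1) sets(1)] this[OF fin(2) sets(2)]
      show "(\<integral>t. cos (s * t + d) \<partial>Q M a c) = (\<integral>t. cos (s * t + d) \<partial>Q N a c)" using IH by simp
    qed (use QL fin sets in auto)
    have split: "(\<integral>t. indicator (A k) t \<partial>Q L a c) = T L (insert k J) A (\<lambda>_. 0) 0 + T L (insert k J) A a c"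
      if L: "finite_measure L" "sets L = sets (PiM I (\<lambda>_. borel))" for L a c
    proof -
      note [measurable_cong] = L(2)
      have im: "(\<lambda>x. indicator (A k) (x k) :: real) \<in> borel_measurable (PiM I (\<lambda>_. borel))"
        by (rule measurable_compose[OF k borel_measurable_indicator[OF Ak]])
      have "(\<integral>t. indicator (A k) t \<partial>Q L a c) = (\<integral>x. indicator (A k) (x k) * g a c x \<partial>L)"
        by (rule QL(3)[OF L]) (use Ak in measurable)
      also have "\<dots> = (\<integral>x. indicator (A k) (x k) * P x + (cos ((\<Sum>k\<in>I. a k * x k) + c) * indicator (A k) (x k)) * P x \<partial>L)"
        by (simp add: g_def algebra_simps)
      also have "\<dots> = (\<integral>x. indicator (A k) (x k) * P x \<partial>L) + (\<integral>x. (cos ((\<Sum>k\<in>I. a k * x k) + c) * indicator (A k) (x k)) * P x \<partial>L)"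
      proof (intro Bochner_Integration.integral_add int[OF L] im)
        have "(\<lambda>x. cos ((\<Sum>k\<in>I. a k * x k) + c)) \<in> borel_measurable (PiM I (\<lambda>_. borel))" by measurable
        from this im show "(\<lambda>x. cos ((\<Sum>k\<in>I. a k * x k) + c) * indicator (A k) (x k)) \<in> borel_measurable (PiM I (\<lambda>_. borel))"
          by (rule borel_measurable_times)
      qed (auto simp: indicator_def)
      also have "\<dots> = T L (insert k J) A (\<lambda>_. 0) 0 + T L (insert k J) A a c"
        using J by (simp add: T_def P_def mult_ac)
      finally show ?thesis .
    qed
    note s = split[OF fin(1) sets(1)] split[OF fin(2) sets(2)]
    \<comment> \<open>For a = 0 and c = 0 both summands of \<open>split\<close> coincide, which
      settles the unweighted term; subtracting it from the general case leaves the cosine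
      term.\<close>
    have "T M (insert k J) A (\<lambda>_. 0) 0 = T N (insert k J) A (\<lambda>_. 0) 0"
      using s[of "\<lambda>_. 0" 0] Qeq by simp
    then show ?case using s[of a c] Qeq by simp
  qed
  show ?thesis
  proof (rule measure_eqI_PiM_finite[OF I sets])
    fix A :: "'i \<Rightarrow> real set" assume A: "\<And>i. i \<in> I \<Longrightarrow> A i \<in> sets borel"
    have "T L I A (\<lambda>_. 0) 0 = measure L (PiE I A)" if L: "finite_measure L" "sets L = sets (PiM I (\<lambda>_. borel))" for L
    proof -
      have sp: "space L = PiE I (\<lambda>_. UNIV)" using L(2)[THEN sets_eq_imp_space_eq] by (simp add: space_PiM)
      have "T L I A (\<lambda>_. 0) 0 = (\<integral>x. indicator (PiE I A) x \<partial>L)"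
        unfolding T_def
      proof (intro Bochner_Integration.integral_cong refl)
        fix x assume "x \<in> space L"
        then show "cos ((\<Sum>k\<in>I. 0 * x k) + 0) * (\<Prod>j\<in>I. indicator (A j) (x j)) = indicator (PiE I A) x"
          using I by (auto simp: sp indicator_def PiE_iff prod_zero_iff)
      qed
      also have "\<dots> = measure L (PiE I A)"
        using A by (simp add: L(2) sets_PiM_I_finite[OF I])
      finally show ?thesis .
    qed
    from this[OF fin(1) sets(1)] this[OF fin(2) sets(2)] main[of I A "\<lambda>_. 0" 0] A
    show "emeasure M (PiE I A) = emeasure N (PiE I A)"
      by (simp add: M.emeasure_eq_measure N.emeasure_eq_measure)
  next
    show "range (\<lambda>n::nat. space (PiM I (\<lambda>_. borel))) \<subseteq> prod_algebra I (\<lambda>_. borel)"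
      using I by (auto intro!: prod_algebraI_finite simp: space_PiM)
    show "(\<Union>i::nat. space (PiM I (\<lambda>_. borel))) = space (PiM I (\<lambda>_. borel :: real measure))" by simp
  qed simp
qed

section \<open>Gaussian laws and resampling\<close>

lemma normal_scale_integral:
  fixes f :: "real \<Rightarrow> real"
  assumes "\<sigma> > 0" and [measurable]: "f \<in> borel_measurable borel"
  shows "(\<integral>x. f x \<partial>density lborel (normal_density 0 \<sigma>)) = (\<integral>x. f (\<sigma> * x) \<partial>std_normal_distribution)"
proof -
  have nd: "normal_density 0 \<sigma> (\<sigma> * x) = std_normal_density x / \<sigma>" for x
    using assms(1) by (simp add: normal_density_def real_sqrt_mult power_mult_distrib field_simps)
  have "(\<integral>x. f x \<partial>density lborel (normal_density 0 \<sigma>)) = (\<integral>x. normal_density 0 \<sigma> x * f x \<partial>lborel)"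
    by (subst integral_density) auto
  also have "\<dots> = \<bar>\<sigma>\<bar> *\<^sub>R (\<integral>x. normal_density 0 \<sigma> (0 + \<sigma> * x) * f (0 + \<sigma> * x) \<partial>lborel)"
    by (rule lborel_integral_real_affine) (use assms in auto)
  also have "\<dots> = (\<integral>x. std_normal_density x * f (\<sigma> * x) \<partial>lborel)"
  proof -
    have "(\<integral>x. normal_density 0 \<sigma> (0 + \<sigma> * x) * f (0 + \<sigma> * x) \<partial>lborel) = (\<integral>x. (1 / \<sigma>) * (std_normal_density x * f (\<sigma> * x)) \<partial>lborel)"
      by (simp add: nd)
    also have "\<dots> = (1 / \<sigma>) * (\<integral>x. std_normal_density x * f (\<sigma> * x) \<partial>lborel)" by (rule integral_mult_right_zero)
    finally show ?thesis using assms(1) by simp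
  qed
  also have "\<dots> = (\<integral>x. f (\<sigma> * x) \<partial>std_normal_distribution)"
    by (subst integral_density) auto
  finally show ?thesis .
qed

lemma std_normal_cos_sin:
  "(\<integral>x. cos (t * x) \<partial>std_normal_distribution) = exp (- t\<^sup>2 / 2)"
  "(\<integral>x. sin (t * x) \<partial>std_normal_distribution) = 0"
proof -
  interpret real_distribution std_normal_distribution by (rule real_dist_normal_dist)
  have i: "integrable std_normal_distribution (\<lambda>x. cos (t * x))" "integrable std_normal_distribution (\<lambda>x. sin (t * x))"
    by (auto intro!: integrable_const_bound[where B=1])
  have "char std_normal_distribution t = (CLINT x|std_normal_distribution. complex_of_real (cos (t * x)) + \<i> * complex_of_real (sin (t * x)))"
    unfolding char_def by (intro Bochner_Integration.integral_cong refl)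
      (simp add: exp_Euler cos_of_real sin_of_real del: of_real_mult add: of_real_mult[symmetric])
  also have "\<dots> = complex_of_real (\<integral>x. cos (t * x) \<partial>std_normal_distribution) + \<i> * complex_of_real (\<integral>x. sin (t * x) \<partial>std_normal_distribution)"
    using i by simp
  finally have "complex_of_real (exp (- t\<^sup>2 / 2)) = complex_of_real (\<integral>x. cos (t * x) \<partial>std_normal_distribution) + \<i> * complex_of_real (\<integral>x. sin (t * x) \<partial>std_normal_distribution)"
    by (simp add: char_std_normal_distribution)
  then show "(\<integral>x. cos (t * x) \<partial>std_normal_distribution) = exp (- t\<^sup>2 / 2)"
     "(\<integral>x. sin (t * x) \<partial>std_normal_distribution) = 0"
    by (simp_all add: complex_eq_iff)
qed

lemma std_normal_cos_phase:
  "(\<integral>x. cos (t * x + c) \<partial>std_normal_distribution) = exp (- t\<^sup>2 / 2) * cos c"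
proof -
  interpret real_distribution std_normal_distribution by (rule real_dist_normal_dist)
  have i: "integrable std_normal_distribution (\<lambda>x. cos (t * x))" "integrable std_normal_distribution (\<lambda>x. sin (t * x))"
    by (auto intro!: integrable_const_bound[where B=1])
  have "(\<integral>x. cos (t * x + c) \<partial>std_normal_distribution) = (\<integral>x. cos (t * x) * cos c - sin (t * x) * sin c \<partial>std_normal_distribution)"
    by (simp add: cos_add)
  also have "\<dots> = exp (- t\<^sup>2 / 2) * cos c"
    using i std_normal_cos_sin[of t] by simp
  finally show ?thesis .
qed

section \<open>Covariance forms, characteristic functions and conditional resampling\<close>

definition quad_form :: "'i set \<Rightarrow> ('i \<Rightarrow> 'i \<Rightarrow> real) \<Rightarrow> ('i \<Rightarrow> real) \<Rightarrow> real" where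
  "quad_form I S a = (\<Sum>i\<in>I. \<Sum>j\<in>I. a i * a j * S i j)"

text \<open>The law of a centered Gaussian vector, described through its characteristic function; the
  phase \<open>c\<close> covers real and imaginary part at once.\<close>
definition gauss_law :: "'i set \<Rightarrow> ('i \<Rightarrow> 'i \<Rightarrow> real) \<Rightarrow> ('i \<Rightarrow> real) measure \<Rightarrow> bool" where
  "gauss_law I S G \<longleftrightarrow> prob_space G \<and> sets G = sets (PiM I (\<lambda>_. borel)) \<and>
     (\<forall>a c. (\<integral>z. cos ((\<Sum>k\<in>I. a k * z k) + c) \<partial>G) = exp (- quad_form I S a / 2) * cos c)"

text \<open>The integral of a cosine is at most 1 in modulus, so exp (- q / 2) \<le> 1. Positive
  semidefiniteness is thus a consequence of the characteristic function.\<close>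

lemma quad_form_nonneg:
  assumes "gauss_law I S G"
  shows "0 \<le> quad_form I S a"
proof -
  interpret prob_space G using assms by (simp add: gauss_law_def)
  have "exp (- quad_form I S a / 2) = \<bar>\<integral>z. cos ((\<Sum>k\<in>I. a k * z k) + 0) \<partial>G\<bar>"
    using assms unfolding gauss_law_def by (metis abs_of_nonneg cos_zero exp_ge_zero mult.right_neutral)
  also have "\<dots> \<le> 1" by (rule abs_integral_le_1) (auto intro: prob_space_axioms)
  finally show ?thesis by simp
qed

lemma sum_unit:
  assumes "finite I" "k \<in> I"
  shows "(\<Sum>j\<in>I. (if j = k then c else 0) * z j) = c * (z k :: real)"
  using assms by (simp add: if_distrib[of "\<lambda>z. z * _"] cong: if_cong)

lemma quad_form_unit:
  assumes I: "finite I" "k \<in> I"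
  shows "quad_form I S (\<lambda>j. if j = k then c else 0) = c\<^sup>2 * S k k"
proof -
  have "quad_form I S (\<lambda>j. if j = k then c else 0) = (\<Sum>i\<in>I. (if i = k then c else 0) * (\<Sum>j\<in>I. (if j = k then c else 0) * S i j))"
    by (simp add: quad_form_def sum_distrib_left mult.assoc)
  then show ?thesis unfolding sum_unit[OF I] by (simp add: power2_eq_square)
qed

lemma quad_form_two_units:
  assumes I: "finite I" "k \<in> I" "l \<in> I" and kl: "k \<noteq> l"
  shows "quad_form I S (\<lambda>j. (if j = k then c else 0) + (if j = l then d else 0))
    = c\<^sup>2 * S k k + c * d * S k l + d * c * S l k + d\<^sup>2 * S l l"
proof -
  have "quad_form I S (\<lambda>j. (if j = k then c else 0) + (if j = l then d else 0))
     = (\<Sum>i\<in>I. ((if i = k then c else 0) + (if i = l then d else 0)) * (c * S i k + d * S i l))"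
    unfolding quad_form_def
  proof (intro sum.cong refl)
    fix i
    let ?u = "(if i = k then c else 0) + (if i = l then d else 0)"
    have "(\<Sum>j\<in>I. ?u * ((if j = k then c else 0) + (if j = l then d else 0)) * S i j)
       = ?u * ((\<Sum>j\<in>I. (if j = k then c else 0) * S i j) + (\<Sum>j\<in>I. (if j = l then d else 0) * S i j))"
      by (simp add: sum_distrib_left sum.distrib[symmetric] ring_distribs mult.assoc del: mult_if_delta)
    then show "(\<Sum>j\<in>I. ?u * ((if j = k then c else 0) + (if j = l then d else 0)) * S i j) = ?u * (c * S i k + d * S i l)"
      by (simp add: sum_unit I)
  qed
  also have "\<dots> = (\<Sum>i\<in>I. (if i = k then c else 0) * (c * S i k + d * S i l)) + (\<Sum>i\<in>I. (if i = l then d else 0) * (c * S i k + d * S i l))"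
    by (simp only: sum.distrib[symmetric] distrib_right)
  also have "\<dots> = c * (c * S k k + d * S k l) + d * (c * S l k + d * S l l)"
    by (simp add: sum_unit I)
  finally show ?thesis by (simp add: algebra_simps power2_eq_square)
qed

lemma gauss_cauchy_schwarz:
  assumes G: "gauss_law I S G" and I: "finite I" "k \<in> I" "l \<in> I" and sym: "S k l = S l k"
    and pos: "S k k > 0" "S l l > 0"
  shows "S l k \<le> sqrt (S k k) * sqrt (S l l)"
proof (cases "k = l")
  case False
  let ?a = "sqrt (S k k)" and ?b = "sqrt (S l l)"
  \<comment> \<open>For this test vector both square terms equal S k k times S l l, so the form
    factors and its sign gives the inequality.\<close>
  have "0 \<le> quad_form I S (\<lambda>j. (if j = k then ?b else 0) + (if j = l then - ?a else 0))"
    by (rule quad_form_nonneg[OF G])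
  also have "\<dots> = ?b\<^sup>2 * ?a\<^sup>2 + ?b * (- ?a) * S k l + (- ?a) * ?b * S l k + (- ?a)\<^sup>2 * ?b\<^sup>2"
    using pos by (subst quad_form_two_units[OF I False]) simp
  also have "\<dots> = 2 * (?a * ?b) * (?a * ?b - S l k)"
    using sym by (simp add: power2_eq_square algebra_simps)
  finally have "0 \<le> (?a * ?b) * (?a * ?b - S l k)" by simp
  moreover have "?a * ?b > 0" using pos by simp
  ultimately show ?thesis by (simp add: zero_le_mult_iff)
qed (use pos in auto)

text \<open>Passes from laws of linear functionals to characteristic functions. A functional of
  variance 0 has the point mass at 0 as its law, and both sides reduce to
  \<open>cos c\<close>.\<close>

lemma gauss_lawI:
  assumes fin: "finite I" and G: "prob_space G" "sets G = sets (PiM I (\<lambda>_. borel))"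
    and nn: "\<And>a. 0 \<le> quad_form I S a"
    and law: "\<And>a. distr G borel (\<lambda>z. \<Sum>i\<in>I. a i * z i) =
        (if quad_form I S a = 0 then return borel 0 else density lborel (normal_density 0 (sqrt (quad_form I S a))))"
  shows "gauss_law I S G"
  unfolding gauss_law_def
proof (intro conjI G allI)
  fix a :: "'a \<Rightarrow> real" and c :: real
  note [measurable_cong] = G(2)
  have "(\<integral>z. cos ((\<Sum>k\<in>I. a k * z k) + c) \<partial>G) = (\<integral>x. cos (x + c) \<partial>distr G borel (\<lambda>z. \<Sum>i\<in>I. a i * z i))"
    by (subst integral_distr) auto
  also have "\<dots> = exp (- quad_form I S a / 2) * cos c"
  proof (cases "quad_form I S a = 0")
    case True
    then show ?thesis unfolding law by (simp add: integral_return)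
  next
    case False
    then have p: "sqrt (quad_form I S a) > 0" using nn[of a] by simp
    show ?thesis unfolding law using False nn[of a] 
      by (simp add: normal_scale_integral[OF p] std_normal_cos_phase)
  qed
  finally show "(\<integral>z. cos ((\<Sum>k\<in>I. a k * z k) + c) \<partial>G) = exp (- quad_form I S a / 2) * cos c" .
qed

lemma gauss_law_marginal:
  assumes G: "gauss_law I S G" and I: "finite I" "k \<in> I" and pos: "S k k > 0"
  shows "distr G borel (\<lambda>z. z k) = density lborel (normal_density 0 (sqrt (S k k)))"
proof (rule finite_measure_eqI_cos)
  interpret prob_space G using G by (simp add: gauss_law_def)
  have [measurable_cong]: "sets G = sets (PiM I (\<lambda>_. borel))" using G by (simp add: gauss_law_def)
  have k[measurable]: "(\<lambda>z. z k) \<in> borel_measurable G" using I by measurable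
  show "finite_measure (distr G borel (\<lambda>z. z k))"
    by (rule finite_measure_distr) simp
  have p: "sqrt (S k k) > 0" using pos by simp
  show "finite_measure (density lborel (normal_density 0 (sqrt (S k k))))"
    using prob_space_normal_density[OF p] by (rule prob_space.finite_measure)
  fix s d :: real
  have "(\<integral>x. cos (s * x + d) \<partial>distr G borel (\<lambda>z. z k)) = (\<integral>z. cos ((\<Sum>j\<in>I. (if j = k then s else 0) * z j) + d) \<partial>G)"
    using I by (subst integral_distr) (auto simp: sum_unit)
  also have "\<dots> = exp (- (s\<^sup>2 * S k k) / 2) * cos d"
    using G I by (simp add: gauss_law_def quad_form_unit del: sum_unit)
  also have "\<dots> = (\<integral>x. cos (s * x + d) \<partial>density lborel (normal_density 0 (sqrt (S k k))))"
    using std_normal_cos_phase[of "s * sqrt (S k k)" d] pos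
    by (subst normal_scale_integral[OF p]) (auto simp: mult_ac power_mult_distrib)
  finally show "(\<integral>x. cos (s * x + d) \<partial>distr G borel (\<lambda>z. z k)) = (\<integral>x. cos (s * x + d) \<partial>density lborel (normal_density 0 (sqrt (S k k))))" .
qed auto

text \<open>Resampling the part of the vector that is explained by coordinate \<open>k\<close>: the residual
  \<open>x - \<rho> x\<^sub>k\<close> is independent of \<open>z\<^sub>k\<close>.\<close>
definition resample :: "'i set \<Rightarrow> ('i \<Rightarrow> 'i \<Rightarrow> real) \<Rightarrow> 'i \<Rightarrow> ('i \<Rightarrow> real) \<Rightarrow> real \<Rightarrow> 'i \<Rightarrow> real" where
  "resample I S k x u = (\<lambda>j\<in>I. x j + S j k / S k k * (u - x k))"

text \<open>A linear functional of the resampled vector is \<open>a'\<close> applied to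
  \<open>x\<close> plus \<open>r\<close> times the fresh value. These are independent, their
  variances add up to the original one, and characteristic functions determine the law.\<close>

lemma gauss_law_resample:
  assumes G: "gauss_law I S G" and I: "finite I" "k \<in> I" and pos: "S k k > 0"
    and sym: "\<And>i j. i \<in> I \<Longrightarrow> j \<in> I \<Longrightarrow> S i j = S j i"
  shows "distr (G \<Otimes>\<^sub>M G) (PiM I (\<lambda>_. borel)) (\<lambda>(x, z). resample I S k x (z k)) = G"
proof (rule PiM_finite_measure_eqI_cos[OF I(1)])
  interpret prob_space G using G by (simp add: gauss_law_def)
  have sets[measurable_cong]: "sets G = sets (PiM I (\<lambda>_. borel))" using G by (simp add: gauss_law_def)
  have ch: "(\<integral>z. cos ((\<Sum>k\<in>I. a k * z k) + c) \<partial>G) = exp (- quad_form I S a / 2) * cos c" for a c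
    using G by (simp add: gauss_law_def)
  interpret GG: pair_prob_space G G ..
  have kf: "(\<lambda>p. fst p j) \<in> borel_measurable (G \<Otimes>\<^sub>M G)" "(\<lambda>p. snd p j) \<in> borel_measurable (G \<Otimes>\<^sub>M G)" if "j \<in> I" for j
    using that by (auto intro!: measurable_compose[OF measurable_fst] measurable_compose[OF measurable_snd] simp: measurable_cong_sets[OF sets refl])
  have T[measurable]: "(\<lambda>(x, z). resample I S k x (z k)) \<in> (G \<Otimes>\<^sub>M G) \<rightarrow>\<^sub>M PiM I (\<lambda>_. borel)"
    unfolding resample_def case_prod_beta
    by (intro measurable_restrict borel_measurable_add borel_measurable_times borel_measurable_diff borel_measurable_const kf I)
  show "finite_measure (distr (G \<Otimes>\<^sub>M G) (PiM I (\<lambda>_. borel)) (\<lambda>(x, z). resample I S k x (z k)))"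
    by (rule GG.finite_measure_distr) (rule T)
  show "finite_measure G" by (rule finite_measure_axioms)
  fix a :: "'a \<Rightarrow> real" and c :: real
  \<comment> \<open>The regression coefficient of the functional \<open>a\<close> on coordinate
    \<open>k\<close>; \<open>a'\<close> is the functional of the residual.\<close>
  define r where "r = (\<Sum>j\<in>I. a j * (S j k / S k k))"
  define a' where "a' = (\<lambda>j. a j + (if j = k then - r else 0))"
  have lin: "(\<Sum>j\<in>I. a j * resample I S k x u j) = (\<Sum>j\<in>I. a' j * x j) + r * u" for x u
  proof -
    have "(\<Sum>j\<in>I. a j * resample I S k x u j) = (\<Sum>j\<in>I. a j * x j) + (\<Sum>j\<in>I. a j * (S j k / S k k)) * (u - x k)"
    proof -
      have "(\<Sum>j\<in>I. a j * resample I S k x u j) = (\<Sum>j\<in>I. a j * x j + a j * (S j k / S k k) * (u - x k))"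
        by (intro sum.cong refl) (simp add: resample_def distrib_left)
      then show ?thesis by (simp only: sum.distrib sum_distrib_right)
    qed
    also have "\<dots> = (\<Sum>j\<in>I. a j * x j) + (\<Sum>j\<in>I. (if j = k then - r else 0) * x j) + r * u"
      unfolding sum_unit[OF I] r_def[symmetric] by (simp add: algebra_simps)
    finally show ?thesis by (simp add: a'_def ring_distribs sum.distrib)
  qed
  \<comment> \<open>Pythagoras: the residual loses precisely the variance explained by coordinate
    \<open>k\<close>.\<close>
  have q: "quad_form I S a' = quad_form I S a - r\<^sup>2 * S k k"
  proof -
    have rk: "(\<Sum>j\<in>I. a j * S j k) = r * S k k" using pos by (simp add: r_def sum_distrib_right)
    then have rk': "(\<Sum>j\<in>I. a j * S k j) = r * S k k" using sym I by (metis (no_types, lifting) sum.cong)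
    have "quad_form I S a' = (\<Sum>i\<in>I. a' i * (\<Sum>j\<in>I. a j * S i j + (if j = k then - r else 0) * S i j))"
      unfolding quad_form_def by (simp add: a'_def sum_distrib_left algebra_simps)
    also have "\<dots> = (\<Sum>i\<in>I. a' i * ((\<Sum>j\<in>I. a j * S i j) - r * S i k))"
      unfolding sum.distrib sum_unit[OF I] by simp
    also have "\<dots> = (\<Sum>i\<in>I. a i * ((\<Sum>j\<in>I. a j * S i j) - r * S i k)) + (\<Sum>i\<in>I. (if i = k then - r else 0) * ((\<Sum>j\<in>I. a j * S i j) - r * S i k))"
      by (simp only: a'_def sum.distrib[symmetric] distrib_right)
    also have "\<dots> = (\<Sum>i\<in>I. a i * (\<Sum>j\<in>I. a j * S i j)) - r * (\<Sum>i\<in>I. a i * S i k) - r * ((\<Sum>j\<in>I. a j * S k j) - r * S k k)"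
      unfolding sum_unit[OF I] by (simp add: right_diff_distrib sum_subtractf sum_distrib_left sum_negf mult_ac)
    also have "\<dots> = quad_form I S a - r\<^sup>2 * S k k"
      unfolding rk rk' by (simp add: quad_form_def sum_distrib_left mult_ac power2_eq_square)
    finally show ?thesis .
  qed
  have "(\<integral>y. cos ((\<Sum>j\<in>I. a j * y j) + c) \<partial>distr (G \<Otimes>\<^sub>M G) (PiM I (\<lambda>_. borel)) (\<lambda>(x, z). resample I S k x (z k)))
     = (\<integral>p. cos ((\<Sum>j\<in>I. a' j * fst p j) + r * snd p k + c) \<partial>(G \<Otimes>\<^sub>M G))"
    by (subst integral_distr[OF T]) (auto simp: lin case_prod_beta)
  also have "\<dots> = (\<integral>x. (\<integral>z. cos ((\<Sum>j\<in>I. a' j * x j) + r * z k + c) \<partial>G) \<partial>G)"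
  proof (subst GG.integral_fst'[symmetric])
    show "integrable (G \<Otimes>\<^sub>M G) (\<lambda>p. cos ((\<Sum>j\<in>I. a' j * fst p j) + r * snd p k + c))"
      using kf I by (intro GG.P.integrable_const_bound[where B=1]) auto
  qed simp
  also have "\<dots> = (\<integral>x. exp (- (r\<^sup>2 * S k k) / 2) * cos ((\<Sum>j\<in>I. a' j * x j) + c) \<partial>G)"
  proof (intro Bochner_Integration.integral_cong refl)
    fix x
    have "(\<integral>z. cos ((\<Sum>j\<in>I. a' j * x j) + r * z k + c) \<partial>G) = (\<integral>z. cos ((\<Sum>j\<in>I. (if j = k then r else 0) * z j) + ((\<Sum>j\<in>I. a' j * x j) + c)) \<partial>G)"
      unfolding sum_unit[OF I] by (simp add: add_ac)
    then show "(\<integral>z. cos ((\<Sum>j\<in>I. a' j * x j) + r * z k + c) \<partial>G) = exp (- (r\<^sup>2 * S k k) / 2) * cos ((\<Sum>j\<in>I. a' j * x j) + c)"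
      by (simp add: ch quad_form_unit[OF I] del: sum_unit)
  qed
  also have "\<dots> = exp (- (r\<^sup>2 * S k k) / 2) * (exp (- quad_form I S a' / 2) * cos c)"
    by (simp add: ch)
  also have "\<dots> = exp (- quad_form I S a / 2) * cos c"
    unfolding q by (simp add: mult.assoc[symmetric] flip: exp_add) (simp add: field_simps)
  also have "\<dots> = (\<integral>y. cos ((\<Sum>j\<in>I. a j * y j) + c) \<partial>G)" by (simp add: ch)
  finally show "(\<integral>y. cos ((\<Sum>j\<in>I. a j * y j) + c) \<partial>distr (G \<Otimes>\<^sub>M G) (PiM I (\<lambda>_. borel)) (\<lambda>(x, z). resample I S k x (z k)))
     = (\<integral>y. cos ((\<Sum>j\<in>I. a j * y j) + c) \<partial>G)" .
qed (use G in \<open>auto simp: gauss_law_def\<close>)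

section \<open>Nazarov's anti-concentration inequality\<close>

text \<open>The density ratio is exp (- (2 u s + s^2) / (2 \<sigma>^2)). The hypotheses give u s
  \<le> \<sigma>^2, also for negative u, and s \<le> \<sigma>, whence the constant 3/2.\<close>

lemma normal_shift_ratio:
  assumes "\<sigma> > 0" "a \<ge> 0" "0 \<le> s" "s \<le> \<sigma> / (a + 2)" "u \<le> (a + 1) * \<sigma>"
  shows "exp (- 3 / 2) * normal_density 0 \<sigma> u \<le> normal_density 0 \<sigma> (u + s)"
proof -
  have "u * s \<le> (a + 1) * \<sigma> * (\<sigma> / (a + 2))"
  proof (cases "u \<ge> 0")
    case True then show ?thesis using assms by (intro mult_mono) auto
  next
    case False
    then have "u * s \<le> 0" using assms by (simp add: mult_nonpos_nonneg)
    also have "0 \<le> (a + 1) * \<sigma> * (\<sigma> / (a + 2))" using assms by simp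
    finally show ?thesis .
  qed
  also have "\<dots> = (a + 1) / (a + 2) * \<sigma>\<^sup>2" by (simp add: power2_eq_square)
  also have "\<dots> \<le> 1 * \<sigma>\<^sup>2" using assms by (intro mult_right_mono) auto
  finally have 1: "u * s \<le> \<sigma>\<^sup>2" by simp
  have "\<sigma> / (a + 2) \<le> \<sigma> / 1" using assms by (intro divide_left_mono) auto
  then have "s \<le> \<sigma>" using assms(4) by simp
  then have 2: "s\<^sup>2 \<le> \<sigma>\<^sup>2" using assms by (intro power_mono) auto
  have "(u + s)\<^sup>2 = u\<^sup>2 + 2 * (u * s) + s\<^sup>2" by (simp add: power2_eq_square algebra_simps)
  also have "\<dots> \<le> u\<^sup>2 + 3 * \<sigma>\<^sup>2" using 1 2 by linarith
  finally have "- (u\<^sup>2 + 3 * \<sigma>\<^sup>2) / (2 * \<sigma>\<^sup>2) \<le> - (u + s)\<^sup>2 / (2 * \<sigma>\<^sup>2)"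
    using assms(1) by (intro divide_right_mono) auto
  moreover have "- (u\<^sup>2 + 3 * \<sigma>\<^sup>2) / (2 * \<sigma>\<^sup>2) = - 3 / 2 + - u\<^sup>2 / (2 * \<sigma>\<^sup>2)"
    using assms(1) by (simp add: field_simps)
  ultimately have "exp (- 3 / 2) * exp (- u\<^sup>2 / (2 * \<sigma>\<^sup>2)) \<le> exp (- (u + s)\<^sup>2 / (2 * \<sigma>\<^sup>2))"
    by (simp only: exp_add[symmetric] exp_le_cancel_iff)
  then show ?thesis unfolding normal_density_def using assms(1)
    by (simp add: mult.left_commute[of "exp (- 3/2)"] divide_right_mono)
qed

text \<open>Disjoint translates of the lowest slice of the up-set \<open>U\<close> stay in \<open>U\<close> and lose only a constant
  factor of mass as long as the total shift is at most \<open>\<sigma> / (a + 2)\<close>.\<close>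
lemma normal_upset_slice:
  assumes \<sigma>: "\<sigma> > 0" and a: "a \<ge> 0" and \<epsilon>: "0 < \<epsilon>" "\<epsilon> \<le> 1" and t: "t \<le> a * \<sigma>"
    and U: "U \<in> sets borel" and up: "\<And>u v. u \<in> U \<Longrightarrow> u \<le> v \<Longrightarrow> v \<in> U"
  shows "measure (density lborel (normal_density 0 \<sigma>)) {u \<in> U. t < u \<and> u \<le> t + \<sigma> * \<epsilon>}
    \<le> exp (3 / 2) * (a + 2) * \<epsilon> * measure (density lborel (normal_density 0 \<sigma>)) {u \<in> U. t < u}"
proof -
  let ?\<nu> = "density lborel (normal_density 0 \<sigma>)"
  interpret prob_space ?\<nu> by (rule prob_space_normal_density[OF \<sigma>])
  define h where "h = \<sigma> * \<epsilon>"
  have h: "h > 0" "h \<le> \<sigma>" using \<sigma> \<epsilon> by (auto simp: h_def)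
  define V where "V = {u \<in> U. t < u \<and> u \<le> t + h}"
  have V[measurable]: "V \<in> sets borel" unfolding V_def using U by measurable
  define W where "W j = {u. u - real j * h \<in> V}" for j :: nat
  have W[measurable]: "W j \<in> sets borel" for j
  proof -
    have "(\<lambda>u. u - real j * h) -` V \<inter> space borel \<in> sets borel" by (rule measurable_sets[OF _ V]) measurable
    then show ?thesis by (simp add: W_def vimage_def)
  qed
  \<comment> \<open>The number of translates: the last index N - 1 is at most 1 / ((a + 2)
    \<epsilon>), so its shift is still admissible, while the successor makes N at least that
    large.\<close>
  define N where "N = Suc (nat \<lfloor>1 / ((a + 2) * \<epsilon>)\<rfloor>)"
  have N: "real N \<ge> 1 / ((a + 2) * \<epsilon>)" using a \<epsilon> by (simp add: N_def) linarith
  have jh: "real j * h \<le> \<sigma> / (a + 2)" if "j < N" for j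
  proof -
    have "real j \<le> 1 / ((a + 2) * \<epsilon>)" using that a \<epsilon> unfolding N_def by (simp add: le_nat_floor less_Suc_eq_le) (metis le_nat_iff of_nat_le_iff of_int_of_nat_eq le_floor_iff divide_nonneg_nonneg zero_le_floor zero_le_one mult_nonneg_nonneg less_imp_le add_nonneg_nonneg zero_le_numeral)
    then have "real j * h \<le> 1 / ((a + 2) * \<epsilon>) * h" using h by (intro mult_right_mono) auto
    then show ?thesis using \<epsilon> by (simp add: h_def)
  qed
  have slice: "exp (- 3 / 2) * measure ?\<nu> V \<le> measure ?\<nu> (W j)" if j: "j < N" for j
  proof -
    let ?s = "real j * h"
    have "ennreal (exp (- 3 / 2)) * emeasure ?\<nu> V = (\<integral>\<^sup>+u. ennreal (exp (- 3 / 2)) * (ennreal (normal_density 0 \<sigma> u) * indicator V u) \<partial>lborel)"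
      by (simp add: emeasure_density nn_integral_cmult)
    also have "\<dots> \<le> (\<integral>\<^sup>+u. ennreal (normal_density 0 \<sigma> (?s + 1 * u)) * indicator (W j) (?s + 1 * u) \<partial>lborel)"
    proof (intro nn_integral_mono)
      fix u
      show "ennreal (exp (- 3 / 2)) * (ennreal (normal_density 0 \<sigma> u) * indicator V u) \<le> ennreal (normal_density 0 \<sigma> (?s + 1 * u)) * indicator (W j) (?s + 1 * u)"
      proof (cases "u \<in> V")
        case True
        then have "u \<le> (a + 1) * \<sigma>" using t h by (simp add: V_def ring_distribs)
        from normal_shift_ratio[OF \<sigma> a _ jh[OF j] this] h
        have "exp (- 3 / 2) * normal_density 0 \<sigma> u \<le> normal_density 0 \<sigma> (?s + u)" by (simp add: add.commute)
        then show ?thesis using True by (simp add: W_def ennreal_mult[symmetric] ennreal_leI)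
      qed simp
    qed
    also have "\<dots> = (\<integral>\<^sup>+u. ennreal (normal_density 0 \<sigma> u) * indicator (W j) u \<partial>lborel)"
      by (subst nn_integral_real_affine[of _ 1 ?s]) auto
    also have "\<dots> = emeasure ?\<nu> (W j)" by (simp add: emeasure_density)
    finally show ?thesis by (simp add: emeasure_eq_measure ennreal_mult[symmetric])
  qed
  \<comment> \<open>Membership in \<open>U\<close> survives the translation because \<open>U\<close>
    is an up-set; the consecutive half-open intervals give disjointness.\<close>
  have Wsub: "W j \<subseteq> {u \<in> U. t + real j * h < u \<and> u \<le> t + real (Suc j) * h}" for j
    using h up by (auto simp: W_def V_def ring_distribs)
  have disj: "disjoint_family_on W {..<N}"
    unfolding disjoint_family_on_def
  proof (intro ballI impI)
    have "W i \<inter> W j = {}" if "i < j" for i j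
    proof -
      have "real (Suc i) * h \<le> real j * h" using that h by (intro mult_right_mono) auto
      then show ?thesis using Wsub[of i] Wsub[of j] by force
    qed
    then show "W i \<inter> W j = {}" if "i \<noteq> j" for i j
      using that by (metis Int_commute linorder_neqE_nat)
  qed
  have VU: "{u \<in> U. t < u} \<in> sets borel" using U by measurable
  have "real N * (exp (- 3 / 2) * measure ?\<nu> V) = (\<Sum>j<N. exp (- 3 / 2) * measure ?\<nu> V)" by simp
  also have "\<dots> \<le> (\<Sum>j<N. measure ?\<nu> (W j))" by (intro sum_mono slice) auto
  also have "\<dots> = measure ?\<nu> (\<Union>j<N. W j)"
    using disj by (intro finite_measure_finite_Union[symmetric]) auto
  also have "\<dots> \<le> measure ?\<nu> {u \<in> U. t < u}"
  proof (intro finite_measure_mono)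
    show "(\<Union>j<N. W j) \<subseteq> {u \<in> U. t < u}"
    proof
      fix u assume "u \<in> (\<Union>j<N. W j)"
      then obtain j where "u \<in> U" "t + real j * h < u" using Wsub by blast
      moreover have "0 \<le> real j * h" using h by simp
      ultimately show "u \<in> {u \<in> U. t < u}" by simp
    qed
  qed (use VU in simp)
  finally have *: "real N * (exp (- 3 / 2) * measure ?\<nu> V) \<le> measure ?\<nu> {u \<in> U. t < u}" .
  have "1 / ((a + 2) * \<epsilon>) * (exp (- 3 / 2) * measure ?\<nu> V) \<le> real N * (exp (- 3 / 2) * measure ?\<nu> V)"
    by (intro mult_right_mono N) auto
  with * have "1 / ((a + 2) * \<epsilon>) * (exp (- 3 / 2) * measure ?\<nu> V) \<le> measure ?\<nu> {u \<in> U. t < u}" by simp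
  then have "(exp (3/2) * ((a + 2) * \<epsilon>)) * (1 / ((a + 2) * \<epsilon>) * (exp (- 3 / 2) * measure ?\<nu> V)) \<le> (exp (3/2) * ((a + 2) * \<epsilon>)) * measure ?\<nu> {u \<in> U. t < u}"
    using a \<epsilon> by (intro mult_left_mono) auto
  moreover have "(exp (3/2) * ((a + 2) * \<epsilon>)) * (1 / ((a + 2) * \<epsilon>) * (exp (- 3 / 2) * measure ?\<nu> V)) = (exp (3/2) * exp (-3/2)) * measure ?\<nu> V"
    using a \<epsilon> by simp
  moreover have "exp (3/2) * exp (-3/2) = (1::real)" by (simp flip: exp_add)
  ultimately have "1 * measure ?\<nu> V \<le> (exp (3/2) * ((a + 2) * \<epsilon>)) * measure ?\<nu> {u \<in> U. t < u}"
    by (simp only:)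
  then show ?thesis by (simp add: V_def h_def mult.assoc)
qed

text \<open>Beyond a standard deviations the density is at most exp (- a^2 / 2) / \<sigma>, and the
  slice has length \<sigma> \<epsilon>.\<close>

lemma normal_slice_far:
  assumes \<sigma>: "\<sigma> > 0" and a: "a \<ge> 0" and \<epsilon>: "0 < \<epsilon>" and t: "a * \<sigma> \<le> t"
  shows "measure (density lborel (normal_density 0 \<sigma>)) {u. t < u \<and> u \<le> t + \<sigma> * \<epsilon>} \<le> \<epsilon> * exp (- a\<^sup>2 / 2)"
proof -
  let ?\<nu> = "density lborel (normal_density 0 \<sigma>)"
  interpret prob_space ?\<nu> by (rule prob_space_normal_density[OF \<sigma>])
  have nd: "normal_density 0 \<sigma> u \<le> exp (- a\<^sup>2 / 2) / \<sigma>" if "t < u" for u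
  proof -
    have "(a * \<sigma>)\<^sup>2 \<le> u\<^sup>2" using that t a \<sigma> by (intro power_mono) auto
    then have "- u\<^sup>2 / (2 * \<sigma>\<^sup>2) \<le> - a\<^sup>2 / 2" using \<sigma> by (simp add: field_simps power_mult_distrib)
    then have "exp (- u\<^sup>2 / (2 * \<sigma>\<^sup>2)) \<le> exp (- a\<^sup>2 / 2)" by simp
    moreover have "sqrt (2 * pi * \<sigma>\<^sup>2) \<ge> \<sigma>"
    proof -
      have "\<sigma>\<^sup>2 * 1 \<le> \<sigma>\<^sup>2 * (2 * pi)" using pi_gt3 by (intro mult_left_mono) auto
      then show ?thesis by (intro real_le_rsqrt) (simp add: mult_ac)
    qed
    ultimately have "exp (- u\<^sup>2 / (2 * \<sigma>\<^sup>2)) / sqrt (2 * pi * \<sigma>\<^sup>2) \<le> exp (- a\<^sup>2 / 2) / \<sigma>"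
      using \<sigma> by (intro frac_le) auto
    then show ?thesis by (simp add: normal_density_def)
  qed
  have "emeasure ?\<nu> {u. t < u \<and> u \<le> t + \<sigma> * \<epsilon>} = (\<integral>\<^sup>+u. ennreal (normal_density 0 \<sigma> u) * indicator {t<..t + \<sigma> * \<epsilon>} u \<partial>lborel)"
    by (subst emeasure_density) (auto simp: greaterThanAtMost_def greaterThan_def atMost_def Int_def)
  also have "\<dots> \<le> (\<integral>\<^sup>+u. ennreal (exp (- a\<^sup>2 / 2) / \<sigma>) * indicator {t<..t + \<sigma> * \<epsilon>} u \<partial>lborel)"
    using nd by (intro nn_integral_mono) (auto simp: indicator_def intro!: ennreal_leI)
  also have "\<dots> = ennreal (exp (- a\<^sup>2 / 2) / \<sigma>) * ennreal (\<sigma> * \<epsilon>)"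
    using \<sigma> \<epsilon> by (simp add: nn_integral_cmult)
  also have "\<dots> = ennreal (\<epsilon> * exp (- a\<^sup>2 / 2))"
    using \<sigma> \<epsilon> by (simp add: ennreal_mult[symmetric])
  finally show ?thesis using \<epsilon> by (simp add: emeasure_eq_measure)
qed

text \<open>Disintegration along coordinate \<open>k\<close>: with \<open>x\<close> fixed, the
  resampled vector depends on one fresh normal value, so a Gaussian probability is an average of
  one-dimensional normal probabilities.\<close>

lemma emeasure_gauss_resample:
  assumes G: "gauss_law I S G" and I: "finite I" "k \<in> I" and pos: "S k k > 0"
    and sym: "\<And>i j. i \<in> I \<Longrightarrow> j \<in> I \<Longrightarrow> S i j = S j i" and E: "E \<in> sets G"
  shows "emeasure G E = (\<integral>\<^sup>+x. emeasure (density lborel (normal_density 0 (sqrt (S k k)))) {u. resample I S k x u \<in> E} \<partial>G)"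
proof -
  interpret prob_space G using G by (simp add: gauss_law_def)
  have sets[measurable_cong]: "sets G = sets (PiM I (\<lambda>_. borel))" using G by (simp add: gauss_law_def)
  have E': "E \<in> sets (PiM I (\<lambda>_. borel))" using E sets by simp
  interpret GG: pair_prob_space G G ..
  have kf: "(\<lambda>p. fst p j) \<in> borel_measurable (G \<Otimes>\<^sub>M G)" "(\<lambda>p. snd p j) \<in> borel_measurable (G \<Otimes>\<^sub>M G)" if "j \<in> I" for j
    using that by (auto intro!: measurable_compose[OF measurable_fst] measurable_compose[OF measurable_snd] simp: measurable_cong_sets[OF sets refl])
  have T: "(\<lambda>(x, z). resample I S k x (z k)) \<in> (G \<Otimes>\<^sub>M G) \<rightarrow>\<^sub>M PiM I (\<lambda>_. borel)"
    unfolding resample_def case_prod_beta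
    by (intro measurable_restrict borel_measurable_add borel_measurable_times borel_measurable_diff borel_measurable_const kf I)
  have R: "resample I S k x \<in> borel \<rightarrow>\<^sub>M PiM I (\<lambda>_. borel)" for x
    unfolding resample_def[abs_def] by measurable
  have k: "(\<lambda>z. z k) \<in> borel_measurable G" using I by (simp add: measurable_cong_sets[OF sets refl])
  have "emeasure G E = emeasure (distr (G \<Otimes>\<^sub>M G) (PiM I (\<lambda>_. borel)) (\<lambda>(x, z). resample I S k x (z k))) E"
    by (simp only: gauss_law_resample[OF G I pos sym])
  also have "\<dots> = emeasure (G \<Otimes>\<^sub>M G) ((\<lambda>(x, z). resample I S k x (z k)) -` E \<inter> space (G \<Otimes>\<^sub>M G))"
    by (rule emeasure_distr[OF T E'])
  also have "\<dots> = (\<integral>\<^sup>+x. emeasure G (Pair x -` ((\<lambda>(x, z). resample I S k x (z k)) -` E \<inter> space (G \<Otimes>\<^sub>M G))) \<partial>G)"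
    by (rule emeasure_pair_measure_alt) (rule measurable_sets[OF T E'])
  also have "\<dots> = (\<integral>\<^sup>+x. emeasure (distr G borel (\<lambda>z. z k)) {u. resample I S k x u \<in> E} \<partial>G)"
  proof (intro nn_integral_cong)
    fix x assume x: "x \<in> space G"
    have "{u. resample I S k x u \<in> E} \<in> sets borel"
      using measurable_sets[OF R E', of x] by (simp add: vimage_def)
    then show "emeasure G (Pair x -` ((\<lambda>(x, z). resample I S k x (z k)) -` E \<inter> space (G \<Otimes>\<^sub>M G)))
       = emeasure (distr G borel (\<lambda>z. z k)) {u. resample I S k x u \<in> E}"
      using x by (subst emeasure_distr[OF k]) (auto simp: space_pair_measure intro!: arg_cong[where f="emeasure G"])
  qed
  finally show ?thesis unfolding gauss_law_marginal[OF G I pos] .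
qed

text \<open>Nazarov's inequality. The event is split according to the coordinate \<open>k\<close> at which the standardised
  maximum is attained (ties broken by an enumeration); given the residuals this is an up-set
  in \<open>z\<^sub>k\<close>, because correlations are at most 1. Coordinates with \<open>t\<close> beyond
  \<open>sqrt (2 ln (card I))\<close> standard deviations contribute at most \<open>\<epsilon>\<close> altogether.\<close>
lemma gauss_anticoncentration:
  assumes G: "gauss_law I S G" and I: "finite I" "I \<noteq> {}" and pos: "\<And>k. k \<in> I \<Longrightarrow> S k k > 0"
    and sym: "\<And>i j. i \<in> I \<Longrightarrow> j \<in> I \<Longrightarrow> S i j = S j i" and \<epsilon>: "0 < \<epsilon>" "\<epsilon> \<le> 1"
  shows "measure G {z \<in> space G. (\<exists>k\<in>I. t < z k) \<and> (\<forall>k\<in>I. z k \<le> t + sqrt (S k k) * \<epsilon>)}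
    \<le> (exp (3 / 2) * (sqrt (2 * ln (real (card I))) + 2) + 1) * \<epsilon>"
proof -
  interpret prob_space G using G by (simp add: gauss_law_def)
  have sets[measurable_cong]: "sets G = sets (PiM I (\<lambda>_. borel))" using G by (simp add: gauss_law_def)
  have card: "real (card I) \<ge> 1" using I by (simp add: Suc_leI card_gt_0_iff)
  \<comment> \<open>Chosen so that exp (- a^2 / 2) is exactly 1 / card I.\<close>
  define a where "a = sqrt (2 * ln (real (card I)))"
  have a: "a \<ge> 0" "a\<^sup>2 = 2 * ln (real (card I))" using card by (auto simp: a_def)
  have expa: "exp (- a\<^sup>2 / 2) = 1 / real (card I)" using card by (simp add: a exp_minus inverse_eq_divide)
  define C where "C = exp (3 / 2) * (a + 2)"
  have C: "C \<ge> 0" using a by (simp add: C_def)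
  \<comment> \<open>An injective labelling for tie-breaking: exactly one coordinate counts as
    maximiser, which makes the events \<open>F k\<close> disjoint.\<close>
  obtain e :: "'a \<Rightarrow> nat" where e: "inj_on e I" using finite_imp_inj_to_nat_seg[OF I(1)] by blast
  define \<sigma> where "\<sigma> k = sqrt (S k k)" for k
  have \<sigma>: "\<sigma> k > 0" if "k \<in> I" for k using pos[OF that] by (simp add: \<sigma>_def)
  define D where "D k z = (z k - t) / \<sigma> k" for k and z :: "'a \<Rightarrow> real"
  define A where "A k z \<longleftrightarrow> (\<forall>j\<in>I. D j z < D k z \<or> D j z = D k z \<and> e k \<le> e j)" for k z
  define E where "E k = {z \<in> space G. A k z \<and> t < z k \<and> z k \<le> t + \<sigma> k * \<epsilon>}" for k
  define F where "F k = {z \<in> space G. A k z \<and> t < z k}" for k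
  have Dm[measurable]: "D k \<in> borel_measurable (PiM I (\<lambda>_. borel))" if "k \<in> I" for k
    unfolding D_def[abs_def] using that by measurable
  have Am: "{z \<in> space G. A k z} \<in> sets G" if "k \<in> I" for k
  proof -
    have "{z \<in> space G. A k z} = (\<Inter>j\<in>I. {z \<in> space G. D j z < D k z} \<union> {z \<in> space G. D j z = D k z \<and> e k \<le> e j})"
      using I by (auto simp: A_def)
    also have "\<dots> \<in> sets G"
    proof (intro sets.finite_INT I sets.Un)
      fix j assume j: "j \<in> I"
      note [measurable] = Dm[OF j] Dm[OF that]
      show "{z \<in> space G. D j z < D k z} \<in> sets G" by measurable
      have DG: "D j \<in> borel_measurable G" "D k \<in> borel_measurable G"
        using Dm[OF j] Dm[OF that] by (simp_all add: measurable_cong_sets[OF sets refl])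
      have "{z \<in> space G. D j z = D k z \<and> e k \<le> e j} = (if e k \<le> e j then {z \<in> space G. D j z = D k z} else {})" by auto
      also have "\<dots> \<in> sets G" using borel_measurable_eq[OF DG] by simp
      finally show "{z \<in> space G. D j z = D k z \<and> e k \<le> e j} \<in> sets G" .
    qed
    finally show ?thesis .
  qed
  have coord: "(\<lambda>z. z k) \<in> borel_measurable G" if "k \<in> I" for k
    using that by (simp add: measurable_cong_sets[OF sets refl])
  have Fm: "F k \<in> sets G" and Em: "E k \<in> sets G" if "k \<in> I" for k
  proof -
    note [measurable] = coord[OF that] Am[OF that]
    have "F k = {z \<in> space G. A k z} \<inter> {z \<in> space G. t < z k}" by (auto simp: F_def)
    also have "\<dots> \<in> sets G" by measurable
    finally show "F k \<in> sets G" .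
    have "E k = {z \<in> space G. A k z} \<inter> {z \<in> space G. t < z k \<and> z k \<le> t + \<sigma> k * \<epsilon>}" by (auto simp: E_def)
    also have "\<dots> \<in> sets G" by measurable
    finally show "E k \<in> sets G" .
  qed
  have disj: "disjoint_family_on F I"
    unfolding disjoint_family_on_def
  proof (intro ballI impI)
    fix k l assume kl: "k \<in> I" "l \<in> I" "k \<noteq> l"
    have "False" if "z \<in> F k" "z \<in> F l" for z
    proof -
      have "D l z < D k z \<or> D l z = D k z \<and> e k \<le> e l" "D k z < D l z \<or> D k z = D l z \<and> e l \<le> e k"
        using that kl by (auto simp: F_def A_def)
      then have "e k = e l" by auto
      then show False using e kl by (auto dest: inj_onD)
    qed
    then show "F k \<inter> F l = {}" by auto
  qed
  have step: "prob (E k) \<le> C * \<epsilon> * prob (F k) + \<epsilon> / real (card I)" if k: "k \<in> I" for k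
  proof (cases "t \<le> a * \<sigma> k")
    case True
    let ?\<nu> = "density lborel (normal_density 0 (sqrt (S k k)))"
    interpret \<nu>: prob_space ?\<nu> by (rule prob_space_normal_density) (use pos[OF k] in simp)
    have R: "resample I S k x \<in> borel \<rightarrow>\<^sub>M PiM I (\<lambda>_. borel)" for x
      unfolding resample_def[abs_def] by measurable
    have Rk: "resample I S k x u k = u" for x u using k pos[OF k] by (simp add: resample_def)
    have Rs: "resample I S k x u \<in> space G" for x u
      using sets_eq_imp_space_eq[OF sets] by (simp add: space_PiM resample_def)
    have "emeasure G (E k) = (\<integral>\<^sup>+x. emeasure ?\<nu> {u. resample I S k x u \<in> E k} \<partial>G)"
      by (rule emeasure_gauss_resample[OF G I(1) k pos[OF k] sym Em[OF k]])
    also have "\<dots> \<le> (\<integral>\<^sup>+x. ennreal (C * \<epsilon>) * emeasure ?\<nu> {u. resample I S k x u \<in> F k} \<partial>G)"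
    proof (intro nn_integral_mono)
      fix x
      define U where "U = {u. A k (resample I S k x u)}"
      have "U = (resample I S k x) -` {z \<in> space G. A k z} \<inter> space borel"
        using Rs by (auto simp: U_def)
      also have "\<dots> \<in> sets borel"
        using Am[OF k] by (intro measurable_sets[OF R]) (simp add: sets)
      finally have U: "U \<in> sets borel" .
      have up: "v \<in> U" if u: "u \<in> U" "u \<le> v" for u v
      proof -
        have "D j (resample I S k x v) - D k (resample I S k x v) \<le> D j (resample I S k x u) - D k (resample I S k x u)" if j: "j \<in> I" for j
        proof -
          \<comment> \<open>The slopes of the standardised coordinates \<open>j\<close> and
            \<open>k\<close> in the resampled value. Since \<open>k\<close> rises at least as fast
            as \<open>j\<close>, a maximiser stays one when the value increases.\<close>
          have "S j k / S k k / \<sigma> j \<le> 1 / \<sigma> k"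
          proof -
            have "S j k \<le> \<sigma> k * \<sigma> j" unfolding \<sigma>_def
              by (rule gauss_cauchy_schwarz[OF G I(1) k j sym[OF k j] pos[OF k] pos[OF j]])
            moreover have "S k k = \<sigma> k * \<sigma> k" using pos[OF k] by (simp add: \<sigma>_def)
            ultimately show ?thesis using \<sigma>[OF k] \<sigma>[OF j] by (simp add: field_simps)
          qed
          then have "(v - u) * (S j k / S k k / \<sigma> j) \<le> (v - u) * (1 / \<sigma> k)"
            using u by (intro mult_left_mono) auto
          moreover have "D j (resample I S k x v) - D j (resample I S k x u) = (v - u) * (S j k / S k k / \<sigma> j)"
            using j by (simp add: D_def resample_def diff_divide_distrib[symmetric] algebra_simps)
          moreover have "D k (resample I S k x v) - D k (resample I S k x u) = (v - u) * (1 / \<sigma> k)"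
            by (simp add: D_def Rk diff_divide_distrib[symmetric])
          ultimately show ?thesis by linarith
        qed
        note mono = this
        have "D j (resample I S k x v) < D k (resample I S k x v) \<or> D j (resample I S k x v) = D k (resample I S k x v) \<and> e k \<le> e j"
          if j: "j \<in> I" for j
        proof -
          have "D j (resample I S k x u) < D k (resample I S k x u) \<or> D j (resample I S k x u) = D k (resample I S k x u) \<and> e k \<le> e j"
            using u(1) j by (auto simp: U_def A_def)
          then show ?thesis using mono[OF j] by linarith
        qed
        then show ?thesis by (auto simp: U_def A_def)
      qed
      have eE: "{u. resample I S k x u \<in> E k} = {u \<in> U. t < u \<and> u \<le> t + sqrt (S k k) * \<epsilon>}"
        using Rs by (auto simp: E_def U_def Rk \<sigma>_def)
      have eF: "{u. resample I S k x u \<in> F k} = {u \<in> U. t < u}"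
        using Rs by (auto simp: F_def U_def Rk)
      have "measure ?\<nu> {u \<in> U. t < u \<and> u \<le> t + sqrt (S k k) * \<epsilon>} \<le> exp (3 / 2) * (a + 2) * \<epsilon> * measure ?\<nu> {u \<in> U. t < u}"
        by (rule normal_upset_slice[OF _ a(1) \<epsilon> _ U up]) (use pos[OF k] True in \<open>auto simp: \<sigma>_def\<close>)
      then show "emeasure ?\<nu> {u. resample I S k x u \<in> E k} \<le> ennreal (C * \<epsilon>) * emeasure ?\<nu> {u. resample I S k x u \<in> F k}"
        unfolding eE eF \<nu>.emeasure_eq_measure using C \<epsilon>
        by (simp add: ennreal_mult[symmetric] C_def)
    qed
    also have "\<dots> = ennreal (C * \<epsilon>) * (\<integral>\<^sup>+x. emeasure ?\<nu> {u. resample I S k x u \<in> F k} \<partial>G)"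
    proof (rule nn_integral_cmult)
      have T: "(\<lambda>p. resample I S k (fst p) (snd p)) \<in> G \<Otimes>\<^sub>M borel \<rightarrow>\<^sub>M PiM I (\<lambda>_. borel)"
        unfolding resample_def
        by (intro measurable_restrict borel_measurable_add borel_measurable_times borel_measurable_diff borel_measurable_const
           measurable_compose[OF measurable_fst coord] measurable_snd k)
      have T': "(\<lambda>p. resample I S k (fst p) (snd p)) \<in> G \<Otimes>\<^sub>M ?\<nu> \<rightarrow>\<^sub>M PiM I (\<lambda>_. borel)"
        using T by (simp cong: measurable_cong_sets add: sets_pair_measure_cong[OF refl, of ?\<nu> borel])
      have "Measurable.pred (G \<Otimes>\<^sub>M ?\<nu>) (\<lambda>p. resample I S k (fst p) (snd p) \<in> F k)"
        by (rule pred_sets1[OF _ T']) (use Fm[OF k] sets in auto)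
      then have "(\<lambda>p. resample I S k (fst p) (snd p)) -` F k \<inter> space (G \<Otimes>\<^sub>M ?\<nu>) \<in> sets (G \<Otimes>\<^sub>M ?\<nu>)"
        by (simp add: pred_def vimage_def Int_def conj_commute)
      from \<nu>.measurable_emeasure_Pair[OF this]
      show "(\<lambda>x. emeasure ?\<nu> {u. resample I S k x u \<in> F k}) \<in> borel_measurable G"
        by (rule measurable_cong[THEN iffD1, rotated])
          (auto simp: space_pair_measure vimage_def Int_def intro!: arg_cong[where f="emeasure ?\<nu>"])
    qed
    also have "(\<integral>\<^sup>+x. emeasure ?\<nu> {u. resample I S k x u \<in> F k} \<partial>G) = emeasure G (F k)"
      by (rule emeasure_gauss_resample[OF G I(1) k pos[OF k] sym Fm[OF k], symmetric])
    finally have "prob (E k) \<le> C * \<epsilon> * prob (F k)"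
      using C \<epsilon> by (simp add: emeasure_eq_measure ennreal_mult[symmetric])
    also have "\<dots> \<le> C * \<epsilon> * prob (F k) + \<epsilon> / real (card I)" using \<epsilon> by simp
    finally show ?thesis .
  next
    \<comment> \<open>The level is more than a standard deviations away, where a slice has mass at
      most \<epsilon> / card I; this is affordable for every coordinate at once.\<close>
    case False
    let ?\<nu> = "density lborel (normal_density 0 (\<sigma> k))"
    have "prob (E k) \<le> prob ((\<lambda>z. z k) -` {u. t < u \<and> u \<le> t + \<sigma> k * \<epsilon>} \<inter> space G)"
      using coord[OF k] by (intro finite_measure_mono) (auto simp: E_def)
    also have "\<dots> = measure (distr G borel (\<lambda>z. z k)) {u. t < u \<and> u \<le> t + \<sigma> k * \<epsilon>}"
      using coord[OF k] by (intro measure_distr[symmetric]) auto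
    also have "\<dots> \<le> \<epsilon> * exp (- a\<^sup>2 / 2)"
      unfolding gauss_law_marginal[of I S G k, OF G I(1) k pos[of k, OF k]] \<sigma>_def[symmetric]
      by (rule normal_slice_far[OF \<sigma>[OF k] a(1) \<epsilon>(1)]) (use False in simp)
    also have "\<dots> = \<epsilon> / real (card I)" unfolding expa by simp
    also have "\<dots> \<le> C * \<epsilon> * prob (F k) + \<epsilon> / real (card I)" using C \<epsilon> by simp
    finally show ?thesis .
  qed
  have "{z \<in> space G. (\<exists>k\<in>I. t < z k) \<and> (\<forall>k\<in>I. z k \<le> t + sqrt (S k k) * \<epsilon>)} \<subseteq> (\<Union>k\<in>I. E k)"
  proof
    fix z assume z: "z \<in> {z \<in> space G. (\<exists>k\<in>I. t < z k) \<and> (\<forall>k\<in>I. z k \<le> t + sqrt (S k k) * \<epsilon>)}"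
    then obtain k0 where k0: "k0 \<in> I" "t < z k0" by auto
    let ?B = "{k \<in> I. \<forall>j\<in>I. D j z \<le> D k z}"
    have "Max ((\<lambda>k. D k z) ` I) \<in> (\<lambda>k. D k z) ` I" using I by (intro Max_in) auto
    then obtain m where "m \<in> I" "D m z = Max ((\<lambda>k. D k z) ` I)" by auto
    then have "m \<in> ?B" using I by auto
    then have B: "finite (e ` ?B)" "e ` ?B \<noteq> {}" using I by auto
    from Min_in[OF B] obtain k where k: "k \<in> ?B" "e k = Min (e ` ?B)" by auto
    have "A k z" unfolding A_def
    proof (intro ballI)
      fix j assume j: "j \<in> I"
      show "D j z < D k z \<or> D j z = D k z \<and> e k \<le> e j"
      proof (cases "D j z = D k z")
        case True
        then have "j \<in> ?B" using k j by auto
        then show ?thesis using True k(2) B(1) by auto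
      next
        case False
        then show ?thesis using k j by force
      qed
    qed
    moreover have "t < z k"
    proof -
      have "0 < D k0 z" using k0 \<sigma>[OF k0(1)] by (simp add: D_def)
      then have "0 < D k z" using k k0 by (auto intro: less_le_trans)
      then show ?thesis using k \<sigma>[of k] by (simp add: D_def zero_less_divide_iff)
    qed
    ultimately have "z \<in> E k" using z k by (auto simp: E_def \<sigma>_def)
    then show "z \<in> (\<Union>k\<in>I. E k)" using k by auto
  qed
  then have "prob {z \<in> space G. (\<exists>k\<in>I. t < z k) \<and> (\<forall>k\<in>I. z k \<le> t + sqrt (S k k) * \<epsilon>)} \<le> prob (\<Union>k\<in>I. E k)"
    using Em I by (intro finite_measure_mono) auto
  also have "\<dots> \<le> (\<Sum>k\<in>I. prob (E k))"
    using Em I by (intro finite_measure_subadditive_finite) auto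
  also have "\<dots> \<le> (\<Sum>k\<in>I. C * \<epsilon> * prob (F k) + \<epsilon> / real (card I))" by (intro sum_mono step)
  also have "\<dots> = C * \<epsilon> * (\<Sum>k\<in>I. prob (F k)) + \<epsilon>"
    using card by (simp add: sum.distrib sum_distrib_left)
  \<comment> \<open>Disjointness replaces a union bound by total mass at most 1, so the dimension
    enters only through \<open>a\<close>.\<close>
  also have "(\<Sum>k\<in>I. prob (F k)) = prob (\<Union>k\<in>I. F k)"
    using Fm I disj by (intro finite_measure_finite_Union[symmetric]) auto
  also have "C * \<epsilon> * prob (\<Union>k\<in>I. F k) + \<epsilon> \<le> C * \<epsilon> * 1 + \<epsilon>"
    using C \<epsilon> by (intro add_right_mono mult_left_mono) auto
  finally show ?thesis by (simp add: C_def a_def algebra_simps)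
qed

section \<open>Stability of Gaussian sums and exponential moments\<close>

lemma gauss_law_scaled_sum:
  assumes G: "gauss_law I S G" and I: "finite I" and n: "n > 0"
  shows "gauss_law I S (distr (PiM {..<n} (\<lambda>_. G)) (PiM I (\<lambda>_. borel)) (\<lambda>z. \<lambda>k\<in>I. (\<Sum>i<n. z i k) / sqrt (real n)))"
proof -
  interpret prob_space G using G by (simp add: gauss_law_def)
  have sets[measurable_cong]: "sets G = sets (PiM I (\<lambda>_. borel))" using G by (simp add: gauss_law_def)
  have ch: "(\<integral>z. cos ((\<Sum>k\<in>I. a k * z k) + c) \<partial>G) = exp (- quad_form I S a / 2) * cos c" for a c
    using G by (simp add: gauss_law_def)
  have P: "prob_space (PiM {..<m::nat} (\<lambda>_. G))" for m by (intro prob_space_PiM prob_space_axioms)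
  have coord: "(\<lambda>z. z k) \<in> borel_measurable G" if "k \<in> I" for k
    using that by (simp add: measurable_cong_sets[OF sets refl])
  have coord2: "(\<lambda>z. z i k) \<in> borel_measurable (PiM {..<m::nat} (\<lambda>_. G))" if "k \<in> I" "i < m" for i k m
    using that by (intro measurable_compose[OF measurable_component_singleton[of i "{..<m}" "\<lambda>_. G"] coord[of k]]) auto
  have T: "(\<lambda>z. \<lambda>k\<in>I. (\<Sum>i<n. z i k) / sqrt (real n)) \<in> PiM {..<n} (\<lambda>_. G) \<rightarrow>\<^sub>M PiM I (\<lambda>_. borel)"
    by (intro measurable_restrict borel_measurable_divide borel_measurable_sum coord2 borel_measurable_const) auto
  have sumch: "(\<integral>z. cos ((\<Sum>i<m. \<Sum>k\<in>I. a k * z i k) + c) \<partial>PiM {..<m} (\<lambda>_. G)) = exp (- real m * quad_form I S a / 2) * cos c" for a m c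
  proof (induction m arbitrary: c)
    case 0
    show ?case by (simp add: PiM_empty lebesgue_integral_count_space_finite)
  next
    case (Suc m)
    have "(\<lambda>z. (\<Sum>i<Suc m. \<Sum>k\<in>I. a k * z i k) + c) \<in> borel_measurable (PiM {..<Suc m} (\<lambda>_. G))"
      by (intro borel_measurable_add borel_measurable_sum borel_measurable_times borel_measurable_const coord2) auto
    from measurable_compose[OF this, of cos borel]
    have "integrable (PiM {..<Suc m} (\<lambda>_. G)) (\<lambda>z. cos ((\<Sum>i<Suc m. \<Sum>k\<in>I. a k * z i k) + c))"
      by (intro finite_measure.integrable_const_bound[where B=1] prob_space.finite_measure P) (auto simp del: sum.lessThan_Suc)
    then have "(\<integral>z. cos ((\<Sum>i<Suc m. \<Sum>k\<in>I. a k * z i k) + c) \<partial>PiM {..<Suc m} (\<lambda>_. G))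
       = (\<integral>z. (\<integral>y. cos ((\<Sum>k\<in>I. a k * y k) + ((\<Sum>i<m. \<Sum>k\<in>I. a k * z i k) + c)) \<partial>G) \<partial>PiM {..<m} (\<lambda>_. G))"
      by (subst PiM_lessThan_Suc_integral[OF prob_space_axioms]) (simp_all add: add_ac)
    also have "\<dots> = exp (- quad_form I S a / 2) * (exp (- real m * quad_form I S a / 2) * cos c)"
      by (simp add: ch Suc.IH)
    also have "\<dots> = exp (- real (Suc m) * quad_form I S a / 2) * cos c"
      by (simp add: mult.assoc[symmetric] flip: exp_add) (simp add: field_simps)
    finally show ?case .
  qed
  show ?thesis
    unfolding gauss_law_def
  proof (intro conjI allI)
    show "prob_space (distr (PiM {..<n} (\<lambda>_. G)) (PiM I (\<lambda>_. borel)) (\<lambda>z. \<lambda>k\<in>I. (\<Sum>i<n. z i k) / sqrt (real n)))"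
      by (rule prob_space.prob_space_distr[OF P T])
    fix a :: "'a \<Rightarrow> real" and c :: real
    define a' where "a' = (\<lambda>k. a k / sqrt (real n))"
    have q: "quad_form I S a' = quad_form I S a / real n"
      using n by (simp add: quad_form_def a'_def sum_divide_distrib)
    have "(\<integral>z. cos ((\<Sum>k\<in>I. a k * z k) + c) \<partial>distr (PiM {..<n} (\<lambda>_. G)) (PiM I (\<lambda>_. borel)) (\<lambda>z. \<lambda>k\<in>I. (\<Sum>i<n. z i k) / sqrt (real n)))
      = (\<integral>z. cos ((\<Sum>k\<in>I. a k * ((\<Sum>i<n. z i k) / sqrt (real n))) + c) \<partial>PiM {..<n} (\<lambda>_. G))"
      by (subst integral_distr[OF T]) (auto cong: sum.cong)
    also have "\<dots> = (\<integral>z. cos ((\<Sum>i<n. \<Sum>k\<in>I. a' k * z i k) + c) \<partial>PiM {..<n} (\<lambda>_. G))"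
      unfolding a'_def sum.swap[of _ I "{..<n}"] sum_divide_distrib sum_distrib_left by (simp add: mult_ac)
    also have "\<dots> = exp (- quad_form I S a / 2) * cos c"
      unfolding sumch q using n by simp
    finally show "(\<integral>z. cos ((\<Sum>k\<in>I. a k * z k) + c) \<partial>distr (PiM {..<n} (\<lambda>_. G)) (PiM I (\<lambda>_. borel)) (\<lambda>z. \<lambda>k\<in>I. (\<Sum>i<n. z i k) / sqrt (real n)))
      = exp (- quad_form I S a / 2) * cos c" .
  qed simp
qed

text \<open>For \<sigma> \<le> 1 the weight exp (z^2 / 4) removes at most half of the Gaussian
  exponent. What remains is sqrt 2 times the density of variance 2 \<sigma>^2.\<close>

lemma normal_exp_moment:
  assumes \<sigma>: "\<sigma> > 0" "\<sigma> \<le> 1"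
  shows "integrable (density lborel (normal_density 0 \<sigma>)) (\<lambda>z. exp (z\<^sup>2 / 4))"
    "(\<integral>z. exp (z\<^sup>2 / 4) \<partial>density lborel (normal_density 0 \<sigma>)) \<le> 2"
proof -
  have le: "normal_density 0 \<sigma> z * exp (z\<^sup>2 / 4) \<le> 2 * normal_density 0 (sqrt 2 * \<sigma>) z" for z
  proof -
    have "z\<^sup>2 / 4 \<le> z\<^sup>2 / (4 * \<sigma>\<^sup>2)"
    proof (intro divide_left_mono)
      show "4 * \<sigma>\<^sup>2 \<le> 4" using \<sigma> by (simp add: power_le_one)
    qed (use \<sigma> in auto)
    then have "- z\<^sup>2 / (2 * \<sigma>\<^sup>2) + z\<^sup>2 / 4 \<le> - z\<^sup>2 / (4 * \<sigma>\<^sup>2)"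
      by (simp add: field_simps)
    then have 1: "exp (- z\<^sup>2 / (2 * \<sigma>\<^sup>2)) * exp (z\<^sup>2 / 4) \<le> exp (- z\<^sup>2 / (4 * \<sigma>\<^sup>2))" by (simp flip: exp_add)
    have "normal_density 0 \<sigma> z * exp (z\<^sup>2 / 4) = 1 / sqrt (2 * pi * \<sigma>\<^sup>2) * (exp (- z\<^sup>2 / (2 * \<sigma>\<^sup>2)) * exp (z\<^sup>2 / 4))"
      by (simp add: normal_density_def)
    also have "\<dots> \<le> 1 / sqrt (2 * pi * \<sigma>\<^sup>2) * exp (- z\<^sup>2 / (4 * \<sigma>\<^sup>2))" by (intro mult_left_mono 1) auto
    also have "\<dots> = sqrt 2 * normal_density 0 (sqrt 2 * \<sigma>) z"
      using \<sigma> by (simp add: normal_density_def power_mult_distrib real_sqrt_mult field_simps)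
    also have "\<dots> \<le> 2 * normal_density 0 (sqrt 2 * \<sigma>) z"
      by (intro mult_right_mono) (auto intro: real_le_lsqrt)
    finally show ?thesis .
  qed
  have s2: "sqrt 2 * \<sigma> > 0" using \<sigma> by simp
  have int: "integrable lborel (\<lambda>z. normal_density 0 \<sigma> z * exp (z\<^sup>2 / 4))"
    by (rule Bochner_Integration.integrable_bound[of _ "\<lambda>z. 2 * normal_density 0 (sqrt 2 * \<sigma>) z"])
      (use le s2 in \<open>auto intro!: AE_I2\<close>)
  then show "integrable (density lborel (normal_density 0 \<sigma>)) (\<lambda>z. exp (z\<^sup>2 / 4))"
    by (subst integrable_density) auto
  have "(\<integral>z. exp (z\<^sup>2 / 4) \<partial>density lborel (normal_density 0 \<sigma>)) = (\<integral>z. normal_density 0 \<sigma> z * exp (z\<^sup>2 / 4) \<partial>lborel)"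
    by (subst integral_density) auto
  also have "\<dots> \<le> (\<integral>z. 2 * normal_density 0 (sqrt 2 * \<sigma>) z \<partial>lborel)"
    by (rule integral_mono) (use le int s2 in auto)
  also have "\<dots> = 2" using s2 by simp
  finally show "(\<integral>z. exp (z\<^sup>2 / 4) \<partial>density lborel (normal_density 0 \<sigma>)) \<le> 2" .
qed

text \<open>Stands in for Jensen's inequality: the squared logarithm is concave only beyond e, so it
  is bounded by a function linear in \<open>x\<close>. With \<open>a\<close> above the mean of
  \<open>x\<close>, the expectation is at most 2 (ln a)^2 + 2.\<close>

lemma ln_square_le:
  fixes x a :: real
  assumes "x \<ge> 1" "a \<ge> 1"
  shows "(ln x)\<^sup>2 \<le> 2 * (ln a)\<^sup>2 + 2 * (x / a)"
proof (cases "x \<le> a")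
  case True
  then have "(ln x)\<^sup>2 \<le> (ln a)\<^sup>2" using assms by (intro power_mono) auto
  moreover have "0 \<le> x / a" using assms by simp
  moreover have "0 \<le> (ln a)\<^sup>2" by simp
  ultimately show ?thesis by linarith
next
  case False
  define y where "y = x / a"
  have y: "y \<ge> 1" using False assms by (simp add: y_def)
  have x: "ln x = ln a + ln y" using assms y by (simp add: y_def ln_div)
  have "ln y = 2 * ln (sqrt y)" using y by (simp add: ln_sqrt)
  moreover have "ln (sqrt y) \<le> sqrt y / exp 1"
    using ln_le_minus_one[of "sqrt y / exp 1"] y by (simp add: ln_div)
  moreover have "sqrt y / exp 1 \<le> sqrt y / 2"
    using exp_ge_add_one_self[of 1] y by (intro divide_left_mono) auto
  ultimately have "ln y \<le> sqrt y" by linarith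
  then have "(ln y)\<^sup>2 \<le> (sqrt y)\<^sup>2" using y by (intro power_mono) auto
  then have 1: "(ln y)\<^sup>2 \<le> y" using y by simp
  have "(ln a + ln y)\<^sup>2 \<le> 2 * (ln a)\<^sup>2 + 2 * (ln y)\<^sup>2"
    using zero_le_square[of "ln a - ln y"] by (simp add: power2_eq_square algebra_simps)
  then show ?thesis using 1 x by (simp add: y_def)
qed

section \<open>Degenerate U-statistics\<close>

text \<open>Doubling the index set by a sign turns the maximum of absolute values into an ordinary
  maximum, so the calculus of \<open>smax\<close> carries over.\<close>

definition signed :: "('i \<Rightarrow> real) \<Rightarrow> 'i \<times> bool \<Rightarrow> real" where
  "signed w = (\<lambda>(k, s). if s then w k else - w k)"

definition snorm :: "real \<Rightarrow> 'i set \<Rightarrow> ('i \<Rightarrow> real) \<Rightarrow> real" where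
  "snorm \<beta> I w = smax \<beta> (I \<times> UNIV) (signed w)"

text \<open>The gradient of \<open>snorm\<close>: the weight of the positive copy of a coordinate
  minus that of its negative copy.\<close>

definition sgrad :: "real \<Rightarrow> 'i set \<Rightarrow> ('i \<Rightarrow> real) \<Rightarrow> 'i \<Rightarrow> real" where
  "sgrad \<beta> I w k = softmax \<beta> (I \<times> UNIV) (signed w) (k, True) - softmax \<beta> (I \<times> UNIV) (signed w) (k, False)"

lemma snorm_measurable[measurable (raw)]:
  assumes "\<And>k. k \<in> I \<Longrightarrow> (\<lambda>x. W x k) \<in> borel_measurable M"
  shows "(\<lambda>x. snorm \<beta> I (W x)) \<in> borel_measurable M"
  unfolding snorm_def
proof (rule smax_measurable)
  fix k :: "'a \<times> bool" assume "k \<in> I \<times> UNIV"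
  then have [measurable]: "(\<lambda>x. W x (fst k)) \<in> borel_measurable M" using assms by auto
  show "(\<lambda>x. signed (W x) k) \<in> borel_measurable M"
    unfolding signed_def case_prod_beta by simp
qed

context
  fixes I :: "'i set" and \<beta> :: real
  assumes I: "finite I" "I \<noteq> {}" and \<beta>: "\<beta> > 0"
begin

lemma signed_index: "finite (I \<times> (UNIV :: bool set))" "I \<times> (UNIV :: bool set) \<noteq> {}"
  using I by auto

lemma snorm_ge:
  assumes "k \<in> I"
  shows "\<bar>w k\<bar> \<le> snorm \<beta> I w"
  using smax_ge[OF signed_index(1), of "(k, True)" \<beta> "signed w"] smax_ge[OF signed_index(1), of "(k, False)" \<beta> "signed w"] assms \<beta>
  by (auto simp: snorm_def signed_def)

lemma snorm_nonneg: "0 \<le> snorm \<beta> I w"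
  using snorm_ge I by (metis abs_ge_zero ex_in_conv order_trans)

lemma snorm_zero: "snorm \<beta> I (\<lambda>_. 0) \<le> ln (2 * real (card I)) / \<beta>"
  using smax_le[OF signed_index \<beta>, of "signed (\<lambda>_. 0)" 0]
  by (simp add: snorm_def signed_def case_prod_beta card_cartesian_product mult.commute)

lemma snorm_add_le:
  assumes "\<And>k. k \<in> I \<Longrightarrow> \<bar>y k\<bar> \<le> b"
  shows "snorm \<beta> I (\<lambda>k. w k + y k) \<le> snorm \<beta> I w + b"
proof -
  have "signed (\<lambda>k. w k + y k) = (\<lambda>k. signed w k + signed y k)"
    by (auto simp: signed_def)
  moreover have "signed y k \<le> b" if "k \<in> I \<times> UNIV" for k
    using assms[of "fst k"] that by (auto simp: signed_def split: prod.splits)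
  ultimately show ?thesis unfolding snorm_def using smax_add_le[OF signed_index \<beta>] by simp
qed

lemma snorm_diff_le:
  assumes "\<And>k. k \<in> I \<Longrightarrow> \<bar>y k\<bar> \<le> b"
  shows "\<bar>snorm \<beta> I (\<lambda>k. w k + y k) - snorm \<beta> I w\<bar> \<le> b"
  using snorm_add_le[of y b w] snorm_add_le[of "\<lambda>k. - y k" b "\<lambda>k. w k + y k"] assms by simp

lemma smom_signed: "smom \<beta> (I \<times> UNIV) (signed w) (signed y) 1 = (\<Sum>k\<in>I. sgrad \<beta> I w k * y k)"
proof -
  have "(\<Sum>z\<in>I \<times> UNIV. g z) = (\<Sum>k\<in>I. \<Sum>s\<in>UNIV. g (k, s))" for g :: "'i \<times> bool \<Rightarrow> real"
    by (simp add: sum.cartesian_product)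
  then show ?thesis unfolding smom_def sgrad_def
    by (simp add: UNIV_bool signed_def left_diff_distrib)
qed

lemma snorm_second_order:
  assumes "\<And>k. k \<in> I \<Longrightarrow> \<bar>y k\<bar> \<le> b"
  shows "snorm \<beta> I (\<lambda>k. w k + y k) \<le> snorm \<beta> I w + (\<Sum>k\<in>I. sgrad \<beta> I w k * y k) + \<beta> / 2 * b\<^sup>2"
proof -
  have "signed (\<lambda>k. w k + y k) = (\<lambda>k. signed w k + signed y k)"
    by (auto simp: signed_def)
  moreover have "\<bar>signed y k\<bar> \<le> b" if "k \<in> I \<times> UNIV" for k
    using assms[of "fst k"] that by (auto simp: signed_def split: prod.splits)
  ultimately show ?thesis unfolding snorm_def using smax_second_order[OF signed_index \<beta>, of "signed y" b "signed w"] smom_signed by simp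
qed

text \<open>Expanding the square around the old value leaves a cross term and a squared increment.
  Nonnegativity of \<open>snorm\<close> allows the one-sided expansion to be multiplied into the
  former; the Lipschitz bound handles the latter.\<close>

lemma snorm_square_second_order:
  assumes "\<And>k. k \<in> I \<Longrightarrow> \<bar>y k\<bar> \<le> b"
  shows "(snorm \<beta> I (\<lambda>k. w k + y k))\<^sup>2
    \<le> (snorm \<beta> I w)\<^sup>2 + 2 * snorm \<beta> I w * (\<Sum>k\<in>I. sgrad \<beta> I w k * y k) + \<beta> * snorm \<beta> I w * b\<^sup>2 + b\<^sup>2"
proof -
  let ?F = "snorm \<beta> I w" and ?G = "snorm \<beta> I (\<lambda>k. w k + y k)"
  have "2 * ?F * (?G - ?F) \<le> 2 * ?F * ((\<Sum>k\<in>I. sgrad \<beta> I w k * y k) + \<beta> / 2 * b\<^sup>2)"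
    using snorm_second_order[of y b w] assms snorm_nonneg[of w] by (intro mult_left_mono) auto
  moreover have "(?G - ?F)\<^sup>2 \<le> b\<^sup>2"
    using snorm_diff_le[of y b w] assms by (simp add: abs_le_square_iff[symmetric])
  moreover have "?G\<^sup>2 = ?F\<^sup>2 + 2 * ?F * (?G - ?F) + (?G - ?F)\<^sup>2" by (simp add: power2_eq_square algebra_simps)
  ultimately show ?thesis by (simp add: algebra_simps)
qed

end

section \<open>Expected growth of the smooth norm under centered increments\<close>

locale centered_vector = prob_space M for M :: "'a measure" +
  fixes I :: "'i set" and Y :: "'a \<Rightarrow> 'i \<Rightarrow> real" and b :: "'a \<Rightarrow> real" and s :: real
  assumes I: "finite I" "I \<noteq> {}"
    and Y_meas[measurable]: "\<And>k. k \<in> I \<Longrightarrow> (\<lambda>x. Y x k) \<in> borel_measurable M"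
    and b_meas[measurable]: "b \<in> borel_measurable M"
    and Y_le: "\<And>x k. x \<in> space M \<Longrightarrow> k \<in> I \<Longrightarrow> \<bar>Y x k\<bar> \<le> b x"
    and b2: "integrable M (\<lambda>x. (b x)\<^sup>2)" "(\<integral>x. (b x)\<^sup>2 \<partial>M) \<le> s"
    and Y1: "\<And>k. k \<in> I \<Longrightarrow> (\<integral>x. Y x k \<partial>M) = 0"
begin

lemma b1: "integrable M b"
  by (rule square_integrable_imp_integrable) (use b2 in auto)

lemma s_nonneg: "0 \<le> s"
  using b2(2) by (rule order_trans[rotated]) simp

lemma Y_int: "k \<in> I \<Longrightarrow> integrable M (\<lambda>x. Y x k)"
  by (rule Bochner_Integration.integrable_bound[OF b1]) (auto intro!: AE_I2 order_trans[OF Y_le])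

lemma lin_int:
  shows "integrable M (\<lambda>x. \<Sum>k\<in>I. c k * Y x k)" "(\<integral>x. (\<Sum>k\<in>I. c k * Y x k) \<partial>M) = 0"
  using Y_int Y1 by (auto simp: Bochner_Integration.integral_sum)

text \<open>The linear term of the second-order expansion has mean 0, so a centered increment raises
  the expectation by its quadratic term only. Nonnegative integrals let the step be iterated without
  integrability conditions on \<open>snorm\<close>.\<close>

lemma snorm_step:
  assumes \<beta>: "\<beta> > 0"
  shows "(\<integral>\<^sup>+x. ennreal (snorm \<beta> I (\<lambda>k. w k + Y x k)) \<partial>M) \<le> ennreal (snorm \<beta> I w + \<beta> / 2 * s)"
proof -
  let ?g = "\<lambda>x. snorm \<beta> I w + (\<Sum>k\<in>I. sgrad \<beta> I w k * Y x k) + \<beta> / 2 * (b x)\<^sup>2"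
  have g: "snorm \<beta> I (\<lambda>k. w k + Y x k) \<le> ?g x" if "x \<in> space M" for x
    using that by (intro snorm_second_order[OF I \<beta>] Y_le)
  have "(\<integral>\<^sup>+x. ennreal (snorm \<beta> I (\<lambda>k. w k + Y x k)) \<partial>M) \<le> (\<integral>\<^sup>+x. ennreal (?g x) \<partial>M)"
    by (intro nn_integral_mono ennreal_leI g)
  also have "\<dots> = ennreal (\<integral>x. ?g x \<partial>M)"
  proof (rule nn_integral_eq_integral)
    show "integrable M ?g" using b2 lin_int by auto
    show "AE x in M. 0 \<le> ?g x" using order_trans[OF snorm_nonneg[OF I \<beta>] g] by (rule AE_I2)
  qed
  also have "(\<integral>x. ?g x \<partial>M) = snorm \<beta> I w + \<beta> / 2 * (\<integral>x. (b x)\<^sup>2 \<partial>M)"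
    using b2 lin_int by (simp add: prob_space)
  also have "ennreal \<dots> \<le> ennreal (snorm \<beta> I w + \<beta> / 2 * s)"
    using b2 \<beta> by (intro ennreal_leI add_left_mono mult_left_mono) auto
  finally show ?thesis .
qed

lemma snorm_square_step:
  assumes \<beta>: "\<beta> > 0"
  shows "(\<integral>\<^sup>+x. ennreal ((snorm \<beta> I (\<lambda>k. w k + Y x k))\<^sup>2) \<partial>M) \<le> ennreal ((snorm \<beta> I w)\<^sup>2 + \<beta> * s * snorm \<beta> I w + s)"
proof -
  let ?F = "snorm \<beta> I w"
  let ?g = "\<lambda>x. ?F\<^sup>2 + 2 * ?F * (\<Sum>k\<in>I. sgrad \<beta> I w k * Y x k) + \<beta> * ?F * (b x)\<^sup>2 + (b x)\<^sup>2"
  have F: "?F \<ge> 0" by (rule snorm_nonneg[OF I \<beta>])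
  have g: "(snorm \<beta> I (\<lambda>k. w k + Y x k))\<^sup>2 \<le> ?g x" if "x \<in> space M" for x
    using that by (intro snorm_square_second_order[OF I \<beta>] Y_le)
  have "(\<integral>\<^sup>+x. ennreal ((snorm \<beta> I (\<lambda>k. w k + Y x k))\<^sup>2) \<partial>M) \<le> (\<integral>\<^sup>+x. ennreal (?g x) \<partial>M)"
    by (intro nn_integral_mono ennreal_leI g)
  also have "\<dots> = ennreal (\<integral>x. ?g x \<partial>M)"
  proof (rule nn_integral_eq_integral)
    show "integrable M ?g" using b2 lin_int by auto
    show "AE x in M. 0 \<le> ?g x" using order_trans[OF zero_le_power2 g] by (rule AE_I2)
  qed
  also have "(\<integral>x. ?g x \<partial>M) = ?F\<^sup>2 + \<beta> * ?F * (\<integral>x. (b x)\<^sup>2 \<partial>M) + (\<integral>x. (b x)\<^sup>2 \<partial>M)"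
    using b2 lin_int by (simp add: prob_space)
  also have "ennreal \<dots> \<le> ennreal (?F\<^sup>2 + \<beta> * ?F * s + s)"
    using b2 \<beta> F by (intro ennreal_leI add_mono mult_left_mono) auto
  finally show ?thesis by (simp add: mult_ac)
qed

text \<open>The steps are iterated from \<open>snorm\<close> at 0, which is at most l / \<beta>. In
  the recursion for the square, the cross term \<beta> s \<open>snorm\<close> is fed by the
  first-moment bound.\<close>

lemma snorm_sum_bounds:
  assumes \<beta>: "\<beta> > 0" and l: "ln (2 * real (card I)) \<le> l"
  shows "(\<integral>\<^sup>+x. ennreal (snorm \<beta> I (\<lambda>k. \<Sum>i<m. Y (x i) k)) \<partial>PiM {..<m} (\<lambda>_. M)) \<le> ennreal (l / \<beta> + real m * \<beta> * s / 2)"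
    and "(\<integral>\<^sup>+x. ennreal ((snorm \<beta> I (\<lambda>k. \<Sum>i<m. Y (x i) k))\<^sup>2) \<partial>PiM {..<m} (\<lambda>_. M))
      \<le> ennreal ((l / \<beta>)\<^sup>2 + real m * s * (1 + l) + (real m * \<beta> * s)\<^sup>2)"
proof -
  interpret product_sigma_finite "\<lambda>_::nat. M" ..
  have P: "prob_space (PiM {..<m::nat} (\<lambda>_. M))" for m by (intro prob_space_PiM prob_space_axioms)
  have "real (card I) \<ge> 1" using I by (simp add: Suc_leI card_gt_0_iff)
  then have "ln 1 \<le> ln (2 * real (card I))" by (subst ln_le_cancel_iff) auto
  then have l0: "0 \<le> l" using l by simp
  have F0: "snorm \<beta> I (\<lambda>_. 0) \<le> l / \<beta>"
    using snorm_zero[OF I \<beta>] l \<beta> by (meson divide_right_mono less_imp_le order_trans)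
  have mY: "(\<lambda>x. Y (x i) k) \<in> borel_measurable (PiM A (\<lambda>_. M))" if "k \<in> I" "i \<in> A" for i k and A :: "nat set"
    using that by (intro measurable_compose[OF measurable_component_singleton[of i A "\<lambda>_. M"] Y_meas]) auto
  have mS: "(\<lambda>x. snorm \<beta> I (\<lambda>k. \<Sum>i<m. Y (x i) k)) \<in> borel_measurable (PiM {..<m} (\<lambda>_. M))" for m
    by (intro snorm_measurable borel_measurable_sum mY) auto
  have one: "(\<integral>\<^sup>+x. ennreal (snorm \<beta> I (\<lambda>k. \<Sum>i<m. Y (x i) k)) \<partial>PiM {..<m} (\<lambda>_. M)) \<le> ennreal (l / \<beta> + real m * \<beta> * s / 2)" for m
  proof (induction m)
    case 0
    show ?case using F0 by (simp add: PiM_empty nn_integral_count_space_finite ennreal_leI)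
  next
    case (Suc m)
    interpret Pm: prob_space "PiM {..<m} (\<lambda>_. M)" by (rule P)
    have "(\<integral>\<^sup>+x. ennreal (snorm \<beta> I (\<lambda>k. \<Sum>i<Suc m. Y (x i) k)) \<partial>PiM {..<Suc m} (\<lambda>_. M))
      = (\<integral>\<^sup>+x. \<integral>\<^sup>+y. ennreal (snorm \<beta> I (\<lambda>k. (\<Sum>i<m. Y (x i) k) + Y y k)) \<partial>M \<partial>PiM {..<m} (\<lambda>_. M))"
      using mS[of "Suc m"] unfolding lessThan_Suc by (subst product_nn_integral_insert) (auto simp: add.commute)
    also have "\<dots> \<le> (\<integral>\<^sup>+x. ennreal (snorm \<beta> I (\<lambda>k. \<Sum>i<m. Y (x i) k) + \<beta> / 2 * s) \<partial>PiM {..<m} (\<lambda>_. M))"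
      by (intro nn_integral_mono snorm_step \<beta>)
    also have "\<dots> = (\<integral>\<^sup>+x. ennreal (snorm \<beta> I (\<lambda>k. \<Sum>i<m. Y (x i) k)) \<partial>PiM {..<m} (\<lambda>_. M)) + ennreal (\<beta> / 2 * s)"
      using snorm_nonneg[OF I \<beta>] s_nonneg \<beta> mS
      by (simp add: ennreal_plus nn_integral_add Pm.emeasure_space_1)
    also have "\<dots> \<le> ennreal (l / \<beta> + real m * \<beta> * s / 2) + ennreal (\<beta> / 2 * s)" by (intro add_right_mono Suc.IH)
    also have "\<dots> = ennreal (l / \<beta> + real (Suc m) * \<beta> * s / 2)"
      using l0 \<beta> s_nonneg by (subst ennreal_plus[symmetric]) (auto simp: field_simps)
    finally show ?case .
  qed
  show "(\<integral>\<^sup>+x. ennreal (snorm \<beta> I (\<lambda>k. \<Sum>i<m. Y (x i) k)) \<partial>PiM {..<m} (\<lambda>_. M)) \<le> ennreal (l / \<beta> + real m * \<beta> * s / 2)"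
    by (rule one)
  show "(\<integral>\<^sup>+x. ennreal ((snorm \<beta> I (\<lambda>k. \<Sum>i<m. Y (x i) k))\<^sup>2) \<partial>PiM {..<m} (\<lambda>_. M))
      \<le> ennreal ((l / \<beta>)\<^sup>2 + real m * s * (1 + l) + (real m * \<beta> * s)\<^sup>2)"
  proof (induction m)
    case 0
    show ?case using power_mono[OF F0 snorm_nonneg[OF I \<beta>], of 2] by (simp add: PiM_empty nn_integral_count_space_finite ennreal_leI)
  next
    case (Suc m)
    interpret Pm: prob_space "PiM {..<m} (\<lambda>_. M)" by (rule P)
    let ?F = "\<lambda>x. snorm \<beta> I (\<lambda>k. \<Sum>i<m. Y (x i) k)"
    have F: "0 \<le> ?F x" for x by (rule snorm_nonneg[OF I \<beta>])
    note [measurable] = mS[of m]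
    have "(\<integral>\<^sup>+x. ennreal ((snorm \<beta> I (\<lambda>k. \<Sum>i<Suc m. Y (x i) k))\<^sup>2) \<partial>PiM {..<Suc m} (\<lambda>_. M))
      = (\<integral>\<^sup>+x. \<integral>\<^sup>+y. ennreal ((snorm \<beta> I (\<lambda>k. (\<Sum>i<m. Y (x i) k) + Y y k))\<^sup>2) \<partial>M \<partial>PiM {..<m} (\<lambda>_. M))"
      using mS[of "Suc m"] unfolding lessThan_Suc by (subst product_nn_integral_insert) (auto simp: add.commute)
    also have "\<dots> \<le> (\<integral>\<^sup>+x. ennreal ((?F x)\<^sup>2 + \<beta> * s * ?F x + s) \<partial>PiM {..<m} (\<lambda>_. M))"
      by (intro nn_integral_mono snorm_square_step \<beta>)
    also have "\<dots> = (\<integral>\<^sup>+x. ennreal ((?F x)\<^sup>2) + ennreal (\<beta> * s) * ennreal (?F x) + ennreal s \<partial>PiM {..<m} (\<lambda>_. M))"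
      using F s_nonneg \<beta> by (intro nn_integral_cong) (simp add: ennreal_plus ennreal_mult)
    also have "\<dots> = (\<integral>\<^sup>+x. ennreal ((?F x)\<^sup>2) \<partial>PiM {..<m} (\<lambda>_. M)) + ennreal (\<beta> * s) * (\<integral>\<^sup>+x. ennreal (?F x) \<partial>PiM {..<m} (\<lambda>_. M)) + ennreal s"
      by (simp add: nn_integral_add nn_integral_cmult Pm.emeasure_space_1)
    also have "\<dots> \<le> ennreal ((l / \<beta>)\<^sup>2 + real m * s * (1 + l) + (real m * \<beta> * s)\<^sup>2) + ennreal (\<beta> * s) * ennreal (l / \<beta> + real m * \<beta> * s / 2) + ennreal s"
      by (intro add_mono mult_left_mono Suc.IH one) auto
    also have "\<dots> = ennreal ((l / \<beta>)\<^sup>2 + real m * s * (1 + l) + (real m * \<beta> * s)\<^sup>2 + (\<beta> * s) * (l / \<beta> + real m * \<beta> * s / 2) + s)"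
      using l0 \<beta> s_nonneg by (simp add: ennreal_mult ennreal_plus)
    also have "\<dots> \<le> ennreal ((l / \<beta>)\<^sup>2 + real (Suc m) * s * (1 + l) + (real (Suc m) * \<beta> * s)\<^sup>2)"
    proof (intro ennreal_leI)
      \<comment> \<open>The part s l of the cross term goes into the linear growth; the part m
        (\<beta> s)^2 / 2 is absorbed by the increment (2 m + 1) (\<beta> s)^2 of the last
        square.\<close>
      have "(\<beta> * s) * (l / \<beta> + real m * \<beta> * s / 2) = s * l + real m * (\<beta> * s)\<^sup>2 / 2"
        using \<beta> by (simp add: field_simps power2_eq_square)
      moreover have "(real (Suc m) * \<beta> * s)\<^sup>2 = (real m * \<beta> * s)\<^sup>2 + 2 * (real m * (\<beta> * s)\<^sup>2) + (\<beta> * s)\<^sup>2"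
        by (simp add: power2_eq_square algebra_simps)
      moreover have "0 \<le> real m * (\<beta> * s)\<^sup>2" "0 \<le> (\<beta> * s)\<^sup>2" by auto
      moreover have "real (Suc m) * s * (1 + l) = real m * s * (1 + l) + s + s * l" by (simp add: algebra_simps)
      moreover have "A + B + C + X + s \<le> A + B' + C'"
        if "X = sl + P / 2" "C' = C + 2 * P + Q" "0 \<le> P" "0 \<le> Q" "B' = B + s + sl" for A B C X B' C' P Q sl :: real
        using that by linarith
      ultimately show "(l / \<beta>)\<^sup>2 + real m * s * (1 + l) + (real m * \<beta> * s)\<^sup>2 + (\<beta> * s) * (l / \<beta> + real m * \<beta> * s / 2) + s
         \<le> (l / \<beta>)\<^sup>2 + real (Suc m) * s * (1 + l) + (real (Suc m) * \<beta> * s)\<^sup>2" by blast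
    qed
    finally show ?case .
  qed
qed

end

text \<open>Complete degeneracy holds almost everywhere only, since sections of an integrable kernel
  are integrable just for almost every fixed argument. Writing the envelope bound as \<tau> ^ 4
  makes \<tau> scale like the kernel.\<close>

locale degenerate_kernel = prob_space M for M :: "'a measure" +
  fixes I :: "'i set" and f :: "'a \<Rightarrow> 'a \<Rightarrow> 'i \<Rightarrow> real" and b :: "'a \<Rightarrow> 'a \<Rightarrow> real" and \<tau> :: real
  assumes I: "finite I" "I \<noteq> {}"
    and f_meas: "\<And>k. k \<in> I \<Longrightarrow> (\<lambda>z. f (fst z) (snd z) k) \<in> borel_measurable (M \<Otimes>\<^sub>M M)"
    and b_meas: "(\<lambda>z. b (fst z) (snd z)) \<in> borel_measurable (M \<Otimes>\<^sub>M M)"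
    and f_le: "\<And>x y k. x \<in> space M \<Longrightarrow> y \<in> space M \<Longrightarrow> k \<in> I \<Longrightarrow> \<bar>f x y k\<bar> \<le> b x y"
    and b4: "integrable (M \<Otimes>\<^sub>M M) (\<lambda>z. b (fst z) (snd z) ^ 4)" "(\<integral>z. b (fst z) (snd z) ^ 4 \<partial>(M \<Otimes>\<^sub>M M)) \<le> \<tau> ^ 4"
    and \<tau>: "\<tau> > 0"
    and f1: "AE x in M. \<forall>k\<in>I. (\<integral>y. f x y k \<partial>M) = 0"
    and f2: "AE y in M. \<forall>k\<in>I. (\<integral>x. f x y k \<partial>M) = 0"
begin

lemma f_compose: "k \<in> I \<Longrightarrow> u \<in> L \<rightarrow>\<^sub>M M \<Longrightarrow> v \<in> L \<rightarrow>\<^sub>M M \<Longrightarrow> (\<lambda>x. f (u x) (v x) k) \<in> borel_measurable L"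
  using measurable_compose[OF measurable_Pair f_meas, of u L v k] by simp

lemma b_compose: "u \<in> L \<rightarrow>\<^sub>M M \<Longrightarrow> v \<in> L \<rightarrow>\<^sub>M M \<Longrightarrow> (\<lambda>x. b (u x) (v x)) \<in> borel_measurable L"
  using measurable_compose[OF measurable_Pair b_meas, of u L v] by simp

text \<open>For fixed \<open>y\<close> the summands \<open>f (x i) y\<close> are iid and centered,
  so \<open>snorm_sum_bounds\<close> applies with s(y), the second moment of the section of
  \<open>b\<close>. Integrating over \<open>y\<close> then requires bounds on s(y) and its square by
  the fourth moment.\<close>

lemma inner_bound:
  assumes \<beta>: "\<beta> > 0" and l: "ln (2 * real (card I)) \<le> l"
  shows "(\<integral>\<^sup>+y. \<integral>\<^sup>+x. ennreal ((snorm \<beta> I (\<lambda>k. \<Sum>i<m. f (x i) y k))\<^sup>2) \<partial>PiM {..<m} (\<lambda>_. M) \<partial>M)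
    \<le> ennreal ((l / \<beta>)\<^sup>2 + real m * \<tau>\<^sup>2 * (1 + l) + (real m * \<beta>)\<^sup>2 * \<tau> ^ 4)"
proof -
  interpret MM: pair_prob_space M M ..
  have "real (card I) \<ge> 1" using I by (simp add: Suc_leI card_gt_0_iff)
  then have "ln 1 \<le> ln (2 * real (card I))" by (subst ln_le_cancel_iff) auto
  then have l0: "0 \<le> l" using l by simp
  define q where "q y = (\<integral>x. b x y ^ 4 \<partial>M)" for y
  have b4': "integrable (M \<Otimes>\<^sub>M M) (\<lambda>(x, y). b x y ^ 4)" using b4 by (simp add: case_prod_beta')
  have ae: "AE y in M. integrable M (\<lambda>x. b x y ^ 4)" using MM.AE_integrable_snd[OF b4'] by simp
  have iq: "integrable M q" unfolding q_def using MM.integrable_snd[OF b4'] by simp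
  have Eq: "(\<integral>y. q y \<partial>M) \<le> \<tau> ^ 4" using MM.integral_snd[OF b4'] b4(2) by (simp add: q_def case_prod_beta')
  define c where "c = real m * (1 + l) / (2 * \<tau>\<^sup>2) + (real m * \<beta>)\<^sup>2"
  have c: "c \<ge> 0" using l0 by (simp add: c_def)
  let ?g = "\<lambda>y. (l / \<beta>)\<^sup>2 + real m * \<tau>\<^sup>2 * (1 + l) / 2 + c * q y"
  have q0: "q y \<ge> 0" for y unfolding q_def by (intro integral_nonneg_AE AE_I2) simp
  have "AE y in M. (\<integral>\<^sup>+x. ennreal ((snorm \<beta> I (\<lambda>k. \<Sum>i<m. f (x i) y k))\<^sup>2) \<partial>PiM {..<m} (\<lambda>_. M)) \<le> ennreal (?g y)"
    using ae f2 AE_space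
  proof eventually_elim
    case (elim y)
    then have y: "y \<in> space M" by simp
    have bm: "(\<lambda>x. b x y) \<in> borel_measurable M" using y by (intro b_compose) auto
    have i2: "integrable M (\<lambda>x. (b x y)\<^sup>2)" using integrable_le_power4[OF finite_measure_axioms bm, of 2] elim by simp
    define s where "s = (\<integral>x. (b x y)\<^sup>2 \<partial>M)"
    interpret Y: centered_vector M I "\<lambda>x. f x y" "\<lambda>x. b x y" s
      by standard (use I y bm i2 elim in \<open>auto simp: s_def intro!: f_le f_compose\<close>)
    have s0: "s \<ge> 0" by (rule Y.s_nonneg)
    \<comment> \<open>Nonnegative variance of the squared envelope: s^2 is at most its fourth moment
      \<open>q y\<close>.\<close>
    have "0 \<le> (\<integral>x. ((b x y)\<^sup>2 - s)\<^sup>2 \<partial>M)" by simp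
    also have "\<dots> = (\<integral>x. b x y ^ 4 - 2 * s * (b x y)\<^sup>2 + s\<^sup>2 \<partial>M)"
      by (intro Bochner_Integration.integral_cong refl) (simp add: power2_eq_square power4_eq_xxxx algebra_simps)
    also have "\<dots> = q y - 2 * s * s + s\<^sup>2"
      using i2 elim by (simp add: q_def s_def prob_space)
    finally have sq: "s\<^sup>2 \<le> q y" by (simp add: power2_eq_square)
    \<comment> \<open>The arithmetic-geometric mean inequality makes the bound on s affine in
      \<open>q y\<close>, the quantity whose integral is controlled; the weight \<tau>^2 keeps it
      homogeneous.\<close>
    have "0 \<le> (s - \<tau>\<^sup>2)\<^sup>2" by simp
    then have "2 * s * \<tau>\<^sup>2 \<le> \<tau>\<^sup>2 * \<tau>\<^sup>2 + s\<^sup>2" by (simp add: power2_diff power2_eq_square[of "\<tau>\<^sup>2"])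
    also have "\<dots> \<le> \<tau>\<^sup>2 * \<tau>\<^sup>2 + q y" using sq by simp
    finally have s1: "s \<le> (\<tau>\<^sup>2 + q y / \<tau>\<^sup>2) / 2" using \<tau> by (simp add: field_simps)
    have "(\<integral>\<^sup>+x. ennreal ((snorm \<beta> I (\<lambda>k. \<Sum>i<m. f (x i) y k))\<^sup>2) \<partial>PiM {..<m} (\<lambda>_. M))
       \<le> ennreal ((l / \<beta>)\<^sup>2 + real m * s * (1 + l) + (real m * \<beta> * s)\<^sup>2)"
      by (rule Y.snorm_sum_bounds(2)[OF \<beta> l])
    also have "\<dots> \<le> ennreal (?g y)"
    proof (intro ennreal_leI)
      have "real m * (1 + l) * s \<le> real m * (1 + l) * ((\<tau>\<^sup>2 + q y / \<tau>\<^sup>2) / 2)"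
        using l0 by (intro mult_left_mono s1) auto
      moreover have "(real m * \<beta>)\<^sup>2 * s\<^sup>2 \<le> (real m * \<beta>)\<^sup>2 * q y" by (intro mult_left_mono sq) auto
      ultimately show "(l / \<beta>)\<^sup>2 + real m * s * (1 + l) + (real m * \<beta> * s)\<^sup>2 \<le> ?g y"
        by (simp add: c_def power_mult_distrib algebra_simps add_divide_distrib)
    qed
    finally show ?case .
  qed
  then have "(\<integral>\<^sup>+y. \<integral>\<^sup>+x. ennreal ((snorm \<beta> I (\<lambda>k. \<Sum>i<m. f (x i) y k))\<^sup>2) \<partial>PiM {..<m} (\<lambda>_. M) \<partial>M) \<le> (\<integral>\<^sup>+y. ennreal (?g y) \<partial>M)"
    by (rule nn_integral_mono_AE)
  also have "\<dots> = ennreal (\<integral>y. ?g y \<partial>M)"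
    using iq q0 l0 c by (intro nn_integral_eq_integral) auto
  also have "\<dots> \<le> ennreal ((l / \<beta>)\<^sup>2 + real m * \<tau>\<^sup>2 * (1 + l) + (real m * \<beta>)\<^sup>2 * \<tau> ^ 4)"
  proof (intro ennreal_leI)
    have "(\<integral>y. ?g y \<partial>M) = (l / \<beta>)\<^sup>2 + real m * \<tau>\<^sup>2 * (1 + l) / 2 + c * (\<integral>y. q y \<partial>M)"
      using iq by (simp add: prob_space)
    also have "\<dots> \<le> (l / \<beta>)\<^sup>2 + real m * \<tau>\<^sup>2 * (1 + l) / 2 + c * \<tau> ^ 4"
      by (intro add_left_mono mult_left_mono Eq c)
    also have "c * \<tau> ^ 4 = real m * \<tau>\<^sup>2 * (1 + l) / 2 + (real m * \<beta>)\<^sup>2 * \<tau> ^ 4"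
      using \<tau> by (simp add: c_def power2_eq_square power4_eq_xxxx field_simps)
    finally show "(\<integral>y. ?g y \<partial>M) \<le> (l / \<beta>)\<^sup>2 + real m * \<tau>\<^sup>2 * (1 + l) + (real m * \<beta>)\<^sup>2 * \<tau> ^ 4" by linarith
  qed
  finally show ?thesis .
qed

lemma section_integrable_centered: "AE x in M. \<forall>k\<in>I. integrable M (\<lambda>y. f x y k) \<and> (\<integral>y. f x y k \<partial>M) = 0"
proof -
  interpret MM: pair_prob_space M M ..
  have "integrable (M \<Otimes>\<^sub>M M) (\<lambda>(x, y). b x y ^ 4)" using b4 by (simp add: case_prod_beta')
  from MM.AE_integrable_fst[OF this]
  have "AE x in M. integrable M (\<lambda>y. b x y ^ 4)" by simp
  then show ?thesis using f1 AE_space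
  proof eventually_elim
    case (elim x)
    then have x: "x \<in> space M" and ib: "integrable M (\<lambda>y. b x y ^ 4)" by blast+
    have xc: "(\<lambda>_. x) \<in> M \<rightarrow>\<^sub>M M" using x by (rule measurable_const)
    have bm: "(\<lambda>y. b x y) \<in> borel_measurable M" by (rule b_compose[OF xc measurable_ident_sets[OF refl]])
    have "integrable M (\<lambda>y. f x y k)" if k: "k \<in> I" for k
    proof (rule Bochner_Integration.integrable_bound)
      show "integrable M (\<lambda>y. b x y ^ 1)" by (rule integrable_le_power4[OF finite_measure_axioms bm ib]) simp
      show "(\<lambda>y. f x y k) \<in> borel_measurable M" by (rule f_compose[OF k xc measurable_ident_sets[OF refl]])
      show "AE y in M. norm (f x y k) \<le> norm (b x y ^ 1)"
      proof (rule AE_I2)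
        fix y assume "y \<in> space M"
        then have "\<bar>f x y k\<bar> \<le> b x y" using f_le x k by blast
        then show "norm (f x y k) \<le> norm (b x y ^ 1)" by simp
      qed
    qed
    then show ?case using elim by blast
  qed
qed

text \<open>Variables are revealed one at a time. Given the earlier ones, the increment is centered
  in the new variable by degeneracy and has envelope \<open>D m\<close>. One
  \<open>snorm_step\<close> costs \<beta> / 2 times the second moment of \<open>D m\<close>, which
  \<open>inner_bound\<close> controls on average.\<close>

lemma outer_bound:
  assumes l: "ln (2 * real (card I)) \<le> l" "1 \<le> l" and n: "n > 0"
  shows "(\<integral>\<^sup>+x. ennreal (snorm (1 / (real n * \<tau>)) I (\<lambda>k. \<Sum>j<n. \<Sum>i<j. f (x i) (x j) k)) \<partial>PiM {..<n} (\<lambda>_. M))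
    \<le> ennreal (3 * l * real n * \<tau>)"
proof -
  interpret product_sigma_finite "\<lambda>_::nat. M" ..
  have P: "prob_space (PiM {..<m::nat} (\<lambda>_. M))" for m by (intro prob_space_PiM prob_space_axioms)
  \<comment> \<open>Balances the initial value l / \<beta> against the accumulated growth n \<beta>
    Q / 2; both are of order l n \<tau>.\<close>
  define \<beta> where "\<beta> = 1 / (real n * \<tau>)"
  have \<beta>: "\<beta> > 0" using n \<tau> by (simp add: \<beta>_def)
  \<comment> \<open>A separate smoothing parameter for the envelope: it equalises (l / \<gamma>)^2
    and (n \<gamma>)^2 \<tau>^4, both being n l \<tau>^2.\<close>
  define \<gamma> where "\<gamma> = sqrt l / (sqrt (real n) * \<tau>)"
  have \<gamma>: "\<gamma> > 0" using n \<tau> l by (simp add: \<gamma>_def)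
  \<comment> \<open>4 = 1 + 2 + 1, one summand for each term of \<open>inner_bound\<close>; the
    middle one uses 1 + l \<le> 2 l.\<close>
  define Q where "Q = 4 * real n * l * \<tau>\<^sup>2"
  have Q: "Q \<ge> 0" using l by (simp add: Q_def)
  have comp: "(\<lambda>x. x i) \<in> PiM A (\<lambda>_. M) \<rightarrow>\<^sub>M M" if "i \<in> A" for i and A :: "nat set"
    using measurable_component_singleton[OF that, of "\<lambda>_. M"] .
  have mS: "(\<lambda>x. snorm \<beta> I (\<lambda>k. \<Sum>j<m. \<Sum>i<j. f (x i) (x j) k)) \<in> borel_measurable (PiM {..<m} (\<lambda>_. M))" for m :: nat
  proof (intro snorm_measurable borel_measurable_sum)
    fix k j i assume k: "k \<in> I" and ij: "j \<in> {..<m}" "i \<in> {..<j}"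
    from ij have "i \<in> {..<m}" by simp
    from f_compose[OF k comp[OF this] comp[OF ij(1)]]
    show "(\<lambda>x. f (x i) (x j) k) \<in> borel_measurable (PiM {..<m} (\<lambda>_. M))" .
  qed
  define D where "D m x y = snorm \<gamma> I (\<lambda>k. \<Sum>i<m. f (x i) y k)" for m :: nat and x y
  have D0: "0 \<le> D m x y" for m x y unfolding D_def by (rule snorm_nonneg[OF I \<gamma>])
  have mD: "(\<lambda>z. D m (fst z) (snd z)) \<in> borel_measurable (PiM {..<m} (\<lambda>_. M) \<Otimes>\<^sub>M M)" for m
    unfolding D_def
    by (intro snorm_measurable borel_measurable_sum f_compose measurable_compose[OF measurable_fst comp] measurable_snd) auto
  have DQ: "(\<integral>\<^sup>+x. \<integral>\<^sup>+y. ennreal ((D m x y)\<^sup>2) \<partial>M \<partial>PiM {..<m} (\<lambda>_. M)) \<le> ennreal Q" if "m \<le> n" for m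
  proof -
    interpret Pm: prob_space "PiM {..<m} (\<lambda>_. M)" by (rule P)
    interpret PM: pair_prob_space "PiM {..<m} (\<lambda>_. M)" M ..
    have mn: "real m \<le> real n" using that by simp
    have "(\<integral>\<^sup>+x. \<integral>\<^sup>+y. ennreal ((D m x y)\<^sup>2) \<partial>M \<partial>PiM {..<m} (\<lambda>_. M)) = (\<integral>\<^sup>+y. \<integral>\<^sup>+x. ennreal ((D m x y)\<^sup>2) \<partial>PiM {..<m} (\<lambda>_. M) \<partial>M)"
      using mD[of m] by (intro PM.Fubini'[symmetric]) (simp add: case_prod_beta')
    also have "\<dots> \<le> ennreal ((l / \<gamma>)\<^sup>2 + real m * \<tau>\<^sup>2 * (1 + l) + (real m * \<gamma>)\<^sup>2 * \<tau> ^ 4)"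
      unfolding D_def by (rule inner_bound[OF \<gamma> l(1)])
    also have "\<dots> \<le> ennreal Q"
    proof (intro ennreal_leI)
      have 1: "(l / \<gamma>)\<^sup>2 = real n * l * \<tau>\<^sup>2"
        using l n \<tau> by (simp add: \<gamma>_def power_divide power_mult_distrib field_simps power2_eq_square)
      have "real m * \<tau>\<^sup>2 * (1 + l) \<le> real n * \<tau>\<^sup>2 * (2 * l)"
        using mn l by (intro mult_mono) auto
      then have 2: "real m * \<tau>\<^sup>2 * (1 + l) \<le> 2 * (real n * l * \<tau>\<^sup>2)" by (simp add: mult_ac)
      have "(real m * \<gamma>)\<^sup>2 * \<tau> ^ 4 \<le> (real n * \<gamma>)\<^sup>2 * \<tau> ^ 4"
        using mn \<gamma> by (intro mult_right_mono power_mono) auto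
      also have "\<dots> = real n * l * \<tau>\<^sup>2"
        using l n \<tau> by (simp add: \<gamma>_def power_divide power_mult_distrib field_simps power2_eq_square power4_eq_xxxx)
      finally show "(l / \<gamma>)\<^sup>2 + real m * \<tau>\<^sup>2 * (1 + l) + (real m * \<gamma>)\<^sup>2 * \<tau> ^ 4 \<le> Q"
        using 1 2 unfolding Q_def by linarith
    qed
    finally show ?thesis .
  qed
  have F0: "snorm \<beta> I (\<lambda>_. 0) \<le> l / \<beta>"
    using snorm_zero[OF I \<beta>] l \<beta> by (meson divide_right_mono less_imp_le order_trans)
  have main: "(\<integral>\<^sup>+x. ennreal (snorm \<beta> I (\<lambda>k. \<Sum>j<m. \<Sum>i<j. f (x i) (x j) k)) \<partial>PiM {..<m} (\<lambda>_. M)) \<le> ennreal (l / \<beta> + real m * (\<beta> / 2 * Q))" if "m \<le> n" for m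
    using that
  proof (induction m)
    case 0
    show ?case using F0 by (simp add: PiM_empty nn_integral_count_space_finite ennreal_leI)
  next
    case (Suc m)
    let ?P = "PiM {..<m} (\<lambda>_. M)"
    interpret Pm: prob_space ?P by (rule P)
    let ?W = "\<lambda>x k. \<Sum>j<m. \<Sum>i<j. f (x i) (x j) k"
    have Dm: "(\<lambda>x. \<integral>\<^sup>+y. ennreal ((D m x y)\<^sup>2) \<partial>M) \<in> borel_measurable ?P"
      using mD[of m] by (intro borel_measurable_nn_integral) (simp add: case_prod_beta')
    have aeP: "AE x in ?P. \<forall>i\<in>{..<m}. \<forall>k\<in>I. integrable M (\<lambda>y. f (x i) y k) \<and> (\<integral>y. f (x i) y k \<partial>M) = 0"
      by (intro AE_finite_allI AE_PiM_component[of "{..<m}" "\<lambda>_. M", OF prob_space_axioms] section_integrable_centered) auto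
    \<comment> \<open>The averaged bound yields a finite conditional second moment for almost every
      past, which is what instantiating \<open>centered_vector\<close> at a fixed past
      requires.\<close>
    have aeD: "AE x in ?P. (\<integral>\<^sup>+y. ennreal ((D m x y)\<^sup>2) \<partial>M) \<noteq> \<infinity>"
      using DQ[of m] Suc.prems by (intro nn_integral_PInf_AE Dm) (auto simp: top_unique)
    have "(\<integral>\<^sup>+x. ennreal (snorm \<beta> I (\<lambda>k. \<Sum>j<Suc m. \<Sum>i<j. f (x i) (x j) k)) \<partial>PiM {..<Suc m} (\<lambda>_. M))
      = (\<integral>\<^sup>+x. \<integral>\<^sup>+y. ennreal (snorm \<beta> I (\<lambda>k. ?W x k + (\<Sum>i<m. f (x i) y k))) \<partial>M \<partial>?P)"
      using mS[of "Suc m"] unfolding lessThan_Suc by (subst product_nn_integral_insert) (auto simp: add.commute)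
    also have "\<dots> \<le> (\<integral>\<^sup>+x. ennreal (snorm \<beta> I (?W x)) + ennreal (\<beta> / 2) * (\<integral>\<^sup>+y. ennreal ((D m x y)\<^sup>2) \<partial>M) \<partial>?P)"
    proof (intro nn_integral_mono_AE)
      show "AE x in ?P. (\<integral>\<^sup>+y. ennreal (snorm \<beta> I (\<lambda>k. ?W x k + (\<Sum>i<m. f (x i) y k))) \<partial>M)
         \<le> ennreal (snorm \<beta> I (?W x)) + ennreal (\<beta> / 2) * (\<integral>\<^sup>+y. ennreal ((D m x y)\<^sup>2) \<partial>M)"
        using aeP aeD AE_space
      proof eventually_elim
        case (elim x)
        then have x: "x i \<in> space M" if "i < m" for i using that by (auto simp: space_PiM PiE_iff)
        have fm: "(\<lambda>y. f (x i) y k) \<in> borel_measurable M" if "i < m" "k \<in> I" for i k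
          using x that by (intro f_compose) auto
        have Dxm: "D m x \<in> borel_measurable M"
          unfolding D_def[abs_def] by (intro snorm_measurable borel_measurable_sum fm) auto
        have Dle: "\<bar>\<Sum>i<m. f (x i) y k\<bar> \<le> D m x y" if "k \<in> I" for y k
          unfolding D_def by (rule snorm_ge[OF I \<gamma> that])
        have iD: "integrable M (\<lambda>y. (D m x y)\<^sup>2)"
          using elim Dxm by (intro integrableI_nonneg) (auto simp: less_top)
        have bint: "integrable M (D m x)" by (rule square_integrable_imp_integrable[OF Dxm iD])
        interpret Y: centered_vector M I "\<lambda>y k. \<Sum>i<m. f (x i) y k" "D m x" "\<integral>y. (D m x y)\<^sup>2 \<partial>M"
        proof (standard)
          fix k assume k: "k \<in> I"
          show "(\<integral>y. (\<Sum>i<m. f (x i) y k) \<partial>M) = 0"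
            using elim k by (subst Bochner_Integration.integral_sum) auto
        qed (use I iD Dxm fm Dle in \<open>auto intro!: borel_measurable_sum\<close>)
        have "(\<integral>\<^sup>+y. ennreal (snorm \<beta> I (\<lambda>k. ?W x k + (\<Sum>i<m. f (x i) y k))) \<partial>M)
          \<le> ennreal (snorm \<beta> I (?W x) + \<beta> / 2 * (\<integral>y. (D m x y)\<^sup>2 \<partial>M))"
          by (rule Y.snorm_step[OF \<beta>])
        also have "\<dots> = ennreal (snorm \<beta> I (?W x)) + ennreal (\<beta> / 2) * ennreal (\<integral>y. (D m x y)\<^sup>2 \<partial>M)"
          using snorm_nonneg[OF I \<beta>] \<beta> ennreal_mult[of "\<beta> / 2" "\<integral>y. (D m x y)\<^sup>2 \<partial>M"] by (simp add: ennreal_plus)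
        also have "ennreal (\<integral>y. (D m x y)\<^sup>2 \<partial>M) = (\<integral>\<^sup>+y. ennreal ((D m x y)\<^sup>2) \<partial>M)"
          by (rule nn_integral_eq_integral[symmetric, OF iD]) simp
        finally show ?case .
      qed
    qed
    also have "\<dots> = (\<integral>\<^sup>+x. ennreal (snorm \<beta> I (?W x)) \<partial>?P) + ennreal (\<beta> / 2) * (\<integral>\<^sup>+x. \<integral>\<^sup>+y. ennreal ((D m x y)\<^sup>2) \<partial>M \<partial>?P)"
      using Dm mS[of m] by (subst nn_integral_add) (auto simp: nn_integral_cmult)
    also have "\<dots> \<le> ennreal (l / \<beta> + real m * (\<beta> / 2 * Q)) + ennreal (\<beta> / 2) * ennreal Q"
      using Suc by (intro add_mono mult_left_mono DQ) auto
    also have "\<dots> = ennreal (l / \<beta> + real (Suc m) * (\<beta> / 2 * Q))"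
      using l \<beta> Q by (simp add: ennreal_mult[symmetric] ennreal_plus[symmetric] ring_distribs del: ennreal_plus)
    finally show ?case .
  qed
  \<comment> \<open>3 = 1 + 2: the initial value contributes l n \<tau>, the growth 2 l n
    \<tau>.\<close>
  have eq: "l / \<beta> + real n * (\<beta> / 2 * Q) = 3 * l * real n * \<tau>"
    using n \<tau> by (simp add: \<beta>_def Q_def power2_eq_square field_simps)
  show ?thesis using main[OF order_refl] unfolding eq \<beta>_def[symmetric] .
qed

end

section \<open>Smoothing and comparison\<close>

text \<open>The indicator of the maximum being at most t is sandwiched between two smooth steps of
  \<open>smax\<close> at shifted levels, and \<open>lindeberg\<close> compares their expectations.
  Closing the gap between levels is charged to the Gaussian side only, the one with an
  anti-concentration bound.\<close>

lemma gaussian_comparison: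
  fixes Y :: "'a \<Rightarrow> 'i \<Rightarrow> real" and Z :: "'b \<Rightarrow> 'i \<Rightarrow> real" and R :: "(nat \<Rightarrow> 'a) \<Rightarrow> 'i \<Rightarrow> real"
  assumes Y: "small_vector M I Y b \<kappa> \<tau>" and Z: "small_vector N I Z c \<kappa>' \<tau>'"
    and cov: "\<And>a. moment_form M I Y a = moment_form N I Z a"
    and \<beta>: "\<beta> > 0" and \<delta>: "\<delta> > 0" "\<beta> * \<delta> \<ge> 1"
    and R_meas: "\<And>k. k \<in> I \<Longrightarrow> (\<lambda>x. R x k) \<in> borel_measurable (PiM {..<n} (\<lambda>_. M))"
    and R_small: "measure (PiM {..<n} (\<lambda>_. M)) {x \<in> space (PiM {..<n} (\<lambda>_. M)). \<exists>k\<in>I. \<epsilon> < \<bar>R x k\<bar>} \<le> \<eta>"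
    and anti: "\<And>t. measure (PiM {..<n} (\<lambda>_. N)) {z \<in> space (PiM {..<n} (\<lambda>_. N)).
        (\<exists>k\<in>I. t < (\<Sum>i<n. Z (z i) k)) \<and> (\<forall>k\<in>I. (\<Sum>i<n. Z (z i) k) \<le> t + (\<epsilon> + ln (real (card I)) / \<beta> + \<delta>))} \<le> \<alpha>"
  shows "\<bar>measure (PiM {..<n} (\<lambda>_. M)) {x \<in> space (PiM {..<n} (\<lambda>_. M)). \<forall>k\<in>I. (\<Sum>i<n. Y (x i) k) + R x k \<le> t}
     - measure (PiM {..<n} (\<lambda>_. N)) {z \<in> space (PiM {..<n} (\<lambda>_. N)). \<forall>k\<in>I. (\<Sum>i<n. Z (z i) k) \<le> t}\<bar>
    \<le> real n * (1680 * \<beta>\<^sup>2 / \<delta> * (3 * exp 2 * (\<kappa> + \<kappa>')) + 2 * 1680 * \<beta>^3 / \<delta> * (\<tau> + \<tau>')) + \<eta> + \<alpha>"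
proof -
  interpret Y: small_vector M I Y b \<kappa> \<tau> by fact
  interpret Z: small_vector N I Z c \<kappa>' \<tau>' by fact
  let ?P = "PiM {..<n} (\<lambda>_. M)" and ?Q = "PiM {..<n} (\<lambda>_. N)"
  interpret P: prob_space ?P by (intro prob_space_PiM Y.prob_space_axioms)
  interpret Q: prob_space ?Q by (intro prob_space_PiM Z.prob_space_axioms)
  note I = Y.I
  define l where "l = ln (real (card I)) / \<beta>"
  \<comment> \<open>The total shift: \<epsilon> absorbs the remainder, l the gap between maximum and
    smooth maximum, \<delta> the width of the step.\<close>
  define w where "w = \<epsilon> + l + \<delta>"
  define err where "err = real n * (1680 * \<beta>\<^sup>2 / \<delta> * (3 * exp 2 * (\<kappa> + \<kappa>')) + 2 * 1680 * \<beta>^3 / \<delta> * (\<tau> + \<tau>'))"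
  define S where "S x k = (\<Sum>i<n. Y (x i) k)" for x k
  define T where "T z k = (\<Sum>i<n. Z (z i) k)" for z k
  have S_meas: "(\<lambda>x. S x k) \<in> borel_measurable ?P" if "k \<in> I" for k
    unfolding S_def using that
    by (intro borel_measurable_sum measurable_compose[OF measurable_component_singleton[of _ "{..<n}" "\<lambda>_. M"] Y.Y_meas]) auto
  have T_meas: "(\<lambda>z. T z k) \<in> borel_measurable ?Q" if "k \<in> I" for k
    unfolding T_def using that
    by (intro borel_measurable_sum measurable_compose[OF measurable_component_singleton[of _ "{..<n}" "\<lambda>_. N"] Z.Y_meas]) auto
  define \<phi> where "\<phi> u v = step0 ((smax \<beta> I v - u) / \<delta>)" for u and v :: "'i \<Rightarrow> real"
  have \<phi>b: "0 \<le> \<phi> u v" "\<phi> u v \<le> 1" for u v using step_bounds by (auto simp: \<phi>_def)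
  have \<phi>S: "(\<lambda>x. \<phi> u (S x)) \<in> borel_measurable ?P" and \<phi>T: "(\<lambda>z. \<phi> u (T z)) \<in> borel_measurable ?Q" for u
  proof -
    have [measurable]: "(\<lambda>x. smax \<beta> I (S x)) \<in> borel_measurable ?P" "(\<lambda>z. smax \<beta> I (T z)) \<in> borel_measurable ?Q"
      by (intro smax_measurable S_meas T_meas; assumption)+
    show "(\<lambda>x. \<phi> u (S x)) \<in> borel_measurable ?P" "(\<lambda>z. \<phi> u (T z)) \<in> borel_measurable ?Q"
      unfolding \<phi>_def by measurable
  qed
  have i\<phi>: "integrable ?P (\<lambda>x. \<phi> u (S x))" "integrable ?Q (\<lambda>z. \<phi> u (T z))" for u
    using \<phi>S \<phi>T \<phi>b by (auto intro!: P.integrable_const_bound[where B=1] Q.integrable_const_bound[where B=1])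
  have LB: "\<bar>(\<integral>x. \<phi> u (S x) \<partial>?P) - (\<integral>z. \<phi> u (T z) \<partial>?Q)\<bar> \<le> err" for u
  proof -
    have b2: "\<bar>step2 s / \<delta>\<^sup>2\<bar> \<le> 1680 / \<delta>\<^sup>2" and b3: "\<bar>step3 s / \<delta>^3\<bar> \<le> 1680 / \<delta>^3" and b1: "\<bar>step1 s / \<delta>\<bar> \<le> 1680 / \<delta>" for s
      using step_bounds[of s] \<delta> unfolding abs_divide by (auto intro!: divide_right_mono)
    have "\<bar>(\<integral>x. step0 ((smax \<beta> I (\<lambda>k. (\<lambda>_. 0) k + (\<Sum>i<n. Y (x i) k)) - u) / \<delta>) \<partial>?P)
       - (\<integral>z. step0 ((smax \<beta> I (\<lambda>k. (\<lambda>_. 0) k + (\<Sum>i<n. Z (z i) k)) - u) / \<delta>) \<partial>?Q)\<bar> \<le> err"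
      unfolding err_def
      by (rule lindeberg[where m="\<lambda>s. step0 ((s - u) / \<delta>)", OF Y Z cov \<beta> \<delta> _ step0_scaled_deriv[OF \<delta>(1)] _ b1 b2 b3])
        (use step_bounds in \<open>auto simp: abs_le_iff intro: order_trans[of _ 0]\<close>)
    then show ?thesis by (simp add: \<phi>_def S_def[abs_def] T_def[abs_def])
  qed
  have setS: "{x \<in> space ?P. \<forall>k\<in>I. S x k \<le> u} \<in> sets ?P" for u
    using S_meas I by (intro sets.sets_Collect_finite_All') (auto intro!: borel_measurable_le)
  have setSR: "{x \<in> space ?P. \<forall>k\<in>I. S x k + R x k \<le> u} \<in> sets ?P" for u
    using S_meas R_meas I by (intro sets.sets_Collect_finite_All') (auto intro!: borel_measurable_le)
  have setT: "{z \<in> space ?Q. \<forall>k\<in>I. T z k \<le> u} \<in> sets ?Q" for u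
    using T_meas I by (intro sets.sets_Collect_finite_All') (auto intro!: borel_measurable_le)
  have setR: "{x \<in> space ?P. \<exists>k\<in>I. \<epsilon> < \<bar>R x k\<bar>} \<in> sets ?P"
    using R_meas I by (intro sets.sets_Collect_finite_Ex) (auto intro!: borel_measurable_less)
  have setA: "{z \<in> space ?Q. (\<exists>k\<in>I. u < T z k) \<and> (\<forall>k\<in>I. T z k \<le> v)} \<in> sets ?Q" for u v
  proof -
    have "{z \<in> space ?Q. (\<exists>k\<in>I. u < T z k) \<and> (\<forall>k\<in>I. T z k \<le> v)} = {z \<in> space ?Q. \<forall>k\<in>I. T z k \<le> v} - {z \<in> space ?Q. \<forall>k\<in>I. T z k \<le> u}"
      by (auto simp: not_le)
    then show ?thesis using setT by auto
  qed
  have PS: "P.prob A = (\<integral>x. indicator A x \<partial>?P)" if "A \<in> sets ?P" for A using that by simp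
  have QS: "Q.prob A = (\<integral>x. indicator A x \<partial>?Q)" if "A \<in> sets ?Q" for A using that by simp
  have iI: "integrable ?P (indicator A :: _ \<Rightarrow> real)" if "A \<in> sets ?P" for A
    using that by (rule integrable_real_indicator) (simp add: P.emeasure_eq_measure)
  have iJ: "integrable ?Q (indicator A :: _ \<Rightarrow> real)" if "A \<in> sets ?Q" for A
    using that by (rule integrable_real_indicator) (simp add: Q.emeasure_eq_measure)
  have smax_up: "smax \<beta> I v \<le> u + l" if "\<forall>k\<in>I. v k \<le> u" for u v
    unfolding l_def using smax_le[OF I \<beta>, of v u] that by auto
  have smax_dn: "\<forall>k\<in>I. v k \<le> u" if "smax \<beta> I v \<le> u" for u v
    using smax_ge[OF I(1) _ \<beta>] that by (meson order_trans)
  have lowS: "P.prob {x \<in> space ?P. \<forall>k\<in>I. S x k \<le> u} \<le> (\<integral>x. \<phi> (u + l) (S x) \<partial>?P)" for u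
    unfolding PS[OF setS]
  proof (rule integral_mono)
    show "indicator {x \<in> space ?P. \<forall>k\<in>I. S x k \<le> u} x \<le> \<phi> (u + l) (S x)" for x
      using smax_up[of "S x" u] \<phi>b \<delta> step0_eq_1 by (auto simp: indicator_def \<phi>_def divide_le_0_iff)
  qed (rule iI[OF setS] i\<phi>)+
  have upS: "(\<integral>x. \<phi> (u - \<delta>) (S x) \<partial>?P) \<le> P.prob {x \<in> space ?P. \<forall>k\<in>I. S x k \<le> u}" for u
    unfolding PS[OF setS]
  proof (rule integral_mono)
    fix x assume x: "x \<in> space ?P"
    show "\<phi> (u - \<delta>) (S x) \<le> indicator {x \<in> space ?P. \<forall>k\<in>I. S x k \<le> u} x"
    proof (cases "smax \<beta> I (S x) \<le> u")
      case True then show ?thesis using smax_dn[OF True] x \<phi>b by (simp add: indicator_def)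
    next
      case False
      then have "1 \<le> (smax \<beta> I (S x) - (u - \<delta>)) / \<delta>" using \<delta> by (simp add: field_simps)
      then show ?thesis using step0_eq_0 by (simp add: \<phi>_def)
    qed
  qed (rule iI[OF setS] i\<phi>)+
  have lowT: "Q.prob {x \<in> space ?Q. \<forall>k\<in>I. T x k \<le> u} \<le> (\<integral>x. \<phi> (u + l) (T x) \<partial>?Q)" for u
    unfolding QS[OF setT]
  proof (rule integral_mono)
    show "indicator {x \<in> space ?Q. \<forall>k\<in>I. T x k \<le> u} x \<le> \<phi> (u + l) (T x)" for x
      using smax_up[of "T x" u] \<phi>b \<delta> step0_eq_1 by (auto simp: indicator_def \<phi>_def divide_le_0_iff)
  qed (rule iJ[OF setT] i\<phi>)+
  have upT: "(\<integral>x. \<phi> (u - \<delta>) (T x) \<partial>?Q) \<le> Q.prob {x \<in> space ?Q. \<forall>k\<in>I. T x k \<le> u}" for u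
    unfolding QS[OF setT]
  proof (rule integral_mono)
    fix x assume x: "x \<in> space ?Q"
    show "\<phi> (u - \<delta>) (T x) \<le> indicator {x \<in> space ?Q. \<forall>k\<in>I. T x k \<le> u} x"
    proof (cases "smax \<beta> I (T x) \<le> u")
      case True then show ?thesis using smax_dn[OF True] x \<phi>b by (simp add: indicator_def)
    next
      case False
      then have "1 \<le> (smax \<beta> I (T x) - (u - \<delta>)) / \<delta>" using \<delta> by (simp add: field_simps)
      then show ?thesis using step0_eq_0 by (simp add: \<phi>_def)
    qed
  qed (rule iJ[OF setT] i\<phi>)+
  have anti': "Q.prob {x \<in> space ?Q. \<forall>k\<in>I. T x k \<le> u + w} \<le> Q.prob {x \<in> space ?Q. \<forall>k\<in>I. T x k \<le> u} + \<alpha>" for u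
  proof -
    have "Q.prob {x \<in> space ?Q. \<forall>k\<in>I. T x k \<le> u + w} \<le> Q.prob ({x \<in> space ?Q. \<forall>k\<in>I. T x k \<le> u} \<union>
        {z \<in> space ?Q. (\<exists>k\<in>I. u < T z k) \<and> (\<forall>k\<in>I. T z k \<le> u + w)})"
      using setT setA by (intro Q.finite_measure_mono) (auto simp: not_le)
    also have "\<dots> \<le> Q.prob {x \<in> space ?Q. \<forall>k\<in>I. T x k \<le> u} + Q.prob {z \<in> space ?Q. (\<exists>k\<in>I. u < T z k) \<and> (\<forall>k\<in>I. T z k \<le> u + w)}"
      using setT setA by (intro measure_Un_le) auto
    also have "\<dots> \<le> Q.prob {x \<in> space ?Q. \<forall>k\<in>I. T x k \<le> u} + \<alpha>"
      using anti[of u] by (simp add: T_def w_def l_def)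
    finally show ?thesis .
  qed
  have upper: "P.prob {x \<in> space ?P. \<forall>k\<in>I. S x k + R x k \<le> t} \<le> Q.prob {x \<in> space ?Q. \<forall>k\<in>I. T x k \<le> t} + err + \<eta> + \<alpha>"
  proof -
    have "P.prob {x \<in> space ?P. \<forall>k\<in>I. S x k + R x k \<le> t} \<le> P.prob ({x \<in> space ?P. \<forall>k\<in>I. S x k \<le> t + \<epsilon>} \<union> {x \<in> space ?P. \<exists>k\<in>I. \<epsilon> < \<bar>R x k\<bar>})"
      using setS setR by (intro P.finite_measure_mono) (auto simp: not_less abs_le_iff, force)
    also have "\<dots> \<le> P.prob {x \<in> space ?P. \<forall>k\<in>I. S x k \<le> t + \<epsilon>} + P.prob {x \<in> space ?P. \<exists>k\<in>I. \<epsilon> < \<bar>R x k\<bar>}"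
      using setS setR by (intro measure_Un_le) auto
    finally have "P.prob {x \<in> space ?P. \<forall>k\<in>I. S x k + R x k \<le> t} \<le> P.prob {x \<in> space ?P. \<forall>k\<in>I. S x k \<le> t + \<epsilon>} + \<eta>"
      using R_small by linarith
    moreover have "(\<integral>x. \<phi> (t + \<epsilon> + l) (T x) \<partial>?Q) \<le> Q.prob {x \<in> space ?Q. \<forall>k\<in>I. T x k \<le> t + w}"
      using upT[of "t + w"] by (simp add: w_def add_ac)
    ultimately show ?thesis using lowS[of "t + \<epsilon>"] LB[of "t + \<epsilon> + l"] anti'[of t] by linarith
  qed
  \<comment> \<open>The mirrored chain: it starts from the Gaussian event at t - w, so that the
    accumulated shifts end at t.\<close>
  have lower: "Q.prob {x \<in> space ?Q. \<forall>k\<in>I. T x k \<le> t} \<le> P.prob {x \<in> space ?P. \<forall>k\<in>I. S x k + R x k \<le> t} + err + \<eta> + \<alpha>"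
  proof -
    have "P.prob {x \<in> space ?P. \<forall>k\<in>I. S x k \<le> t - \<epsilon>} \<le> P.prob ({x \<in> space ?P. \<forall>k\<in>I. S x k + R x k \<le> t} \<union> {x \<in> space ?P. \<exists>k\<in>I. \<epsilon> < \<bar>R x k\<bar>})"
      using setSR setR by (intro P.finite_measure_mono) (auto simp: not_less abs_le_iff, force)
    also have "\<dots> \<le> P.prob {x \<in> space ?P. \<forall>k\<in>I. S x k + R x k \<le> t} + P.prob {x \<in> space ?P. \<exists>k\<in>I. \<epsilon> < \<bar>R x k\<bar>}"
      using setSR setR by (intro measure_Un_le) auto
    finally have "P.prob {x \<in> space ?P. \<forall>k\<in>I. S x k \<le> t - \<epsilon>} \<le> P.prob {x \<in> space ?P. \<forall>k\<in>I. S x k + R x k \<le> t} + \<eta>"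
      using R_small by linarith
    moreover have "Q.prob {x \<in> space ?Q. \<forall>k\<in>I. T x k \<le> t - w} \<le> (\<integral>x. \<phi> (t - \<epsilon> - \<delta>) (T x) \<partial>?Q)"
      using lowT[of "t - w"] by (simp add: w_def algebra_simps)
    ultimately show ?thesis using upS[of "t - \<epsilon>"] LB[of "t - \<epsilon> - \<delta>"] anti'[of "t - w"] by simp
  qed
  show ?thesis using upper lower unfolding S_def T_def err_def[symmetric] by linarith
qed

section \<open>Hoeffding projections\<close>

text \<open>Jensen's inequality through the tangent of v^j at c, the mean of the absolute value. For
  these exponents the excess over the tangent is a square times a polynomial that is nonnegative for
  v, c \<ge> 0.\<close>

lemma (in prob_space) abs_integral_power_le:
  fixes u :: "'a \<Rightarrow> real"
  assumes u: "u \<in> borel_measurable M" and i4: "integrable M (\<lambda>x. u x ^ 4)" and j: "j \<in> {2, 3, 4}"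
  shows "\<bar>\<integral>x. u x \<partial>M\<bar> ^ j \<le> (\<integral>x. \<bar>u x\<bar> ^ j \<partial>M)"
proof -
  define c where "c = (\<integral>x. \<bar>u x\<bar> \<partial>M)"
  have i4': "integrable M (\<lambda>x. \<bar>u x\<bar> ^ 4)" using i4 by (simp add: power_even_abs)
  have i: "integrable M (\<lambda>x. \<bar>u x\<bar> ^ i)" if "i \<le> 4" for i
    using integrable_le_power4[OF finite_measure_axioms _ i4' that] u by simp
  have c0: "0 \<le> c" by (simp add: c_def)
  have tangent: "c ^ j + real j * c ^ (j - 1) * (v - c) \<le> v ^ j" if v: "0 \<le> v" for v
  proof -
    have 2: "v\<^sup>2 - (c\<^sup>2 + 2 * c * (v - c)) = (v - c)\<^sup>2" by (simp add: power2_eq_square algebra_simps)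
    have 3: "v^3 - (c^3 + 3 * c\<^sup>2 * (v - c)) = (v - c)\<^sup>2 * (v + 2 * c)" by (simp add: eval_nat_numeral algebra_simps)
    have 4: "v^4 - (c^4 + 4 * c^3 * (v - c)) = (v - c)\<^sup>2 * (v\<^sup>2 + 2 * v * c + 3 * c\<^sup>2)" by (simp add: eval_nat_numeral algebra_simps)
    have "0 \<le> (v - c)\<^sup>2" "0 \<le> (v - c)\<^sup>2 * (v + 2 * c)" "0 \<le> (v - c)\<^sup>2 * (v\<^sup>2 + 2 * v * c + 3 * c\<^sup>2)"
      using v c0 by auto
    then have "c\<^sup>2 + 2 * c * (v - c) \<le> v\<^sup>2" "c^3 + 3 * c\<^sup>2 * (v - c) \<le> v^3" "c^4 + 4 * c^3 * (v - c) \<le> v^4"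
      using 2 3 4 by linarith+
    then show ?thesis using j by auto
  qed
  have "\<bar>\<integral>x. u x \<partial>M\<bar> ^ j \<le> c ^ j"
    unfolding c_def by (intro power_mono integral_abs_bound) auto
  also have "c ^ j = (\<integral>x. c ^ j + real j * c ^ (j - 1) * (\<bar>u x\<bar> - c) \<partial>M)"
    using i[of 1] by (simp add: prob_space c_def[symmetric])
  also have "\<dots> \<le> (\<integral>x. \<bar>u x\<bar> ^ j \<partial>M)"
    using i[of 1] i[of j] j tangent by (intro integral_mono) auto
  finally show ?thesis .
qed

lemma power4_sum_le: "(a + b :: real) ^ 4 \<le> 8 * (a ^ 4 + b ^ 4)"
proof -
  have sq: "(x + y)\<^sup>2 \<le> 2 * (x\<^sup>2 + y\<^sup>2)" for x y :: real
    using zero_le_square[of "x - y"] by (simp add: power2_eq_square algebra_simps)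
  have "((a + b)\<^sup>2)\<^sup>2 \<le> (2 * (a\<^sup>2 + b\<^sup>2))\<^sup>2" by (intro power_mono sq) auto
  also have "\<dots> = 4 * (a\<^sup>2 + b\<^sup>2)\<^sup>2" by (simp only: power_mult_distrib) simp
  also have "\<dots> \<le> 4 * (2 * ((a\<^sup>2)\<^sup>2 + (b\<^sup>2)\<^sup>2))" by (intro mult_left_mono sq) auto
  finally show ?thesis by simp
qed

lemma power4_sum4_le: "(a + b + (c + d) :: real) ^ 4 \<le> 64 * (a ^ 4 + b ^ 4 + (c ^ 4 + d ^ 4))"
proof -
  have "(a + b + (c + d)) ^ 4 \<le> 8 * ((a + b) ^ 4 + (c + d) ^ 4)" by (rule power4_sum_le)
  also have "\<dots> \<le> 8 * (8 * (a ^ 4 + b ^ 4) + 8 * (c ^ 4 + d ^ 4))"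
    by (intro mult_left_mono add_mono power4_sum_le) auto
  finally show ?thesis by simp
qed

lemma power3_sum_le: 
  assumes "0 \<le> a" "0 \<le> b"
  shows "(a + b :: real) ^ 3 \<le> 4 * (a ^ 3 + b ^ 3)"
proof -
  have "4 * (a ^ 3 + b ^ 3) - (a + b) ^ 3 = 3 * ((a + b) * (a - b)\<^sup>2)" by (simp add: eval_nat_numeral algebra_simps)
  moreover have "0 \<le> (a + b) * (a - b)\<^sup>2" using assms by simp
  ultimately show ?thesis by linarith
qed

text \<open>The matrix structure is forgotten: \<open>I\<close> plays the lower triangle,
  \<open>N\<close> the matrix norm. The exponents l = 0 and l = 1 of the moment hypothesis become
  \<open>H2\<close> and \<open>H3\<close>.\<close>

locale ustat_kernel = prob_space F for F :: "'a measure" +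
  fixes I :: "'i set" and H :: "'a \<Rightarrow> 'a \<Rightarrow> 'i \<Rightarrow> real" and N :: "'a \<Rightarrow> 'a \<Rightarrow> real" and B C1 :: real
  assumes I: "finite I" "I \<noteq> {}" and B: "1 \<le> B" and C1: "0 < C1"
    and H_meas: "\<And>k. k \<in> I \<Longrightarrow> (\<lambda>z. H (fst z) (snd z) k) \<in> borel_measurable (F \<Otimes>\<^sub>M F)"
    and N_meas: "(\<lambda>z. N (fst z) (snd z)) \<in> borel_measurable (F \<Otimes>\<^sub>M F)"
    and H_sym: "\<And>x y k. x \<in> space F \<Longrightarrow> y \<in> space F \<Longrightarrow> k \<in> I \<Longrightarrow> H x y k = H y x k"
    and H_le: "\<And>x y k. x \<in> space F \<Longrightarrow> y \<in> space F \<Longrightarrow> k \<in> I \<Longrightarrow> \<bar>H x y k\<bar> \<le> N x y"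
    and N4: "integrable (F \<Otimes>\<^sub>M F) (\<lambda>z. N (fst z) (snd z) ^ 4)" "(\<integral>z. N (fst z) (snd z) ^ 4 \<partial>(F \<Otimes>\<^sub>M F)) \<le> B ^ 4"
    and H2: "\<And>k. k \<in> I \<Longrightarrow> (\<integral>z. (H (fst z) (snd z) k)\<^sup>2 \<partial>(F \<Otimes>\<^sub>M F)) \<le> 1"
    and H3: "\<And>k. k \<in> I \<Longrightarrow> (\<integral>z. \<bar>H (fst z) (snd z) k\<bar> ^ 3 \<partial>(F \<Otimes>\<^sub>M F)) \<le> B"
begin

definition mean :: "'i \<Rightarrow> real" where "mean k = (\<integral>z. H (fst z) (snd z) k \<partial>(F \<Otimes>\<^sub>M F))"
definition proj :: "'a \<Rightarrow> 'i \<Rightarrow> real" where "proj x k = (\<integral>y. H x y k \<partial>F) - mean k"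
text \<open>The second-order Hoeffding component, centered in each argument with the other held
  fixed.\<close>

definition resid :: "'a \<Rightarrow> 'a \<Rightarrow> 'i \<Rightarrow> real" where "resid x y k = H x y k - mean k - proj x k - proj y k"

sublocale FF: pair_prob_space F F ..

lemma H_compose: "k \<in> I \<Longrightarrow> u \<in> L \<rightarrow>\<^sub>M F \<Longrightarrow> v \<in> L \<rightarrow>\<^sub>M F \<Longrightarrow> (\<lambda>x. H (u x) (v x) k) \<in> borel_measurable L"
  using measurable_compose[OF measurable_Pair H_meas, of u L v k] by simp

lemma N_nonneg: "x \<in> space F \<Longrightarrow> y \<in> space F \<Longrightarrow> 0 \<le> N x y"
  using H_le I by (metis abs_ge_zero ex_in_conv order_trans)

lemma N_power_integrable: "j \<le> 4 \<Longrightarrow> integrable (F \<Otimes>\<^sub>M F) (\<lambda>z. N (fst z) (snd z) ^ j)"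
  by (rule integrable_le_power4[OF FF.finite_measure_axioms N_meas N4(1)])

lemma H_power_integrable:
  assumes k: "k \<in> I" and j: "j \<le> 4"
  shows "integrable (F \<Otimes>\<^sub>M F) (\<lambda>z. \<bar>H (fst z) (snd z) k\<bar> ^ j)"
proof (rule Bochner_Integration.integrable_bound[OF N_power_integrable[OF j]])
  show "(\<lambda>z. \<bar>H (fst z) (snd z) k\<bar> ^ j) \<in> borel_measurable (F \<Otimes>\<^sub>M F)" using H_meas[OF k] by measurable
  show "AE z in F \<Otimes>\<^sub>M F. norm (\<bar>H (fst z) (snd z) k\<bar> ^ j) \<le> norm (N (fst z) (snd z) ^ j)"
  proof (rule AE_I2)
    fix z assume "z \<in> space (F \<Otimes>\<^sub>M F)"
    then have "\<bar>H (fst z) (snd z) k\<bar> ^ j \<le> N (fst z) (snd z) ^ j"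
      using H_le[OF _ _ k] by (intro power_mono) (auto simp: space_pair_measure)
    then show "norm (\<bar>H (fst z) (snd z) k\<bar> ^ j) \<le> norm (N (fst z) (snd z) ^ j)" by simp
  qed
qed

lemma H_integrable:
  assumes k: "k \<in> I"
  shows "integrable (F \<Otimes>\<^sub>M F) (\<lambda>z. H (fst z) (snd z) k)"
  using H_power_integrable[OF k, of 1] H_meas[OF k] by (simp add: integrable_abs_iff)

lemma section_int:
  fixes u :: "'a \<Rightarrow> 'a \<Rightarrow> real"
  assumes "integrable (F \<Otimes>\<^sub>M F) (\<lambda>z. u (fst z) (snd z))"
  shows "AE x in F. integrable F (\<lambda>y. u x y)" "integrable F (\<lambda>x. \<integral>y. u x y \<partial>F)"
    "(\<integral>x. (\<integral>y. u x y \<partial>F) \<partial>F) = (\<integral>z. u (fst z) (snd z) \<partial>(F \<Otimes>\<^sub>M F))"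
proof -
  have i: "integrable (F \<Otimes>\<^sub>M F) (\<lambda>(x, y). u x y)" using assms by (simp add: case_prod_beta')
  show "AE x in F. integrable F (\<lambda>y. u x y)" using FF.AE_integrable_fst[OF i] by simp
  show "integrable F (\<lambda>x. \<integral>y. u x y \<partial>F)" using FF.integrable_fst[OF i] by simp
  show "(\<integral>x. (\<integral>y. u x y \<partial>F) \<partial>F) = (\<integral>z. u (fst z) (snd z) \<partial>(F \<Otimes>\<^sub>M F))"
    using FF.integral_fst[OF i] by (simp add: case_prod_beta')
qed

lemma proj_measurable[measurable]:
  assumes k: "k \<in> I"
  shows "(\<lambda>x. proj x k) \<in> borel_measurable F"
proof -
  have "(\<lambda>(x, y). H x y k) \<in> borel_measurable (F \<Otimes>\<^sub>M F)" using H_meas[OF k] by (simp add: case_prod_beta')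
  then have "(\<lambda>x. \<integral>y. H x y k \<partial>F) \<in> borel_measurable F" by (rule borel_measurable_lebesgue_integral)
  then show ?thesis unfolding proj_def by simp
qed

lemma proj_mean: "k \<in> I \<Longrightarrow> (\<integral>x. proj x k \<partial>F) = 0" "k \<in> I \<Longrightarrow> integrable F (\<lambda>x. proj x k)"
  using section_int[OF H_integrable, of k] unfolding proj_def mean_def by (simp_all add: prob_space)

lemma section_power:
  assumes k: "k \<in> I" and j: "j \<in> {2, 3, 4}"
  shows "AE x in F. \<bar>\<integral>y. H x y k \<partial>F\<bar> ^ j \<le> (\<integral>y. \<bar>H x y k\<bar> ^ j \<partial>F)"
  using section_int(1)[of "\<lambda>x y. \<bar>H x y k\<bar> ^ 4", OF H_power_integrable[OF k order_refl]] AE_space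
proof eventually_elim
  case (elim x)
  have m: "(\<lambda>y. H x y k) \<in> borel_measurable F"
    using elim(2) by (intro H_compose[OF k] measurable_const measurable_ident_sets[OF refl])
  show ?case using elim(1) by (intro abs_integral_power_le m j) (simp add: power_even_abs)
qed

lemma mean_power:
  assumes k: "k \<in> I" and j: "j \<in> {2, 3, 4}"
  shows "\<bar>mean k\<bar> ^ j \<le> (\<integral>z. \<bar>H (fst z) (snd z) k\<bar> ^ j \<partial>(F \<Otimes>\<^sub>M F))"
  unfolding mean_def using H_power_integrable[OF k, of 4] H_meas[OF k]
  by (intro FF.abs_integral_power_le j) (auto simp: power_even_abs)

lemma section_power_integrable:
  assumes k: "k \<in> I" and j: "j \<in> {2, 3, 4}"
  shows "integrable F (\<lambda>x. \<bar>\<integral>y. H x y k \<partial>F\<bar> ^ j)"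
    "(\<integral>x. \<bar>\<integral>y. H x y k \<partial>F\<bar> ^ j \<partial>F) \<le> (\<integral>z. \<bar>H (fst z) (snd z) k\<bar> ^ j \<partial>(F \<Otimes>\<^sub>M F))"
proof -
  have j4: "j \<le> 4" using j by auto
  note s = section_int[of "\<lambda>x y. \<bar>H x y k\<bar> ^ j", OF H_power_integrable[OF k j4]]
  have m: "(\<lambda>x. \<integral>y. H x y k \<partial>F) \<in> borel_measurable F"
    using section_int(2)[OF H_integrable[OF k]] by simp
  show i: "integrable F (\<lambda>x. \<bar>\<integral>y. H x y k \<partial>F\<bar> ^ j)"
  proof (rule Bochner_Integration.integrable_bound[OF s(2)])
    show "AE x in F. norm (\<bar>\<integral>y. H x y k \<partial>F\<bar> ^ j) \<le> norm (\<integral>y. \<bar>H x y k\<bar> ^ j \<partial>F)"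
      using section_power[OF k j] by eventually_elim simp
  qed (use m in measurable)
  have "(\<integral>x. \<bar>\<integral>y. H x y k \<partial>F\<bar> ^ j \<partial>F) \<le> (\<integral>x. (\<integral>y. \<bar>H x y k\<bar> ^ j \<partial>F) \<partial>F)"
    by (rule integral_mono_AE[OF i s(2) section_power[OF k j]])
  then show "(\<integral>x. \<bar>\<integral>y. H x y k \<partial>F\<bar> ^ j \<partial>F) \<le> (\<integral>z. \<bar>H (fst z) (snd z) k\<bar> ^ j \<partial>(F \<Otimes>\<^sub>M F))"
    using s(3) by simp
qed

lemma proj_square:
  assumes k: "k \<in> I"
  shows "integrable F (\<lambda>x. (proj x k)\<^sup>2)" "(\<integral>x. (proj x k)\<^sup>2 \<partial>F) \<le> 1"
proof -
  let ?e = "\<lambda>x. \<integral>y. H x y k \<partial>F"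
  note s = section_int[OF H_integrable[OF k]]
  have i2: "integrable F (\<lambda>x. (?e x)\<^sup>2)" using section_power_integrable(1)[OF k, of 2] by simp
  have e: "(proj x k)\<^sup>2 = (?e x)\<^sup>2 - 2 * mean k * ?e x + (mean k)\<^sup>2" for x
    by (simp add: proj_def power2_eq_square algebra_simps)
  show "integrable F (\<lambda>x. (proj x k)\<^sup>2)" unfolding e using i2 s by auto
  have "(\<integral>x. (proj x k)\<^sup>2 \<partial>F) = (\<integral>x. (?e x)\<^sup>2 \<partial>F) - 2 * mean k * mean k + (mean k)\<^sup>2"
    unfolding e using i2 s by (simp add: prob_space mean_def)
  also have "\<dots> \<le> (\<integral>x. (?e x)\<^sup>2 \<partial>F)" by (simp add: power2_eq_square)
  also have "\<dots> \<le> 1" using section_power_integrable(2)[OF k, of 2] H2[OF k] by simp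
  finally show "(\<integral>x. (proj x k)\<^sup>2 \<partial>F) \<le> 1" .
qed

lemma proj_cubed:
  assumes k: "k \<in> I"
  shows "(\<integral>x. \<bar>proj x k\<bar> ^ 3 \<partial>F) \<le> 8 * B"
proof -
  let ?e = "\<lambda>x. \<integral>y. H x y k \<partial>F"
  have i3: "integrable F (\<lambda>x. \<bar>?e x\<bar> ^ 3)" using section_power_integrable(1)[OF k, of 3] by simp
  have le: "\<bar>proj x k\<bar> ^ 3 \<le> 4 * (\<bar>?e x\<bar> ^ 3 + \<bar>mean k\<bar> ^ 3)" for x
  proof -
    have "\<bar>proj x k\<bar> ^ 3 \<le> (\<bar>?e x\<bar> + \<bar>mean k\<bar>) ^ 3" unfolding proj_def by (intro power_mono) auto
    also have "\<dots> \<le> 4 * (\<bar>?e x\<bar> ^ 3 + \<bar>mean k\<bar> ^ 3)" by (rule power3_sum_le) auto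
    finally show ?thesis .
  qed
  have ip: "integrable F (\<lambda>x. \<bar>proj x k\<bar> ^ 3)"
    by (rule Bochner_Integration.integrable_bound[of _ "\<lambda>x. 4 * (\<bar>?e x\<bar> ^ 3 + \<bar>mean k\<bar> ^ 3)"])
      (use i3 le k in \<open>auto intro!: AE_I2\<close>)
  have "(\<integral>x. \<bar>proj x k\<bar> ^ 3 \<partial>F) \<le> (\<integral>x. 4 * (\<bar>?e x\<bar> ^ 3 + \<bar>mean k\<bar> ^ 3) \<partial>F)"
    using i3 le ip by (intro integral_mono) auto
  also have "\<dots> = 4 * ((\<integral>x. \<bar>?e x\<bar> ^ 3 \<partial>F) + \<bar>mean k\<bar> ^ 3)" using i3 by (simp add: prob_space)
  \<comment> \<open>The conditional mean and the overall mean each have third moment at most B by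
    Jensen.\<close>
  also have "\<dots> \<le> 4 * (B + B)"
    using section_power_integrable(2)[OF k, of 3] mean_power[OF k, of 3] H3[OF k] by (intro mult_left_mono add_mono) auto
  finally show ?thesis by simp
qed

definition env :: "'a \<Rightarrow> real" where "env x = Max ((\<lambda>k. \<bar>proj x k\<bar>) ` I)"
definition Nmean :: real where "Nmean = (\<integral>z. N (fst z) (snd z) \<partial>(F \<Otimes>\<^sub>M F))"

lemma env_measurable[measurable]: "env \<in> borel_measurable F"
  unfolding env_def[abs_def] using I by (intro borel_measurable_Max) auto

lemma proj_le_env: "k \<in> I \<Longrightarrow> \<bar>proj x k\<bar> \<le> env x"
  unfolding env_def using I by (intro Max_ge) auto

lemma env_nonneg: "0 \<le> env x"
  using proj_le_env I by (metis abs_ge_zero ex_in_conv order_trans)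

lemma Nmean_nonneg: "0 \<le> Nmean"
  unfolding Nmean_def by (intro integral_nonneg_AE AE_I2) (auto simp: space_pair_measure N_nonneg)

lemma Nmean_power: "Nmean ^ 4 \<le> B ^ 4"
  using FF.abs_integral_power_le[OF N_meas N4(1), of 4] N4(2) Nmean_nonneg
  by (simp add: Nmean_def[symmetric] power_even_abs)

lemma mean_le: "k \<in> I \<Longrightarrow> \<bar>mean k\<bar> \<le> Nmean"
proof -
  assume k: "k \<in> I"
  have "\<bar>mean k\<bar> \<le> (\<integral>z. \<bar>H (fst z) (snd z) k\<bar> \<partial>(F \<Otimes>\<^sub>M F))" unfolding mean_def by (rule integral_abs_bound)
  also have "\<dots> \<le> Nmean" unfolding Nmean_def
    using H_power_integrable[OF k, of 1] N_power_integrable[of 1] H_le[OF _ _ k]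
    by (intro integral_mono) (auto simp: space_pair_measure)
  finally show "\<bar>mean k\<bar> \<le> Nmean" .
qed

text \<open>All projections at x are bounded by the mean of the section of \<open>N\<close> plus the
  overall mean of \<open>N\<close>. Both have fourth moment at most B^4 by Jensen, and
  \<open>power4_sum_le\<close> contributes the factor 8.\<close>

lemma env4: "integrable F (\<lambda>x. env x ^ 4)" "(\<integral>x. env x ^ 4 \<partial>F) \<le> 16 * B ^ 4"
proof -
  let ?q = "\<lambda>x. \<integral>y. N x y ^ 4 \<partial>F"
  note s = section_int[of "\<lambda>x y. N x y ^ 4", OF N4(1)]
  have le: "AE x in F. env x ^ 4 \<le> 8 * (?q x + Nmean ^ 4)"
    using s(1) AE_space
  proof eventually_elim
    case (elim x)
    have xc: "(\<lambda>_. x) \<in> F \<rightarrow>\<^sub>M F" using elim(2) by (rule measurable_const)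
    have Nm: "(\<lambda>y. N x y) \<in> borel_measurable F"
      using measurable_compose[OF measurable_Pair[OF xc measurable_ident_sets[OF refl]] N_meas] by simp
    have Ni: "integrable F (\<lambda>y. N x y)" using integrable_le_power4[OF finite_measure_axioms Nm elim(1), of 1] by simp
    have "\<bar>proj x k\<bar> \<le> (\<integral>y. N x y \<partial>F) + Nmean" if k: "k \<in> I" for k
    proof -
      have Hm: "(\<lambda>y. H x y k) \<in> borel_measurable F" by (intro H_compose[OF k] xc measurable_ident_sets[OF refl])
      have "\<bar>\<integral>y. H x y k \<partial>F\<bar> \<le> (\<integral>y. \<bar>H x y k\<bar> \<partial>F)" by (rule integral_abs_bound)
      also have "\<dots> \<le> (\<integral>y. N x y \<partial>F)"
      proof (rule integral_mono)
        show le: "\<bar>H x y k\<bar> \<le> N x y" if "y \<in> space F" for y using H_le elim that k by blast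
        show "integrable F (\<lambda>y. \<bar>H x y k\<bar>)"
          by (rule Bochner_Integration.integrable_bound[OF Ni]) (use Hm le in \<open>auto intro!: AE_I2 intro: order_trans[OF _ abs_ge_self]\<close>)
      qed (rule Ni)
      finally show ?thesis unfolding proj_def using mean_le[OF k] by linarith
    qed
    then have "env x \<le> (\<integral>y. N x y \<partial>F) + Nmean" unfolding env_def using I by (intro Max.boundedI) auto
    then have "env x ^ 4 \<le> ((\<integral>y. N x y \<partial>F) + Nmean) ^ 4" using env_nonneg by (intro power_mono)
    also have "\<dots> \<le> 8 * ((\<integral>y. N x y \<partial>F) ^ 4 + Nmean ^ 4)" by (rule power4_sum_le)
    also have "(\<integral>y. N x y \<partial>F) ^ 4 \<le> ?q x"
      using abs_integral_power_le[OF Nm elim(1), of 4] by (simp add: power_even_abs)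
    finally show ?case by simp
  qed
  show i: "integrable F (\<lambda>x. env x ^ 4)"
  proof (rule Bochner_Integration.integrable_bound)
    show "integrable F (\<lambda>x. 8 * (?q x + Nmean ^ 4))" using s by auto
    show "AE x in F. norm (env x ^ 4) \<le> norm (8 * (?q x + Nmean ^ 4))"
      using le by eventually_elim (simp add: abs_le_iff order_trans[OF _ abs_ge_self])
  qed measurable
  have "(\<integral>x. env x ^ 4 \<partial>F) \<le> (\<integral>x. 8 * (?q x + Nmean ^ 4) \<partial>F)"
    using s i by (intro integral_mono_AE le) auto
  also have "\<dots> = 8 * ((\<integral>x. ?q x \<partial>F) + Nmean ^ 4)" using s by (simp add: prob_space)
  also have "\<dots> \<le> 8 * (B ^ 4 + B ^ 4)" using s(3) N4(2) Nmean_power by (intro mult_left_mono add_mono) auto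
  finally show "(\<integral>x. env x ^ 4 \<partial>F) \<le> 16 * B ^ 4" by simp
qed

lemma resid_degenerate: "degenerate_kernel F I resid (\<lambda>x y. N x y + Nmean + (env x + env y)) (7 * B)"
proof
  show "finite I" "I \<noteq> {}" "0 < 7 * B" using I B by auto
  have pm: "(\<lambda>z. proj (fst z) k) \<in> borel_measurable (F \<Otimes>\<^sub>M F)" "(\<lambda>z. proj (snd z) k) \<in> borel_measurable (F \<Otimes>\<^sub>M F)" if "k \<in> I" for k
    using measurable_compose[OF measurable_fst proj_measurable[OF that]] measurable_compose[OF measurable_snd proj_measurable[OF that]] by auto
  show "(\<lambda>z. resid (fst z) (snd z) k) \<in> borel_measurable (F \<Otimes>\<^sub>M F)" if "k \<in> I" for k
    unfolding resid_def using H_meas[OF that] pm[OF that] by simp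
  have em: "(\<lambda>z. env (fst z)) \<in> borel_measurable (F \<Otimes>\<^sub>M F)" "(\<lambda>z. env (snd z)) \<in> borel_measurable (F \<Otimes>\<^sub>M F)"
    by measurable
  show bm: "(\<lambda>z. N (fst z) (snd z) + Nmean + (env (fst z) + env (snd z))) \<in> borel_measurable (F \<Otimes>\<^sub>M F)"
    using N_meas em by simp
  show "\<bar>resid x y k\<bar> \<le> N x y + Nmean + (env x + env y)" if "x \<in> space F" "y \<in> space F" "k \<in> I" for x y k
    unfolding resid_def using H_le[OF that] mean_le[OF that(3)] proj_le_env[OF that(3), of x] proj_le_env[OF that(3), of y] by linarith
  have ie: "integrable (F \<Otimes>\<^sub>M F) (\<lambda>z. env (fst z) ^ 4)" "integrable (F \<Otimes>\<^sub>M F) (\<lambda>z. env (snd z) ^ 4)"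
    "(\<integral>z. env (fst z) ^ 4 \<partial>(F \<Otimes>\<^sub>M F)) = (\<integral>x. env x ^ 4 \<partial>F)" "(\<integral>z. env (snd z) ^ 4 \<partial>(F \<Otimes>\<^sub>M F)) = (\<integral>x. env x ^ 4 \<partial>F)"
  proof -
    have d: "distr (F \<Otimes>\<^sub>M F) F fst = F" by (rule distr_pair_fst)
    show i: "integrable (F \<Otimes>\<^sub>M F) (\<lambda>z. env (fst z) ^ 4)"
      using env4(1) integrable_distr_eq[OF measurable_fst[of F F], of "\<lambda>x. env x ^ 4"] unfolding d by auto
    show e: "(\<integral>z. env (fst z) ^ 4 \<partial>(F \<Otimes>\<^sub>M F)) = (\<integral>x. env x ^ 4 \<partial>F)"
      using integral_distr[OF measurable_fst[of F F], of "\<lambda>x. env x ^ 4"] unfolding d by auto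
    show "integrable (F \<Otimes>\<^sub>M F) (\<lambda>z. env (snd z) ^ 4)"
      using FF.integrable_product_swap[OF i] by (simp add: case_prod_beta')
    show "(\<integral>z. env (snd z) ^ 4 \<partial>(F \<Otimes>\<^sub>M F)) = (\<integral>x. env x ^ 4 \<partial>F)"
      using FF.integral_product_swap[of "\<lambda>z. env (fst z) ^ 4"] i e by (simp add: case_prod_beta')
  qed
  let ?dom = "\<lambda>z. 64 * (N (fst z) (snd z) ^ 4 + Nmean ^ 4 + (env (fst z) ^ 4 + env (snd z) ^ 4))"
  have le: "(N (fst z) (snd z) + Nmean + (env (fst z) + env (snd z))) ^ 4 \<le> ?dom z" for z
    by (rule power4_sum4_le)
  have idom: "integrable (F \<Otimes>\<^sub>M F) ?dom" using N4(1) ie by auto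
  show i4: "integrable (F \<Otimes>\<^sub>M F) (\<lambda>z. (N (fst z) (snd z) + Nmean + (env (fst z) + env (snd z))) ^ 4)"
    by (rule Bochner_Integration.integrable_bound[OF idom]) (use bm le in \<open>auto intro!: AE_I2 intro: order_trans[OF _ abs_ge_self]\<close>)
  have "(\<integral>z. (N (fst z) (snd z) + Nmean + (env (fst z) + env (snd z))) ^ 4 \<partial>(F \<Otimes>\<^sub>M F)) \<le> (\<integral>z. ?dom z \<partial>(F \<Otimes>\<^sub>M F))"
    by (intro integral_mono i4 idom le)
  also have "\<dots> = 64 * ((\<integral>z. N (fst z) (snd z) ^ 4 \<partial>(F \<Otimes>\<^sub>M F)) + Nmean ^ 4 + ((\<integral>x. env x ^ 4 \<partial>F) + (\<integral>x. env x ^ 4 \<partial>F)))"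
    using N4(1) ie by (simp add: FF.prob_space)
  also have "\<dots> \<le> 64 * (B ^ 4 + B ^ 4 + (16 * B ^ 4 + 16 * B ^ 4))"
    using N4(2) Nmean_power env4(2) by (intro mult_left_mono add_mono) auto
  \<comment> \<open>64 * 34 = 2176, which is below 2401 = 7^4.\<close>
  also have "\<dots> \<le> (7 * B) ^ 4" by (simp add: power_mult_distrib)
  finally show "(\<integral>z. (N (fst z) (snd z) + Nmean + (env (fst z) + env (snd z))) ^ 4 \<partial>(F \<Otimes>\<^sub>M F)) \<le> (7 * B) ^ 4" .
  have aeH: "AE x in F. \<forall>k\<in>I. integrable F (\<lambda>y. H x y k)"
    using section_int(1)[OF H_integrable] I by (intro AE_finite_allI) auto
  show r1: "AE x in F. \<forall>k\<in>I. (\<integral>y. resid x y k \<partial>F) = 0"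
    using aeH
  proof eventually_elim
    case (elim x)
    show ?case
    proof
      fix k assume k: "k \<in> I"
      have "(\<integral>y. resid x y k \<partial>F) = (\<integral>y. H x y k \<partial>F) - mean k - proj x k - (\<integral>y. proj y k \<partial>F)"
        unfolding resid_def using elim k proj_mean[OF k] by (simp add: prob_space)
      then show "(\<integral>y. resid x y k \<partial>F) = 0" using proj_mean[OF k] by (simp add: proj_def)
    qed
  qed
  show "AE y in F. \<forall>k\<in>I. (\<integral>x. resid x y k \<partial>F) = 0"
    using r1 AE_space
  proof eventually_elim
    case (elim y)
    show ?case
    proof
      fix k assume k: "k \<in> I"
      \<comment> \<open>Symmetry of the kernel reduces the second argument to the first.\<close>
      have "(\<integral>x. resid x y k \<partial>F) = (\<integral>x. resid y x k \<partial>F)"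
        using elim(2) k by (intro Bochner_Integration.integral_cong refl) (simp add: resid_def H_sym)
      then show "(\<integral>x. resid x y k \<partial>F) = 0" using elim(1) k by simp
    qed
  qed
qed

end

section \<open>Explicit Gaussian approximation bound\<close>

lemma small_vector_scale:
  assumes "small_vector M I Y b \<kappa> \<tau>" and c: "c > 0"
  shows "small_vector M I (\<lambda>x k. Y x k / c) (\<lambda>x. b x / c) (\<kappa> / c ^ 3) (\<tau> / c ^ 4)"
proof -
  interpret small_vector M I Y b \<kappa> \<tau> by fact
  show ?thesis
  proof
    show "finite I" "I \<noteq> {}" by (rule I)+
    show "(\<lambda>x. Y x k / c) \<in> borel_measurable M" if "k \<in> I" for k using Y_meas[OF that] by simp
    show "(\<lambda>x. b x / c) \<in> borel_measurable M" by measurable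
    show "\<bar>Y x k / c\<bar> \<le> b x / c" if "x \<in> space M" "k \<in> I" for x k
      using Y_le[OF that] c by (simp add: divide_right_mono)
    show "integrable M (\<lambda>x. (b x / c) ^ 4)" using b4 by (simp add: power_divide)
    show "(\<integral>x. (b x / c) ^ 4 \<partial>M) \<le> \<tau> / c ^ 4" using b4 c by (simp add: power_divide divide_right_mono)
    show "(\<integral>x. \<bar>Y x k / c\<bar> ^ 3 \<partial>M) \<le> \<kappa> / c ^ 3" if "k \<in> I" for k
      using Y3[OF that] c by (simp add: power_divide divide_right_mono)
    show "(\<integral>x. Y x k / c \<partial>M) = 0" if "k \<in> I" for k using Y1[OF that] by simp
  qed
qed

lemma moment_form_scale: "moment_form M I (\<lambda>x k. Y x k / c) a = moment_form M I Y a / c\<^sup>2"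
proof -
  have "(\<Sum>k\<in>I. a k * (Y x k / c))\<^sup>2 = (\<Sum>k\<in>I. a k * Y x k)\<^sup>2 / c\<^sup>2" for x
    by (simp add: sum_divide_distrib[symmetric] power_divide)
  then show ?thesis by (simp add: moment_form_def)
qed

text \<open>\<open>is_centered_gaussian\<close> rewritten with \<open>quad_form\<close>. It retains
  the laws of linear functionals, from which second moments are read off, whereas
  \<open>gauss_law\<close> retains characteristic functions.\<close>

definition is_gauss :: "'i set \<Rightarrow> ('i \<Rightarrow> 'i \<Rightarrow> real) \<Rightarrow> ('i \<Rightarrow> real) measure \<Rightarrow> bool" where
  "is_gauss I S G \<longleftrightarrow> prob_space G \<and> sets G = sets (PiM I (\<lambda>_. borel)) \<and>
     (\<forall>a. distr G borel (\<lambda>z. \<Sum>i\<in>I. a i * z i) =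
        (if quad_form I S a = 0 then return borel 0 else density lborel (normal_density 0 (sqrt (quad_form I S a)))))"

lemma normal_square_integral:
  assumes "\<sigma> > 0"
  shows "(\<integral>x. x\<^sup>2 \<partial>density lborel (normal_density 0 \<sigma>)) = \<sigma>\<^sup>2"
  using integral_normal_moment_even[OF assms, of 0 1] by (subst integral_density) (auto simp: fact_numeral)

lemma gauss_moment_form:
  assumes I: "finite I" and G: "is_gauss I S G" and nn: "\<And>a. 0 \<le> quad_form I S a"
  shows "moment_form G I (\<lambda>z k. z k) a = quad_form I S a"
proof -
  have [measurable_cong]: "sets G = sets (PiM I (\<lambda>_. borel))" using G by (simp add: is_gauss_def)
  have "moment_form G I (\<lambda>z k. z k) a = (\<integral>x. x\<^sup>2 \<partial>distr G borel (\<lambda>z. \<Sum>i\<in>I. a i * z i))"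
    unfolding moment_form_def by (subst integral_distr) auto
  also have "\<dots> = quad_form I S a"
  proof (cases "quad_form I S a = 0")
    case True
    then show ?thesis using G by (simp add: is_gauss_def integral_return)
  next
    case False
    then have "sqrt (quad_form I S a) > 0" using nn[of a] by simp
    from normal_square_integral[OF this] show ?thesis using G False nn[of a] by (simp add: is_gauss_def)
  qed
  finally show ?thesis .
qed

text \<open>The envelope \<open>2 sqrt (ln (\<Sum> exp (z\<^sub>k\<^sup>2 / 4)))\<close> dominates the maximum norm, and its fourth
  moment is of order \<open>(ln (card I))\<^sup>2\<close> since \<open>E exp (z\<^sub>k\<^sup>2 / 4) \<le> 2\<close>.\<close>
lemma gauss_small_vector:
  assumes I: "finite I" "I \<noteq> {}" and G: "gauss_law I S G" and S: "\<And>k. k \<in> I \<Longrightarrow> 0 < S k k" "\<And>k. k \<in> I \<Longrightarrow> S k k \<le> 1"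
  shows "small_vector G I (\<lambda>z k. z k) (\<lambda>z. 2 * sqrt (ln (\<Sum>k\<in>I. exp ((z k)\<^sup>2 / 4)))) 2
     (32 * (ln (2 * real (card I)))\<^sup>2 + 32)"
proof -
  interpret prob_space G using G by (simp add: gauss_law_def)
  have sets[measurable_cong]: "sets G = sets (PiM I (\<lambda>_. borel))" using G by (simp add: gauss_law_def)
  have coord[measurable]: "(\<lambda>z. z k) \<in> borel_measurable G" if "k \<in> I" for k
    using that by (simp add: measurable_cong_sets[OF sets refl])
  define X where "X z = (\<Sum>k\<in>I. exp ((z k)\<^sup>2 / 4))" for z :: "'a \<Rightarrow> real"
  have Xm[measurable]: "X \<in> borel_measurable G" unfolding X_def[abs_def] by measurable
  have Xk: "exp ((z k)\<^sup>2 / 4) \<le> X z" if "k \<in> I" for z k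
    unfolding X_def using I that by (intro member_le_sum) auto
  have X1: "1 \<le> X z" for z
  proof -
    obtain k where "k \<in> I" using I by auto
    have "1 \<le> exp ((z k)\<^sup>2 / 4)" by simp
    then show ?thesis using Xk[OF \<open>k \<in> I\<close>, of z] by linarith
  qed
  have card: "real (card I) \<ge> 1" using I by (simp add: Suc_leI card_gt_0_iff)
  define a where "a = 2 * real (card I)"
  have a: "a \<ge> 1" using card by (simp add: a_def)
  have marg: "(\<integral>z. u (z k) \<partial>G) = (\<integral>x. u x \<partial>density lborel (normal_density 0 (sqrt (S k k))))"
    "integrable G (\<lambda>z. u (z k)) \<longleftrightarrow> integrable (density lborel (normal_density 0 (sqrt (S k k)))) u"
    if k: "k \<in> I" and u: "u \<in> borel_measurable borel" for k and u :: "real \<Rightarrow> real"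
  proof -
    note law = gauss_law_marginal[of I S G k, OF G I(1) k S(1)[of k, OF k]]
    show "(\<integral>z. u (z k) \<partial>G) = (\<integral>x. u x \<partial>density lborel (normal_density 0 (sqrt (S k k))))"
      unfolding law[symmetric] using k u by (subst integral_distr) auto
    show "integrable G (\<lambda>z. u (z k)) \<longleftrightarrow> integrable (density lborel (normal_density 0 (sqrt (S k k)))) u"
      unfolding law[symmetric] using k u by (subst integrable_distr_eq) auto
  qed
  have sq: "0 < sqrt (S k k)" "sqrt (S k k) \<le> 1" if "k \<in> I" for k using S[of k] that by auto
  have iX: "integrable G X" and EX: "(\<integral>z. X z \<partial>G) \<le> a"
  proof -
    have ie: "integrable G (\<lambda>z. exp ((z k)\<^sup>2 / 4))" if "k \<in> I" for k
      using marg(2)[OF that, of "\<lambda>x. exp (x\<^sup>2 / 4)"] normal_exp_moment(1)[OF sq[OF that]] by simp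
    have ee: "(\<integral>z. exp ((z k)\<^sup>2 / 4) \<partial>G) \<le> 2" if "k \<in> I" for k
      using marg(1)[OF that, of "\<lambda>x. exp (x\<^sup>2 / 4)"] normal_exp_moment(2)[OF sq[OF that]] by simp
    show "integrable G X" unfolding X_def[abs_def] using ie by auto
    have "(\<integral>z. X z \<partial>G) = (\<Sum>k\<in>I. \<integral>z. exp ((z k)\<^sup>2 / 4) \<partial>G)"
      unfolding X_def using ie by (intro Bochner_Integration.integral_sum) auto
    also have "\<dots> \<le> (\<Sum>k\<in>I. 2)" by (intro sum_mono ee)
    finally show "(\<integral>z. X z \<partial>G) \<le> a" by (simp add: a_def)
  qed
  have b4: "(2 * sqrt (ln (X z))) ^ 4 = 16 * (ln (X z))\<^sup>2" for z
  proof -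
    have "(2 * sqrt (ln (X z))) ^ 4 = 16 * ((sqrt (ln (X z)))\<^sup>2)\<^sup>2" by (simp add: power_mult_distrib flip: power_mult)
    then show ?thesis using X1[of z] by simp
  qed
  \<comment> \<open>Affine in \<open>X\<close> and tuned at \<open>a\<close>, which bounds the mean
    of \<open>X\<close>, so that taking expectations adds only 32.\<close>
  have le: "16 * (ln (X z))\<^sup>2 \<le> 32 * (ln a)\<^sup>2 + 32 / a * X z" for z
    using ln_square_le[OF X1[of z] a] by simp
  have i4: "integrable G (\<lambda>z. 16 * (ln (X z))\<^sup>2)"
    by (rule Bochner_Integration.integrable_bound[of _ "\<lambda>z. 32 * (ln a)\<^sup>2 + 32 / a * X z"])
      (use iX le in \<open>auto intro!: AE_I2 intro: order_trans[OF _ abs_ge_self]\<close>)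
  show ?thesis
    unfolding X_def[symmetric]
  proof
    show "finite I" "I \<noteq> {}" by (rule I)+
    show "(\<lambda>z. z k) \<in> borel_measurable G" if "k \<in> I" for k by (rule coord[OF that])
    show "(\<lambda>z. 2 * sqrt (ln (X z))) \<in> borel_measurable G" by measurable
    show "\<bar>z k\<bar> \<le> 2 * sqrt (ln (X z))" if "k \<in> I" for z k
    proof -
      have "(z k)\<^sup>2 / 4 \<le> ln (X z)" using Xk[OF that, of z] X1[of z] by (subst ln_ge_iff) auto
      then have "sqrt ((z k / 2)\<^sup>2) \<le> sqrt (ln (X z))" by (intro real_sqrt_le_mono) (simp add: power_divide)
      then show ?thesis by simp
    qed
    show "integrable G (\<lambda>z. (2 * sqrt (ln (X z))) ^ 4)" unfolding b4 by (rule i4)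
    have "(\<integral>z. 16 * (ln (X z))\<^sup>2 \<partial>G) \<le> (\<integral>z. 32 * (ln a)\<^sup>2 + 32 / a * X z \<partial>G)"
      using i4 iX le by (intro integral_mono) auto
    also have "\<dots> = 32 * (ln a)\<^sup>2 + 32 / a * (\<integral>z. X z \<partial>G)" using iX by (simp add: prob_space)
    also have "\<dots> \<le> 32 * (ln a)\<^sup>2 + 32 / a * a" using EX a by (intro add_left_mono mult_left_mono) auto
    also have "\<dots> = 32 * (ln a)\<^sup>2 + 32" using a by simp
    finally show "(\<integral>z. (2 * sqrt (ln (X z))) ^ 4 \<partial>G) \<le> 32 * (ln (2 * real (card I)))\<^sup>2 + 32"
      unfolding b4 by (simp add: a_def)
  next
    fix k assume k: "k \<in> I"
    show "(\<integral>z. \<bar>z k\<bar> ^ 3 \<partial>G) \<le> 2"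
    proof -
      have "(\<integral>z. \<bar>z k\<bar> ^ 3 \<partial>G) = (\<integral>x. normal_density 0 (sqrt (S k k)) x * \<bar>x - 0\<bar> ^ (2 * 1 + 1) \<partial>lborel)"
        using marg(1)[OF k, of "\<lambda>x. \<bar>x\<bar> ^ 3"] by (simp add: integral_density numeral_3_eq_3)
      \<comment> \<open>The third absolute moment of a centered normal variable; its standard
        deviation is at most 1 and 2 / pi is below 1.\<close>
      also have "\<dots> = 2 * (sqrt (S k k)) ^ 3 * sqrt (2 / pi)"
        by (subst integral_normal_moment_abs_odd[OF sq(1)[OF k]]) simp
      also have "\<dots> \<le> 2 * 1 * 1"
        using sq[OF k] pi_gt3 by (intro mult_mono) (auto simp: power_le_one real_sqrt_le_1_iff)
      finally show ?thesis by simp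
    qed
    show "(\<integral>z. z k \<partial>G) = 0"
      using marg(1)[OF k, of "\<lambda>x. x"] integral_normal_moment_nz_1[OF sq(1)[OF k], of 0] by (simp add: integral_density)
  qed
qed

text \<open>Nazarov's bound has widths relative to the standard deviations. Since these are at least
  sqrt C1, an absolute width w corresponds to \<epsilon> = w / sqrt C1; for \<epsilon> > 1 the
  right-hand side exceeds 1.\<close>

lemma anticoncentration_scaled_sum:
  assumes G: "gauss_law I S G" and I: "finite I" "I \<noteq> {}" and C1: "0 < C1" and S: "\<And>k. k \<in> I \<Longrightarrow> C1 \<le> S k k"
    and sym: "\<And>i j. i \<in> I \<Longrightarrow> j \<in> I \<Longrightarrow> S i j = S j i" and w: "0 < w" and n: "n > 0"
  shows "measure (PiM {..<n} (\<lambda>_. G)) {z \<in> space (PiM {..<n} (\<lambda>_. G)).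
        (\<exists>k\<in>I. t < (\<Sum>i<n. z i k / sqrt (real n))) \<and> (\<forall>k\<in>I. (\<Sum>i<n. z i k / sqrt (real n)) \<le> t + w)}
     \<le> (exp (3 / 2) * (sqrt (2 * ln (real (card I))) + 2) + 1) * (w / sqrt C1)" (is "measure ?P ?A \<le> ?c * _")
proof -
  interpret P: prob_space ?P using G by (intro prob_space_PiM) (simp add: gauss_law_def)
  have card: "real (card I) \<ge> 1" using I by (simp add: Suc_leI card_gt_0_iff)
  have c1: "?c \<ge> 1" using card by simp
  show ?thesis
  proof (cases "w / sqrt C1 \<le> 1")
    case False
    then have "1 * 1 \<le> ?c * (w / sqrt C1)" using c1 by (intro mult_mono) auto
    then show ?thesis using P.prob_le_1[of ?A] by linarith
  next
    case True
    define X where "X = (\<lambda>z. \<lambda>k\<in>I. (\<Sum>i<n. z i k) / sqrt (real n))"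
    define D where "D = distr ?P (PiM I (\<lambda>_. borel)) X"
    have D: "gauss_law I S D" unfolding D_def X_def by (rule gauss_law_scaled_sum[OF G I(1) n])
    have sets: "sets G = sets (PiM I (\<lambda>_. borel))" using G by (simp add: gauss_law_def)
    have coord: "(\<lambda>z. z k) \<in> borel_measurable G" if "k \<in> I" for k
      using that by (simp add: measurable_cong_sets[OF sets refl])
    have Xm: "X \<in> ?P \<rightarrow>\<^sub>M PiM I (\<lambda>_. borel)" unfolding X_def
      by (intro measurable_restrict borel_measurable_divide borel_measurable_sum borel_measurable_const
         measurable_compose[OF measurable_component_singleton[of _ "{..<n}" "\<lambda>_. G"] coord])
    define E where "E = {z \<in> space D. (\<exists>k\<in>I. t < z k) \<and> (\<forall>k\<in>I. z k \<le> t + sqrt (S k k) * (w / sqrt C1))}"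
    have E: "E \<in> sets (PiM I (\<lambda>_. borel))"
    proof -
      have c: "(\<lambda>z. z k) \<in> borel_measurable (PiM I (\<lambda>_. borel :: real measure))" if "k \<in> I" for k
        by (rule measurable_component_singleton[OF that])
      have "{z \<in> space (PiM I (\<lambda>_. borel)). \<exists>k\<in>I. t < z k} \<in> sets (PiM I (\<lambda>_. borel))"
        by (intro sets.sets_Collect_finite_Ex borel_measurable_less borel_measurable_const c I)
      moreover have "{z \<in> space (PiM I (\<lambda>_. borel)). \<forall>k\<in>I. z k \<le> t + sqrt (S k k) * (w / sqrt C1)} \<in> sets (PiM I (\<lambda>_. borel))"
        by (intro sets.sets_Collect_finite_All' borel_measurable_le borel_measurable_const c I)
      ultimately have "{z \<in> space (PiM I (\<lambda>_. borel)). (\<exists>k\<in>I. t < z k) \<and> (\<forall>k\<in>I. z k \<le> t + sqrt (S k k) * (w / sqrt C1))} \<in> sets (PiM I (\<lambda>_. borel))"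
        by - (rule sets.sets_Collect_conj; assumption)
      then show ?thesis by (simp add: E_def D_def)
    qed
    have "?A \<subseteq> X -` E \<inter> space ?P"
    proof
      fix z assume z: "z \<in> ?A"
      have "w \<le> sqrt (S k k) * (w / sqrt C1)" if "k \<in> I" for k
      proof -
        have "sqrt C1 * (w / sqrt C1) \<le> sqrt (S k k) * (w / sqrt C1)"
          using S[OF that] w C1 by (intro mult_right_mono real_sqrt_le_mono) auto
        then show ?thesis using C1 by simp
      qed
      moreover have "X z k = (\<Sum>i<n. z i k / sqrt (real n))" if "k \<in> I" for k
        using that by (simp add: X_def sum_divide_distrib)
      moreover have "X z \<in> space D" using measurable_space[OF Xm] z by (simp add: D_def)
      ultimately show "z \<in> X -` E \<inter> space ?P" using z by (fastforce simp: E_def)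
    qed
    then have "measure ?P ?A \<le> measure ?P (X -` E \<inter> space ?P)"
      using measurable_sets[OF Xm E] by (intro P.finite_measure_mono)
    also have "\<dots> = measure D E"
      unfolding D_def by (rule measure_distr[symmetric, OF Xm E])
    also have "\<dots> \<le> ?c * (w / sqrt C1)"
      unfolding E_def by (rule gauss_anticoncentration[OF D I _ sym _ True]) (use S C1 w in \<open>auto intro: less_le_trans\<close>)
    finally show ?thesis .
  qed
qed

context ustat_kernel
begin

definition cov :: "'i \<Rightarrow> 'i \<Rightarrow> real" where "cov i j = (\<integral>x. proj x i * proj x j \<partial>F)"

lemma proj_prod_integrable:
  assumes "i \<in> I" "j \<in> I"
  shows "integrable F (\<lambda>x. proj x i * proj x j)"
proof (rule Bochner_Integration.integrable_bound[of _ "\<lambda>x. (proj x i)\<^sup>2 + (proj x j)\<^sup>2"])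
  show "AE x in F. norm (proj x i * proj x j) \<le> norm ((proj x i)\<^sup>2 + (proj x j)\<^sup>2)"
  proof (rule AE_I2)
    fix x
    have "2 * (\<bar>proj x i\<bar> * \<bar>proj x j\<bar>) \<le> \<bar>proj x i\<bar>\<^sup>2 + \<bar>proj x j\<bar>\<^sup>2"
      using zero_le_square[of "\<bar>proj x i\<bar> - \<bar>proj x j\<bar>"] by (simp only: power2_eq_square algebra_simps)
    moreover have "0 \<le> \<bar>proj x i\<bar> * \<bar>proj x j\<bar>" by simp
    ultimately have "\<bar>proj x i\<bar> * \<bar>proj x j\<bar> \<le> \<bar>proj x i\<bar>\<^sup>2 + \<bar>proj x j\<bar>\<^sup>2" by linarith
    then show "norm (proj x i * proj x j) \<le> norm ((proj x i)\<^sup>2 + (proj x j)\<^sup>2)" by (simp add: abs_mult)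
  qed
qed (use assms proj_square in auto)

lemma moment_form_proj: "moment_form F I proj a = quad_form I cov a"
proof -
  have "moment_form F I proj a = (\<integral>x. (\<Sum>i\<in>I. \<Sum>j\<in>I. a i * a j * (proj x i * proj x j)) \<partial>F)"
    by (simp add: moment_form_def power2_eq_square sum_product mult_ac)
  also have "\<dots> = (\<Sum>i\<in>I. \<integral>x. (\<Sum>j\<in>I. a i * a j * (proj x i * proj x j)) \<partial>F)"
    using proj_prod_integrable by (intro Bochner_Integration.integral_sum Bochner_Integration.integrable_sum integrable_mult_right)
  also have "\<dots> = (\<Sum>i\<in>I. \<Sum>j\<in>I. \<integral>x. a i * a j * (proj x i * proj x j) \<partial>F)"
    using proj_prod_integrable by (intro sum.cong refl Bochner_Integration.integral_sum integrable_mult_right)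
  also have "\<dots> = quad_form I cov a" by (simp add: quad_form_def cov_def)
  finally show ?thesis .
qed

lemma quad_form_cov_nonneg: "0 \<le> quad_form I cov a"
  unfolding moment_form_proj[symmetric] moment_form_def by simp

lemma cov_sym: "cov i j = cov j i" by (simp add: cov_def mult.commute)

lemma cov_le_1: "k \<in> I \<Longrightarrow> cov k k \<le> 1"
  using proj_square(2)[of k] by (simp add: cov_def power2_eq_square)

lemma proj_small_vector: "small_vector F I proj env (8 * B) (16 * B ^ 4)"
  by standard (use I env4 proj_cubed proj_mean proj_le_env in auto)

text \<open>The normalisation is sqrt n / 2 divided by n (n - 1) / 2, the number of pairs.\<close>

definition remainder :: "nat \<Rightarrow> (nat \<Rightarrow> 'a) \<Rightarrow> 'i \<Rightarrow> real" where
  "remainder n x k = (\<Sum>j<n. \<Sum>i<j. resid (x i) (x j) k) / (sqrt (real n) * (real n - 1))"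

lemma remainder_measurable:
  assumes k: "k \<in> I"
  shows "(\<lambda>x. remainder n x k) \<in> borel_measurable (PiM {..<n} (\<lambda>_. F))"
proof -
  interpret R: degenerate_kernel F I resid "\<lambda>x y. N x y + Nmean + (env x + env y)" "7 * B" by (rule resid_degenerate)
  have "(\<lambda>x. resid (x i) (x j) k) \<in> borel_measurable (PiM {..<n} (\<lambda>_. F))" if "j \<in> {..<n}" "i \<in> {..<j}" for i j
    using that by (intro R.f_compose[OF k] measurable_component_singleton) auto
  then show ?thesis unfolding remainder_def by (intro borel_measurable_divide borel_measurable_sum borel_measurable_const)
qed

text \<open>Markov's inequality for \<open>snorm\<close>, which dominates every coordinate. The
  constant is 3 * 7 * 2: 3 from \<open>outer_bound\<close>, 7 from the envelope of
  \<open>resid\<close>, 2 from n / (n - 1) \<le> 2.\<close>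

lemma remainder_tail:
  assumes n: "2 \<le> n" and l: "ln (2 * real (card I)) \<le> l" "1 \<le> l" and \<delta>: "0 < \<delta>"
  shows "measure (PiM {..<n} (\<lambda>_. F)) {x \<in> space (PiM {..<n} (\<lambda>_. F)). \<exists>k\<in>I. \<delta> < \<bar>remainder n x k\<bar>}
    \<le> 42 * l * B / (\<delta> * sqrt (real n))" (is "measure ?P ?A \<le> _")
proof -
  interpret R: degenerate_kernel F I resid "\<lambda>x y. N x y + Nmean + (env x + env y)" "7 * B" by (rule resid_degenerate)
  interpret P: prob_space ?P by (intro prob_space_PiM prob_space_axioms)
  define \<beta> where "\<beta> = 1 / (real n * (7 * B))"
  have \<beta>: "\<beta> > 0" using n B by (simp add: \<beta>_def)
  define c where "c = \<delta> * (sqrt (real n) * (real n - 1))"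
  have c: "c > 0" using n \<delta> by (simp add: c_def)
  define V where "V x = snorm \<beta> I (\<lambda>k. \<Sum>j<n. \<Sum>i<j. resid (x i) (x j) k)" for x
  have rm: "(\<lambda>x. resid (x i) (x j) k) \<in> borel_measurable ?P" if "k \<in> I" "j \<in> {..<n}" "i \<in> {..<j}" for i j k
    using that by (intro R.f_compose measurable_component_singleton) auto
  have Vm: "V \<in> borel_measurable ?P"
    unfolding V_def[abs_def] by (intro snorm_measurable borel_measurable_sum rm)
  have V0: "0 \<le> V x" for x unfolding V_def by (rule snorm_nonneg[OF I \<beta>])
  have sub: "?A \<subseteq> {x \<in> space ?P. 1 \<le> ennreal (1 / c) * ennreal (V x)}"
  proof
    fix x assume "x \<in> ?A"
    then obtain k where x: "x \<in> space ?P" and k: "k \<in> I" and d: "\<delta> < \<bar>remainder n x k\<bar>" by auto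
    have "\<bar>\<Sum>j<n. \<Sum>i<j. resid (x i) (x j) k\<bar> \<le> V x" unfolding V_def by (rule snorm_ge[OF I \<beta> k])
    moreover have "c < \<bar>\<Sum>j<n. \<Sum>i<j. resid (x i) (x j) k\<bar>"
      using d n by (simp add: remainder_def c_def abs_mult pos_less_divide_eq)
    ultimately have "1 \<le> 1 / c * V x" using c by (simp add: field_simps)
    then have "ennreal 1 \<le> ennreal (1 / c * V x)" by (rule ennreal_leI)
    also have "ennreal (1 / c * V x) = ennreal (1 / c) * ennreal (V x)" using c V0 by (intro ennreal_mult) auto
    finally show "x \<in> {x \<in> space ?P. 1 \<le> ennreal (1 / c) * ennreal (V x)}"
      using x by simp
  qed
  have "ennreal (measure ?P ?A) = emeasure ?P ?A" by (simp add: P.emeasure_eq_measure)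
  also have "\<dots> \<le> emeasure ?P {x \<in> space ?P. 1 \<le> ennreal (1 / c) * ennreal (V x)}"
    using Vm by (intro emeasure_mono sub) measurable
  also have "\<dots> \<le> ennreal (1 / c) * (\<integral>\<^sup>+x. ennreal (V x) * indicator (space ?P) x \<partial>?P)"
    using Vm by (intro nn_integral_Markov_inequality) auto
  also have "(\<integral>\<^sup>+x. ennreal (V x) * indicator (space ?P) x \<partial>?P) = (\<integral>\<^sup>+x. ennreal (V x) \<partial>?P)"
    by (intro nn_integral_cong) simp
  also have "ennreal (1 / c) * (\<integral>\<^sup>+x. ennreal (V x) \<partial>?P) \<le> ennreal (1 / c) * ennreal (3 * l * real n * (7 * B))"
    using R.outer_bound[OF l, of n] n unfolding V_def \<beta>_def by (intro mult_left_mono) auto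
  also have "\<dots> = ennreal (1 / c * (3 * l * real n * (7 * B)))"
    using c l B by (intro ennreal_mult[symmetric]) auto
  finally have "measure ?P ?A \<le> 1 / c * (3 * l * real n * (7 * B))"
    using c l B by (subst (asm) ennreal_le_iff) auto
  also have "\<dots> = 21 * l * B / (\<delta> * sqrt (real n)) * (real n / (real n - 1))"
    using n \<delta> by (simp add: c_def field_simps)
  also have "\<dots> \<le> 21 * l * B / (\<delta> * sqrt (real n)) * 2"
    using n \<delta> l B by (intro mult_left_mono) (auto simp: field_simps)
  finally show ?thesis by simp
qed

text \<open>One summand per error: third order (1680 * 3 * 10), fourth order (3360 * 336), remainder
  tail (42 * 3) and anti-concentration.\<close>

definition rate_const :: real where
  "rate_const = 50400 * exp 2 + 1128960 + 126 + 5 * (5 * exp (3 / 2) + 1) / sqrt C1"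

lemma gaussian_approximation:
  assumes n: "2 \<le> n" and L: "1 \<le> L" "ln (2 * real (card I)) \<le> 3 * L"
    and r: "0 < r" "r \<le> 1" "r ^ 8 = B ^ 4 * L ^ 7 / real n"
    and cov: "\<And>k. k \<in> I \<Longrightarrow> C1 \<le> cov k k" and G: "is_gauss I cov G"
  shows "\<bar>measure (PiM {..<n} (\<lambda>_. F)) {x \<in> space (PiM {..<n} (\<lambda>_. F)). \<forall>k\<in>I. (\<Sum>i<n. proj (x i) k / sqrt (real n)) + remainder n x k \<le> t}
     - measure (PiM {..<n} (\<lambda>_. G)) {z \<in> space (PiM {..<n} (\<lambda>_. G)). \<forall>k\<in>I. (\<Sum>i<n. z i k / sqrt (real n)) \<le> t}\<bar>
    \<le> rate_const * r"
proof -
  have card: "real (card I) \<ge> 1" using I by (simp add: Suc_leI card_gt_0_iff)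
  define s where "s = sqrt L"
  have s: "1 \<le> s" "s\<^sup>2 = L" using L by (auto simp: s_def)
  define N where "N = sqrt (real n)"
  have N: "0 < N" "N\<^sup>2 = real n" using n by (auto simp: N_def)
  \<comment> \<open>Makes the smoothing cost \<delta> sqrt L equal to r; \<beta> then gives \<beta>
    \<delta> = L, so the gap between maximum and smooth maximum is of order \<delta>.\<close>
  define \<delta> where "\<delta> = r / s"
  define \<beta> where "\<beta> = s ^ 3 / r"
  have \<delta>: "0 < \<delta>" using r s by (simp add: \<delta>_def)
  have \<beta>: "0 < \<beta>" using r s by (simp add: \<beta>_def)
  have \<beta>\<delta>: "\<beta> * \<delta> = L" using r s by (simp add: \<beta>_def \<delta>_def power3_eq_cube power2_eq_square[symmetric])
  have key8: "N\<^sup>2 * r ^ 8 = B ^ 4 * s ^ 14"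
  proof -
    have "s ^ 14 = L ^ 7" using s(2)[symmetric] by (simp flip: power_mult)
    then show ?thesis using r(3) N n by simp
  qed
  \<comment> \<open>The square root of the equation defining r; every error below is converted into
    powers of r with it or with \<open>key8\<close>.\<close>
  have key: "N * r ^ 4 = B\<^sup>2 * s ^ 7"
  proof -
    have "(N * r ^ 4)\<^sup>2 = (B\<^sup>2 * s ^ 7)\<^sup>2" using key8 by (simp add: power_mult_distrib flip: power_mult)
    then show ?thesis using N r B s by (intro power2_eq_imp_eq[of "N * r ^ 4"]) auto
  qed
  have nn: "0 \<le> quad_form I cov a" for a by (rule quad_form_cov_nonneg)
  have GL: "gauss_law I cov G"
    using G I nn by (intro gauss_lawI) (auto simp: is_gauss_def)
  have pos: "0 < cov k k" if "k \<in> I" for k using cov[OF that] C1 by linarith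
  define \<tau>G where "\<tau>G = 32 * (ln (2 * real (card I)))\<^sup>2 + 32"
  have SY: "small_vector F I (\<lambda>x k. proj x k / N) (\<lambda>x. env x / N) (8 * B / N ^ 3) (16 * B ^ 4 / N ^ 4)"
    by (rule small_vector_scale[OF proj_small_vector N(1)])
  have SZ: "small_vector G I (\<lambda>z k. z k / N) (\<lambda>z. 2 * sqrt (ln (\<Sum>k\<in>I. exp ((z k)\<^sup>2 / 4))) / N) (2 / N ^ 3) (\<tau>G / N ^ 4)"
    unfolding \<tau>G_def by (rule small_vector_scale[OF gauss_small_vector[OF I GL pos cov_le_1] N(1)])
  have qq: "moment_form F I (\<lambda>x k. proj x k / N) a = moment_form G I (\<lambda>z k. z k / N) a" for a
    by (simp only: moment_form_scale moment_form_proj gauss_moment_form[OF I(1) G nn])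
  define w where "w = \<delta> + ln (real (card I)) / \<beta> + \<delta>"
  have w: "0 < w" "w \<le> 5 * \<delta>"
  proof -
    have "0 \<le> ln (real (card I)) / \<beta>" using card \<beta> by simp
    then show "0 < w" using \<delta> by (simp add: w_def)
    have "ln (real (card I)) \<le> ln (2 * real (card I))" using card by simp
    also have "\<dots> \<le> 3 * (\<beta> * \<delta>)" using L by (simp add: \<beta>\<delta>)
    \<comment> \<open>The five units of \<delta> in \<open>w\<close> are one for the remainder,
      three for this gap and one for the step.\<close>
    finally have "ln (real (card I)) / \<beta> \<le> 3 * \<delta>" using \<beta> by (simp add: field_simps)
    then show "w \<le> 5 * \<delta>" by (simp add: w_def)
  qed
  define c where "c = exp (3 / 2) * (sqrt (2 * ln (real (card I))) + 2) + 1"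
  have "\<bar>measure (PiM {..<n} (\<lambda>_. F)) {x \<in> space (PiM {..<n} (\<lambda>_. F)). \<forall>k\<in>I. (\<Sum>i<n. proj (x i) k / N) + remainder n x k \<le> t}
     - measure (PiM {..<n} (\<lambda>_. G)) {z \<in> space (PiM {..<n} (\<lambda>_. G)). \<forall>k\<in>I. (\<Sum>i<n. z i k / N) \<le> t}\<bar>
    \<le> real n * (1680 * \<beta>\<^sup>2 / \<delta> * (3 * exp 2 * (8 * B / N ^ 3 + 2 / N ^ 3)) + 2 * 1680 * \<beta>^3 / \<delta> * (16 * B ^ 4 / N ^ 4 + \<tau>G / N ^ 4))
      + 42 * (3 * L) * B / (\<delta> * sqrt (real n)) + c * (w / sqrt C1)"
  proof (rule gaussian_comparison[OF SY SZ qq \<beta> \<delta> _ remainder_measurable])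
    show "1 \<le> \<beta> * \<delta>" using L \<beta>\<delta> by simp
    show "measure (PiM {..<n} (\<lambda>_. F)) {x \<in> space (PiM {..<n} (\<lambda>_. F)). \<exists>k\<in>I. \<delta> < \<bar>remainder n x k\<bar>} \<le> 42 * (3 * L) * B / (\<delta> * sqrt (real n))"
      by (rule remainder_tail[OF n L(2) _ \<delta>]) (use L in simp)
    show "measure (PiM {..<n} (\<lambda>_. G)) {z \<in> space (PiM {..<n} (\<lambda>_. G)). (\<exists>k\<in>I. t < (\<Sum>i<n. z i k / N)) \<and>
        (\<forall>k\<in>I. (\<Sum>i<n. z i k / N) \<le> t + (\<delta> + ln (real (card I)) / \<beta> + \<delta>))} \<le> c * (w / sqrt C1)" for t
      unfolding N_def c_def w_def[symmetric]
      by (rule anticoncentration_scaled_sum[OF GL I C1 cov cov_sym w(1)]) (use n in auto)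
  qed
  also have "\<dots> \<le> rate_const * r"
  proof -
    have B2: "B \<le> B\<^sup>2" "1 \<le> B\<^sup>2" "1 \<le> B ^ 4"
      using B one_le_power[OF B, of 2] one_le_power[OF B, of 4] by (auto simp: power2_eq_square)
    have e1: "\<beta>\<^sup>2 / \<delta> = s ^ 7 / r ^ 3" "\<beta>^3 / \<delta> = s ^ 10 / r ^ 4"
      using s(1) r(1) by (simp_all add: \<beta>_def \<delta>_def field_simps eval_nat_numeral)
    have Bs: "B * s ^ 7 \<le> N * r ^ 4" unfolding key using B2 s by (intro mult_right_mono) auto
    \<comment> \<open>Third order: after substitution this is a multiple of B s^7 / (N r^3), and
      \<open>Bs\<close> turns it into r.\<close>
    have "real n * (1680 * \<beta>\<^sup>2 / \<delta> * (3 * exp 2 * (8 * B / N ^ 3 + 2 / N ^ 3))) \<le> real n * (1680 * \<beta>\<^sup>2 / \<delta> * (3 * exp 2 * (10 * B / N ^ 3)))"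
    proof (intro mult_left_mono)
      show "8 * B / N ^ 3 + 2 / N ^ 3 \<le> 10 * B / N ^ 3"
        unfolding add_divide_distrib[symmetric] using B N by (intro divide_right_mono) auto
    qed (use \<delta> in auto)
    also have "\<dots> = 50400 * exp 2 * (\<beta>\<^sup>2 / \<delta>) * B / N"
      using N unfolding N(2)[symmetric] by (simp add: field_simps eval_nat_numeral)
    also have "\<dots> = 50400 * exp 2 * (B * s ^ 7) / (N * r ^ 3)"
      unfolding e1 using r(1) N(1) by (simp add: field_simps)
    also have "\<dots> \<le> 50400 * exp 2 * (N * r ^ 4) / (N * r ^ 3)"
      using Bs r N by (intro divide_right_mono mult_left_mono) auto
    also have "\<dots> = 50400 * exp 2 * r" using r(1) N(1) by (simp add: field_simps eval_nat_numeral)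
    finally have t1: "real n * (1680 * \<beta>\<^sup>2 / \<delta> * (3 * exp 2 * (8 * B / N ^ 3 + 2 / N ^ 3))) \<le> 50400 * exp 2 * r" .
    have r4: "r ^ 4 \<le> r" "r ^ 3 \<le> r" using r power_decreasing[of 1 4 r] power_decreasing[of 1 3 r] by auto
    have "(ln (2 * real (card I)))\<^sup>2 \<le> (3 * L)\<^sup>2" using L card by (intro power_mono) auto
    moreover have "1 \<le> L\<^sup>2" using L by simp
    \<comment> \<open>320 = 32 * 9 + 32.\<close>
    ultimately have "\<tau>G \<le> 320 * L\<^sup>2" unfolding \<tau>G_def by (simp add: power_mult_distrib)
    then have \<tau>G: "\<tau>G \<le> 320 * s ^ 4" unfolding s(2)[symmetric] by simp
    have b1: "s ^ 10 * B ^ 4 \<le> N\<^sup>2 * r ^ 8"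
    proof -
      have "s ^ 10 * B ^ 4 \<le> s ^ 14 * B ^ 4" using s by (intro mult_right_mono power_increasing) auto
      then show ?thesis unfolding key8 by (simp add: mult.commute)
    qed
    have b2: "s ^ 10 * s ^ 4 \<le> N\<^sup>2 * r ^ 8"
    proof -
      have "1 * s ^ 14 \<le> B ^ 4 * s ^ 14" using s B2 by (intro mult_right_mono) auto
      then show ?thesis unfolding key8 by (simp flip: power_add)
    qed
    \<comment> \<open>Fourth order: \<open>b1\<close> handles the envelope of the projections,
      \<open>b2\<close> the Gaussian envelope, with 336 = 16 + 320.\<close>
    have "real n * (2 * 1680 * \<beta>^3 / \<delta> * (16 * B ^ 4 / N ^ 4 + \<tau>G / N ^ 4)) = 3360 * (\<beta>^3 / \<delta>) * (16 * B ^ 4 + \<tau>G) / N\<^sup>2"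
    proof -
      have "N\<^sup>2 * (q * (y / N ^ 4)) = q * y / N\<^sup>2" for q y
        using N by (simp add: field_simps eval_nat_numeral)
      from this[of "2 * 1680 * \<beta>^3 / \<delta>" "16 * B ^ 4 + \<tau>G"] show ?thesis
        unfolding N(2)[symmetric] add_divide_distrib[symmetric] by simp
    qed
    also have "\<dots> = 3360 * (s ^ 10 * (16 * B ^ 4 + \<tau>G)) / (r ^ 4 * N\<^sup>2)"
      unfolding e1 by simp
    also have "\<dots> \<le> 3360 * (336 * (N\<^sup>2 * r ^ 8)) / (r ^ 4 * N\<^sup>2)"
    proof (intro divide_right_mono mult_left_mono)
      have "s ^ 10 * (16 * B ^ 4 + \<tau>G) \<le> s ^ 10 * (16 * B ^ 4 + 320 * s ^ 4)"
        using \<tau>G s by (intro mult_left_mono add_left_mono) auto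
      also have "\<dots> = 16 * (s ^ 10 * B ^ 4) + 320 * (s ^ 10 * s ^ 4)" by (simp only: distrib_left mult_ac)
      also have "\<dots> \<le> 16 * (N\<^sup>2 * r ^ 8) + 320 * (N\<^sup>2 * r ^ 8)" by (intro add_mono mult_left_mono b1 b2) auto
      finally show "s ^ 10 * (16 * B ^ 4 + \<tau>G) \<le> 336 * (N\<^sup>2 * r ^ 8)" by simp
    qed (use r N in auto)
    also have "\<dots> = 1128960 * r ^ 4" using r(1) N(1) by (simp add: field_simps eval_nat_numeral)
    also have "\<dots> \<le> 1128960 * r" using r4 by simp
    finally have t2: "real n * (2 * 1680 * \<beta>^3 / \<delta> * (16 * B ^ 4 / N ^ 4 + \<tau>G / N ^ 4)) \<le> 1128960 * r" .
    have "42 * (3 * L) * B / (\<delta> * sqrt (real n)) = 126 * (s ^ 3 * B) / (r * N)"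
      unfolding N_def[symmetric] s(2)[symmetric] \<delta>_def using s(1) r(1) N(1) by (simp add: field_simps eval_nat_numeral)
    also have "\<dots> \<le> 126 * (N * r ^ 4) / (r * N)"
    proof (intro divide_right_mono mult_left_mono)
      have "s ^ 3 * B \<le> s ^ 7 * B\<^sup>2" using s B B2 by (intro mult_mono power_increasing) auto
      then show "s ^ 3 * B \<le> N * r ^ 4" unfolding key by (simp add: mult.commute)
    qed (use r N in auto)
    also have "\<dots> = 126 * r ^ 3" using r(1) N(1) by (simp add: field_simps eval_nat_numeral)
    also have "\<dots> \<le> 126 * r" using r4 by simp
    finally have t3: "42 * (3 * L) * B / (\<delta> * sqrt (real n)) \<le> 126 * r" .
    have "c \<le> (5 * exp (3 / 2) + 1) * s"
    proof -
      \<comment> \<open>The logarithm of the cardinality is at most 3 L, so the square root is at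
        most sqrt (6 L).\<close>
      have "sqrt (2 * ln (real (card I))) \<le> 3 * s"
      proof (rule real_le_lsqrt)
        have "ln (real (card I)) \<le> ln (2 * real (card I))" using card by simp
        then show "2 * ln (real (card I)) \<le> (3 * s)\<^sup>2" using L s by (simp add: power_mult_distrib)
      qed (use s in simp)
      then have "sqrt (2 * ln (real (card I))) + 2 \<le> 5 * s" using s by simp
      then have "exp (3 / 2) * (sqrt (2 * ln (real (card I))) + 2) \<le> exp (3 / 2) * (5 * s)" by (intro mult_left_mono) auto
      then show ?thesis using s by (simp add: c_def algebra_simps)
    qed
    then have "c * (w / sqrt C1) \<le> ((5 * exp (3 / 2) + 1) * s) * (5 * \<delta> / sqrt C1)"
      using w C1 s by (intro mult_mono divide_right_mono) auto
    also have "\<dots> = 5 * (5 * exp (3 / 2) + 1) / sqrt C1 * r"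
    proof -
      have "(q * s) * (5 * (r / s) / y) = 5 * q / y * r" for q y using s(1) by simp
      then show ?thesis unfolding \<delta>_def .
    qed
    finally have t4: "c * (w / sqrt C1) \<le> 5 * (5 * exp (3 / 2) + 1) / sqrt C1 * r" .
    show ?thesis
      using add_mono[OF add_mono[OF add_mono[OF t1 t2] t3] t4] unfolding rate_const_def by (simp add: ring_distribs)
  qed
  finally show ?thesis unfolding N_def .
qed

end

section \<open>The U-statistic and its Hoeffding decomposition\<close>

lemma PiM_pair_distr:
  assumes "prob_space F" and ij: "i < n" "j < n" "i \<noteq> j"
  shows "distr (PiM {..<n::nat} (\<lambda>_. F)) (F \<Otimes>\<^sub>M F) (\<lambda>x. (x i, x j)) = F \<Otimes>\<^sub>M F"
proof -
  interpret prob_space F by fact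
  interpret product_sigma_finite "\<lambda>_::nat. F" ..
  have c: "(\<lambda>x. x i) \<in> PiM {..<n} (\<lambda>_. F) \<rightarrow>\<^sub>M F" "(\<lambda>x. x j) \<in> PiM {..<n} (\<lambda>_. F) \<rightarrow>\<^sub>M F"
    using ij by (auto intro: measurable_component_singleton)
  have m: "(\<lambda>x. (x i, x j)) \<in> PiM {..<n} (\<lambda>_. F) \<rightarrow>\<^sub>M F \<Otimes>\<^sub>M F" using c by (rule measurable_Pair)
  show ?thesis
  proof (rule pair_measure_eqI[symmetric])
    show "sigma_finite_measure F" "sigma_finite_measure F" by unfold_locales
    fix A B assume A: "A \<in> sets F" and B: "B \<in> sets F"
    define E where "E = (\<lambda>l. if l = i then A else if l = j then B else space F)"
    have E: "E l \<in> sets F" for l using A B by (simp add: E_def)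
    have "emeasure (distr (PiM {..<n} (\<lambda>_. F)) (F \<Otimes>\<^sub>M F) (\<lambda>x. (x i, x j))) (A \<times> B) = emeasure (PiM {..<n} (\<lambda>_. F)) (PiE {..<n} E)"
    proof -
      have "(\<lambda>x. (x i, x j)) -` (A \<times> B) \<inter> space (PiM {..<n} (\<lambda>_. F)) = PiE {..<n} E"
        using ij A[THEN sets.sets_into_space] B[THEN sets.sets_into_space]
        by (auto simp: space_PiM PiE_iff E_def split: if_splits) (metis lessThan_iff subsetD)
      then show ?thesis using A B by (subst emeasure_distr[OF m]) auto
    qed
    also have "\<dots> = (\<Prod>l<n. emeasure F (E l))" by (rule emeasure_PiM) (auto simp: E)
    also have "\<dots> = (\<Prod>l\<in>{i, j}. emeasure F (E l))"
      using ij by (intro prod.mono_neutral_right) (auto simp: E_def emeasure_space_1)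
    also have "\<dots> = emeasure F A * emeasure F B" using ij by (simp add: E_def)
    finally show "emeasure F A * emeasure F B = emeasure (distr (PiM {..<n} (\<lambda>_. F)) (F \<Otimes>\<^sub>M F) (\<lambda>x. (x i, x j))) (A \<times> B)" by simp
  qed simp
qed

lemma sum_lower_pairs: "(\<Sum>(i, j)\<in>{(i, j). i < j \<and> j < n}. f i j) = (\<Sum>j<n. \<Sum>i<j. f i j)" for f :: "nat \<Rightarrow> nat \<Rightarrow> real"
proof -
  have "(\<Sum>j<n. \<Sum>i<j. f i j) = (\<Sum>(j, i)\<in>Sigma {..<n} (\<lambda>j. {..<j}). f i j)"
    by (rule sum.Sigma) auto
  also have "\<dots> = (\<Sum>(i, j)\<in>{(i, j). i < j \<and> j < n}. f i j)"
    by (rule sum.reindex_bij_witness[where i="\<lambda>(i, j). (j, i)" and j="\<lambda>(j, i). (i, j)"]) auto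
  finally show ?thesis by simp
qed

text \<open>Every index belongs to exactly n - 1 unordered pairs.\<close>

lemma sum_pairs_add: "(\<Sum>j<n. \<Sum>i<j. a i + a j) = (real n - 1) * (\<Sum>i<n. a i :: real)"
proof (induction n)
  case (Suc n)
  then show ?case by (simp add: sum.distrib algebra_simps)
qed simp

lemma real_choose_two: "real (n choose 2) = real n * (real n - 1) / 2"
proof -
  have "2 * (n choose 2) = n * (n - 1)"
    unfolding choose_two by (cases n) auto
  then have "2 * real (n choose 2) = real n * real (n - 1)"
    by (metis of_nat_mult of_nat_numeral)
  then show ?thesis by (cases n) (auto simp: field_simps)
qed

context ustat_kernel
begin

definition ustat :: "nat \<Rightarrow> (nat \<Rightarrow> 'a) \<Rightarrow> 'i \<Rightarrow> real" where
  "ustat n x k = (\<Sum>(i,j)\<in>{(i,j). i < j \<and> j < n}. H (x i) (x j) k) / real (n choose 2)"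

lemma integral_ustat:
  assumes n: "2 \<le> n" and k: "k \<in> I"
  shows "(\<integral>x. ustat n x k \<partial>PiM {..<n} (\<lambda>_. F)) = mean k"
proof -
  let ?P = "PiM {..<n} (\<lambda>_. F)"
  have pair: "integrable ?P (\<lambda>x. H (x i) (x j) k)" "(\<integral>x. H (x i) (x j) k \<partial>?P) = mean k" if "j \<in> {..<n}" "i \<in> {..<j}" for i j
  proof -
    have ij: "i < n" "j < n" "i \<noteq> j" using that by auto
    have m: "(\<lambda>x. (x i, x j)) \<in> ?P \<rightarrow>\<^sub>M F \<Otimes>\<^sub>M F"
      using ij by (intro measurable_Pair measurable_component_singleton) auto
    note d = PiM_pair_distr[OF prob_space_axioms ij]
    show "integrable ?P (\<lambda>x. H (x i) (x j) k)"
      using integrable_distr_eq[OF m H_meas[OF k]] H_integrable[OF k] unfolding d by simp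
    show "(\<integral>x. H (x i) (x j) k \<partial>?P) = mean k"
      using integral_distr[OF m H_meas[OF k]] unfolding d by (simp add: mean_def)
  qed
  \<comment> \<open>The constant is split into two halves, one per member of the pair, so that the
    pair formula applies.\<close>
  have c: "(\<Sum>j<n. \<Sum>i<j. mean k) = real (n choose 2) * mean k"
    using sum_pairs_add[of "\<lambda>_. mean k / 2" n] by (simp add: real_choose_two)
  have "(\<integral>x. (\<Sum>j<n. \<Sum>i<j. H (x i) (x j) k) \<partial>?P) = (\<Sum>j<n. \<integral>x. (\<Sum>i<j. H (x i) (x j) k) \<partial>?P)"
    using pair by (intro Bochner_Integration.integral_sum Bochner_Integration.integrable_sum)
  also have "\<dots> = (\<Sum>j<n. \<Sum>i<j. \<integral>x. H (x i) (x j) k \<partial>?P)"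
    using pair by (intro sum.cong refl Bochner_Integration.integral_sum)
  also have "\<dots> = (\<Sum>j<n. \<Sum>i<j. mean k)" using pair by (intro sum.cong refl)
  finally have "(\<integral>x. (\<Sum>j<n. \<Sum>i<j. H (x i) (x j) k) \<partial>?P) = real (n choose 2) * mean k" unfolding c .
  moreover have "real (n choose 2) > 0" using n by (simp add: real_choose_two)
  ultimately show ?thesis unfolding ustat_def sum_lower_pairs by simp
qed

lemma hoeffding_decomposition:
  assumes n: "2 \<le> n"
  shows "sqrt (real n) * (ustat n x k - mean k) / 2 = (\<Sum>i<n. proj (x i) k / sqrt (real n)) + remainder n x k"
proof -
  define N where "N = sqrt (real n)"
  have N: "N > 0" "real n = N * N" using n by (auto simp: N_def)
  have n1: "real n - 1 > 0" using n by simp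
  have "(\<Sum>j<n. \<Sum>i<j. H (x i) (x j) k) = (\<Sum>j<n. \<Sum>i<j. resid (x i) (x j) k + ((mean k / 2 + mean k / 2) + (proj (x i) k + proj (x j) k)))"
    by (intro sum.cong refl) (simp add: resid_def)
  also have "\<dots> = (\<Sum>j<n. \<Sum>i<j. resid (x i) (x j) k) + ((real n - 1) * (real n * (mean k / 2)) + (real n - 1) * (\<Sum>i<n. proj (x i) k))"
    unfolding sum.distrib[symmetric] by (simp only: sum.distrib[of _ _ "{..<_}"] sum_pairs_add[unfolded sum.distrib] ) simp
  finally have e: "(\<Sum>j<n. \<Sum>i<j. H (x i) (x j) k) = (\<Sum>j<n. \<Sum>i<j. resid (x i) (x j) k) + ((real n - 1) * (real n * (mean k / 2)) + (real n - 1) * (\<Sum>i<n. proj (x i) k))" .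
  define A where "A = (\<Sum>j<n. \<Sum>i<j. resid (x i) (x j) k)"
  define S where "S = (\<Sum>i<n. proj (x i) k)"
  have "ustat n x k - mean k = 2 * A / (real n * (real n - 1)) + 2 * S / real n"
    unfolding ustat_def sum_lower_pairs e real_choose_two A_def[symmetric] S_def[symmetric]
    using n n1 by (simp add: field_simps)
  then have "N * (ustat n x k - mean k) / 2 = N * (A / (real n * (real n - 1))) + N * (S / real n)"
    by (simp add: algebra_simps)
  also have "N * (A / (real n * (real n - 1))) = A / (N * (real n - 1))" using N n1 by simp
  also have "N * (S / real n) = S / N" using N by simp
  finally show ?thesis by (simp add: N_def A_def S_def remainder_def sum_divide_distrib)
qed

lemma ustat_gaussian_approximation:
  assumes n: "2 \<le> n" and L: "1 \<le> L" "ln (2 * real (card I)) \<le> 3 * L"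
    and cov: "\<And>k. k \<in> I \<Longrightarrow> C1 \<le> cov k k" and G: "is_gauss I cov G"
  shows "\<bar>measure (PiM {..<n} (\<lambda>_. F)) {x \<in> space (PiM {..<n} (\<lambda>_. F)). \<forall>k\<in>I.
        sqrt (real n) * (ustat n x k - (\<integral>y. ustat n y k \<partial>PiM {..<n} (\<lambda>_. F))) / 2 \<le> t}
     - measure (PiM {..<n} (\<lambda>_. G)) {z \<in> space (PiM {..<n} (\<lambda>_. G)). \<forall>k\<in>I. (\<Sum>i<n. z i k) / sqrt (real n) \<le> t}\<bar>
    \<le> (rate_const + 1) * (B ^ 4 * L ^ 7 / real n) powr (1 / 8)" (is "\<bar>measure ?P ?A - measure ?Q ?E\<bar> \<le> _ * ?r")
proof -
  interpret P: prob_space ?P by (intro prob_space_PiM prob_space_axioms)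
  interpret Q: prob_space ?Q using G by (intro prob_space_PiM) (simp add: is_gauss_def)
  have q: "B ^ 4 * L ^ 7 / real n > 0" using B L n by simp
  have r0: "?r > 0" using B L n by simp
  have rc: "rate_const \<ge> 0" using C1 by (simp add: rate_const_def)
  show ?thesis
  proof (cases "?r \<le> 1")
    case True
    have "(x powr (1 / 8)) ^ 8 = x" if "0 < x" for x :: real
      using that by (simp add: powr_power)
    note r8 = this[OF q]
    have A: "?A = {x \<in> space ?P. \<forall>k\<in>I. (\<Sum>i<n. proj (x i) k / sqrt (real n)) + remainder n x k \<le> t}"
      using integral_ustat[OF n] hoeffding_decomposition[OF n] by auto
    have E: "?E = {z \<in> space ?Q. \<forall>k\<in>I. (\<Sum>i<n. z i k / sqrt (real n)) \<le> t}"
      by (simp add: sum_divide_distrib)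
    have "\<bar>measure ?P ?A - measure ?Q ?E\<bar> \<le> rate_const * ?r"
      unfolding A E by (rule gaussian_approximation[OF n L r0 True r8 cov G])
    also have "\<dots> \<le> (rate_const + 1) * ?r" using r0 by (intro mult_right_mono) auto
    finally show ?thesis .
  next
    \<comment> \<open>Here the right-hand side already exceeds 1; the summand 1 in the constant
      covers this case.\<close>
    case False
    have "\<bar>measure ?P ?A - measure ?Q ?E\<bar> \<le> 1"
      using P.prob_le_1[of ?A] Q.prob_le_1[of ?E] measure_nonneg[of ?P ?A] measure_nonneg[of ?Q ?E] by linarith
    also have "\<dots> \<le> (rate_const + 1) * ?r" using mult_mono[of 1 "rate_const + 1" 1 ?r] rc False by simp
    finally show ?thesis .
  qed
qed

end

section \<open>Matrix-valued kernels\<close>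

text \<open>Every entry equals its lower-triangular representative, so the maximum over the square
  is governed by the index set on which the Gaussian vector lives.\<close>

lemma Max_pairs_le_iff:
  assumes p: "0 < p" and sym: "\<And>m k. m < p \<Longrightarrow> k < p \<Longrightarrow> f m k = g (sidx m k)"
  shows "Max ((\<lambda>(m, k). f m k) ` ({..<p} \<times> {..<p})) \<le> (t::real) \<longleftrightarrow> (\<forall>a\<in>vidx p. g a \<le> t)"
proof -
  have "Max ((\<lambda>(m, k). f m k) ` ({..<p} \<times> {..<p})) \<le> t \<longleftrightarrow> (\<forall>m<p. \<forall>k<p. f m k \<le> t)"
    using p by (subst Max_le_iff) (auto intro: ex_in_conv)
  also have "\<dots> \<longleftrightarrow> (\<forall>a\<in>vidx p. g a \<le> t)"
  proof safe
    fix j k assume *: "\<forall>m<p. \<forall>k<p. f m k \<le> t" "(j, k) \<in> vidx p"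
    then have "j < p" "k < p" "sidx j k = (j, k)" by (auto simp: vidx_def sidx_def)
    then show "g (j, k) \<le> t" using * sym by metis
  next
    fix m k assume *: "\<forall>a\<in>vidx p. g a \<le> t" "m < p" "k < p"
    then have "sidx m k \<in> vidx p" by (auto simp: vidx_def sidx_def)
    then show "f m k \<le> t" using * sym by metis
  qed
  finally show ?thesis .
qed

lemma vidx_subset: "vidx p \<subseteq> {..<p} \<times> {..<p}" by (auto simp: vidx_def)

lemma finite_vidx: "finite (vidx p)" by (rule finite_subset[OF vidx_subset]) simp

text \<open>The moment hypotheses are extended nonnegative integrals; a finite bound on them
  supplies integrability as well as the bound on the Bochner integral.\<close>

lemma integrable_of_nn_bound:
  fixes u :: "'a \<Rightarrow> real"
  assumes "u \<in> borel_measurable M" "\<And>x. x \<in> space M \<Longrightarrow> 0 \<le> u x" "(\<integral>\<^sup>+x. ennreal (u x) \<partial>M) \<le> ennreal c" "0 \<le> c"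
  shows "integrable M u" "(\<integral>x. u x \<partial>M) \<le> c"
proof -
  have "(\<integral>\<^sup>+x. ennreal (u x) \<partial>M) < \<infinity>" using assms(3) by (rule le_less_trans) simp
  then show i: "integrable M u" using assms(1,2) by (intro integrableI_nonneg) auto
  have "ennreal (\<integral>x. u x \<partial>M) \<le> ennreal c"
    using nn_integral_eq_integral[OF i] assms(2,3) by simp
  then show "(\<integral>x. u x \<partial>M) \<le> c" using assms(4) by (simp add: ennreal_le_iff)
qed

lemma ln_6_ge_1: "1 \<le> ln (6::real)"
proof -
  have "exp 1 < (6::real)" using exp_le by simp
  then show ?thesis by (subst ln_ge_iff) auto
qed

text \<open>The constant is \<open>rate_const + 1\<close> written out, so that its dependence on C1
  alone is visible outside the locale.\<close>

lemma rho_bound_explicit: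
  fixes C1 :: real
  assumes C1: "0 < C1" and p: "3 \<le> p" and n: "2 \<le> n" and Bn: "1 \<le> Bn"
    and F: "prob_space F" "sets F = sets (vecM p)"
    and h_meas: "\<And>m k. m < p \<Longrightarrow> k < p \<Longrightarrow> (\<lambda>z. h (fst z) (snd z) m k) \<in> borel_measurable (vecM p \<Otimes>\<^sub>M vecM p)"
    and h_sym: "\<And>x y m k. x \<in> space (vecM p) \<Longrightarrow> y \<in> space (vecM p) \<Longrightarrow> m < p \<Longrightarrow> k < p \<Longrightarrow> h x y m k = h y x m k \<and> h x y m k = h x y k m"
    and h_int: "integrable (F \<Otimes>\<^sub>M F) (\<lambda>z. mnorm p (h (fst z) (snd z)))"
    and g2: "\<And>m k. m < p \<Longrightarrow> k < p \<Longrightarrow> ennreal C1 \<le> (\<integral>\<^sup>+x. ennreal ((gk F h x m k)\<^sup>2) \<partial>F)"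
    and hl: "\<And>m k l. m < p \<Longrightarrow> k < p \<Longrightarrow> l \<in> {0,1,2::nat} \<Longrightarrow>
       (\<integral>\<^sup>+z. ennreal (\<bar>h (fst z) (snd z) m k\<bar> ^ (2 + l) / Bn ^ l) \<partial>(F \<Otimes>\<^sub>M F)) \<le> 1"
    and h4: "(\<integral>\<^sup>+z. ennreal ((mnorm p (h (fst z) (snd z)) / Bn) ^ 4) \<partial>(F \<Otimes>\<^sub>M F)) \<le> 1"
    and G: "is_centered_gaussian (vidx p) (Gamma_g F h) G"
  shows "rho (sampleM n F) (T0stat n p F h) (sampleM n G) (Z0stat n p)
    \<le> (50400 * exp 2 + 1128960 + 126 + 5 * (5 * exp (3 / 2) + 1) / sqrt C1 + 1) * (Bn ^ 4 * ln (real (p * n)) ^ 7 / real n) powr (1 / 8)"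
proof -
  interpret F: prob_space F by fact
  interpret FF: pair_prob_space F F ..
  define I where "I = vidx p"
  define H where "H x y k = h x y (fst k) (snd k)" for x y :: vec and k :: "nat \<times> nat"
  define N where "N x y = mnorm p (h x y)" for x y :: vec
  have sp: "space F = space (vecM p)" using F(2) by (rule sets_eq_imp_space_eq)
  have spp: "sets (F \<Otimes>\<^sub>M F) = sets (vecM p \<Otimes>\<^sub>M vecM p)" using F(2) by (intro sets_pair_measure_cong)
  have I: "finite I" "I \<noteq> {}"
  proof -
    have "(0, 0) \<in> I" using p by (simp add: I_def vidx_def)
    then show "I \<noteq> {}" by blast
  qed (simp add: I_def finite_vidx)
  have Ip: "fst k < p" "snd k < p" if "k \<in> I" for k using that vidx_subset[of p] by (auto simp: I_def)
  have H_meas: "(\<lambda>z. H (fst z) (snd z) k) \<in> borel_measurable (F \<Otimes>\<^sub>M F)" if "k \<in> I" for k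
    using h_meas[OF Ip[OF that]] unfolding H_def by (simp add: measurable_cong_sets[OF spp refl])
  have N_meas: "(\<lambda>z. N (fst z) (snd z)) \<in> borel_measurable (F \<Otimes>\<^sub>M F)"
    using h_int unfolding N_def by (rule borel_measurable_integrable)
  have H_le: "\<bar>H x y k\<bar> \<le> N x y" if "k \<in> I" for x y k
    unfolding H_def N_def mnorm_def using Ip[OF that] by (intro Max_ge) force+
  obtain k0 where k0: "k0 \<in> I" using I by auto
  have N0: "0 \<le> N x y" for x y using H_le[OF k0, of x y] by linarith
  have N4m: "(\<integral>\<^sup>+z. ennreal (N (fst z) (snd z) ^ 4) \<partial>(F \<Otimes>\<^sub>M F)) \<le> ennreal (Bn ^ 4)"
  proof -
    have "(\<integral>\<^sup>+z. ennreal (N (fst z) (snd z) ^ 4) \<partial>(F \<Otimes>\<^sub>M F)) = (\<integral>\<^sup>+z. ennreal (Bn ^ 4) * ennreal ((N (fst z) (snd z) / Bn) ^ 4) \<partial>(F \<Otimes>\<^sub>M F))"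
      using Bn by (intro nn_integral_cong) (simp add: ennreal_mult[symmetric] power_divide)
    also have "\<dots> = ennreal (Bn ^ 4) * (\<integral>\<^sup>+z. ennreal ((N (fst z) (snd z) / Bn) ^ 4) \<partial>(F \<Otimes>\<^sub>M F))"
      by (intro nn_integral_cmult measurable_compose[OF _ measurable_ennreal] borel_measurable_power
          borel_measurable_divide borel_measurable_const N_meas)
    also have "\<dots> \<le> ennreal (Bn ^ 4) * 1" using h4 unfolding N_def by (intro mult_left_mono) auto
    finally show ?thesis by simp
  qed
  have N4: "integrable (F \<Otimes>\<^sub>M F) (\<lambda>z. N (fst z) (snd z) ^ 4)" "(\<integral>z. N (fst z) (snd z) ^ 4 \<partial>(F \<Otimes>\<^sub>M F)) \<le> Bn ^ 4"
    using integrable_of_nn_bound[OF _ _ N4m] N_meas Bn by auto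
  have H2: "(\<integral>z. (H (fst z) (snd z) k)\<^sup>2 \<partial>(F \<Otimes>\<^sub>M F)) \<le> 1" if k: "k \<in> I" for k
    using hl[OF Ip[OF k], of 0] H_meas[OF k] by (intro integrable_of_nn_bound(2)) (auto simp: H_def)
  \<comment> \<open>The hypothesis with l = 1, multiplied by Bn.\<close>
  have H3: "(\<integral>z. \<bar>H (fst z) (snd z) k\<bar> ^ 3 \<partial>(F \<Otimes>\<^sub>M F)) \<le> Bn" if k: "k \<in> I" for k
  proof -
    have "(\<integral>\<^sup>+z. ennreal (\<bar>H (fst z) (snd z) k\<bar> ^ 3 / Bn) \<partial>(F \<Otimes>\<^sub>M F)) \<le> ennreal 1"
      using hl[OF Ip[OF k], of 1] by (simp add: H_def numeral_3_eq_3)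
    then have "(\<integral>z. \<bar>H (fst z) (snd z) k\<bar> ^ 3 / Bn \<partial>(F \<Otimes>\<^sub>M F)) \<le> 1"
      using H_meas[OF k] Bn by (intro integrable_of_nn_bound(2)) auto
    then show ?thesis using Bn by (simp add: field_simps)
  qed
  interpret U: ustat_kernel F I H N Bn C1
    by standard (use I Bn C1 H_meas N_meas H_le N4 H2 H3 h_sym Ip sp in \<open>auto simp: H_def\<close>)
  have mean: "U.mean k = Eh F h (fst k) (snd k)" for k by (simp add: U.mean_def Eh_def H_def)
  have proj: "U.proj x k = gk F h x (fst k) (snd k)" for x k
    by (simp add: U.proj_def gk_def H_def mean)
  \<comment> \<open>\<open>Gamma_g\<close> subtracts the means of the projections, which are
    0.\<close>
  have cov: "U.cov i j = Gamma_g F h i j" if "i \<in> I" "j \<in> I" for i j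
    using U.proj_mean(1)[OF that(1)] U.proj_mean(1)[OF that(2)] by (simp add: U.cov_def Gamma_g_def proj)
  have quad_form: "quad_form I U.cov a = (\<Sum>i\<in>I. \<Sum>j\<in>I. a i * a j * Gamma_g F h i j)" for a
    unfolding quad_form_def by (intro sum.cong refl) (simp add: cov)
  have G': "is_gauss I U.cov G"
    using G unfolding is_centered_gaussian_def is_gauss_def Let_def quad_form I_def[symmetric] by simp
  have covC1: "C1 \<le> U.cov k k" if k: "k \<in> I" for k
  proof -
    have "ennreal C1 \<le> (\<integral>\<^sup>+x. ennreal ((U.proj x k)\<^sup>2) \<partial>F)" using g2[OF Ip[OF k]] by (simp add: proj)
    also have "\<dots> = ennreal (U.cov k k)"
      using U.proj_square(1)[OF k] by (subst nn_integral_eq_integral) (auto simp: U.cov_def power2_eq_square)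
    finally show ?thesis using C1
      by (metis ennreal_le_iff2 linorder_not_le)
  qed
  define L where "L = ln (real (p * n))"
  have pn: "6 \<le> real (p * n)"
  proof -
    have "3 * 2 \<le> p * n" using p n by (intro mult_mono) auto
    then show ?thesis by linarith
  qed
  \<comment> \<open>Here p \<ge> 3 and n \<ge> 2 matter: they give pn \<ge> 6, which is above
    e.\<close>
  have L1: "1 \<le> L" unfolding L_def using ln_6_ge_1 pn by (metis ln_le_cancel_iff order_trans less_le_trans zero_less_numeral)
  \<comment> \<open>At most p^2 lower-triangular entries and the factor 2 \<le> pn give 2 card I
    \<le> (pn)^3.\<close>
  have L2: "ln (2 * real (card I)) \<le> 3 * L"
  proof -
    have "card I \<le> card ({..<p} \<times> {..<p})" unfolding I_def by (intro card_mono vidx_subset) simp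
    then have "card I \<le> p * p" by (simp add: card_cartesian_product)
    then have cI: "real (card I) \<le> real p * real p" by (simp flip: of_nat_mult)
    have "p * 1 \<le> p * n" using n by (intro mult_le_mono) auto
    then have pP: "real p \<le> real (p * n)" by (simp only: of_nat_le_iff mult_1_right)
    have "real (card I) \<le> real (p * n) * real (p * n)"
      using mult_mono[OF pP pP] cI by (auto intro: order_trans)
    then have "2 * real (card I) \<le> real (p * n) * (real (p * n) * real (p * n))"
      using pn by (intro mult_mono) auto
    also have "\<dots> = real (p * n) ^ 3" by (simp add: power3_eq_cube)
    finally have "ln (2 * real (card I)) \<le> ln (real (p * n) ^ 3)"
      using I pn by (subst ln_le_cancel_iff) (auto simp: card_gt_0_iff)
    also have "\<dots> = 3 * L" unfolding L_def using pn by (subst ln_realpow) auto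
    finally show ?thesis .
  qed
  have T: "{x \<in> space (sampleM n F). T0stat n p F h x \<le> t} = {x \<in> space (PiM {..<n} (\<lambda>_. F)). \<forall>k\<in>I.
        sqrt (real n) * (U.ustat n x k - (\<integral>y. U.ustat n y k \<partial>PiM {..<n} (\<lambda>_. F))) / 2 \<le> t}" for t
  proof -
    \<comment> \<open>Symmetry of the kernel is known on the sample space only, so the sample points
      are first located there.\<close>
    have us: "Ustat n h x m k = Ustat n h x k m" if "x \<in> space (PiM {..<n} (\<lambda>_. F))" "m < p" "k < p" for x m k
    proof -
      have "h (x i) (x j) m k = h (x i) (x j) k m" if ij: "i < j" "j < n" for i j
      proof -
        have "x i \<in> space (vecM p)" "x j \<in> space (vecM p)"
          using \<open>x \<in> space (PiM {..<n} (\<lambda>_. F))\<close> ij by (auto simp: space_PiM PiE_iff sp)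
        then show ?thesis using h_sym \<open>m < p\<close> \<open>k < p\<close> by blast
      qed
      then show ?thesis unfolding Ustat_def by (intro arg_cong2[where f="(/)"] sum.cong refl) auto
    qed
    have us': "Ustat n h x m k = U.ustat n x (sidx m k)" if "x \<in> space (PiM {..<n} (\<lambda>_. F))" "m < p" "k < p" for x m k
    proof -
      have "U.ustat n x (sidx m k) = Ustat n h x (max m k) (min m k)" by (simp add: U.ustat_def Ustat_def H_def sidx_def)
      then show ?thesis using us[OF that] by (cases "m \<le> k") (auto simp: max_def min_def)
    qed
    have uI: "(\<integral>y. Ustat n h y m k \<partial>PiM {..<n} (\<lambda>_. F)) = (\<integral>y. U.ustat n y (sidx m k) \<partial>PiM {..<n} (\<lambda>_. F))" if "m < p" "k < p" for m k
      using that by (intro Bochner_Integration.integral_cong refl us')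
    have "T0stat n p F h x \<le> t \<longleftrightarrow> (\<forall>k\<in>I. sqrt (real n) * (U.ustat n x k - (\<integral>y. U.ustat n y k \<partial>PiM {..<n} (\<lambda>_. F))) / 2 \<le> t)"
      if x: "x \<in> space (PiM {..<n} (\<lambda>_. F))" for x
      unfolding T0stat_def sampleM_def I_def
      by (rule Max_pairs_le_iff) (use p us'[OF x] uI in auto)
    then show ?thesis unfolding sampleM_def by auto
  qed
  have Z: "{z \<in> space (sampleM n G). Z0stat n p z \<le> t} = {z \<in> space (PiM {..<n} (\<lambda>_. G)). \<forall>k\<in>I. (\<Sum>i<n. z i k) / sqrt (real n) \<le> t}" for t
  proof -
    have "Z0stat n p z \<le> t \<longleftrightarrow> (\<forall>k\<in>I. (\<Sum>i<n. z i k) / sqrt (real n) \<le> t)" for z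
      unfolding Z0stat_def I_def by (rule Max_pairs_le_iff) (use p in auto)
    then show ?thesis unfolding sampleM_def by auto
  qed
  show ?thesis
    unfolding rho_def
  proof (rule cSUP_least)
    fix t
    show "\<bar>measure (sampleM n F) {x \<in> space (sampleM n F). T0stat n p F h x \<le> t} - measure (sampleM n G) {y \<in> space (sampleM n G). Z0stat n p y \<le> t}\<bar>
      \<le> (50400 * exp 2 + 1128960 + 126 + 5 * (5 * exp (3 / 2) + 1) / sqrt C1 + 1) * (Bn ^ 4 * ln (real (p * n)) ^ 7 / real n) powr (1 / 8)"
      unfolding T Z unfolding sampleM_def L_def[symmetric] U.rate_const_def[symmetric]
      by (rule U.ustat_gaussian_approximation[OF n L1 L2 covC1 G'])
  qed simp
qed

theorem theorem2p2:
  fixes C1 C2 :: real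
  assumes "C1 > 0" and "C2 > 0"
  shows "\<exists>C>0. \<forall>(K::real) (p::nat) (n::nat) (F::vec measure) (h::mkernel) (Bn::real)
            (G::((nat \<times> nat) \<Rightarrow> real) measure).
     ( 0 < K \<and> K < 1 \<and> 3 \<le> p \<and> 2 \<le> n \<and> 1 \<le> Bn
     \<and> prob_space F \<and> sets F = sets (vecM p)
     \<comment> \<open>measurable kernel\<close>
     \<and> (\<forall>m<p. \<forall>k<p. (\<lambda>z. h (fst z) (snd z) m k) \<in> borel_measurable (vecM p \<Otimes>\<^sub>M vecM p))
     \<comment> \<open>symmetric kernel with symmetric-matrix values\<close>
     \<and> (\<forall>x\<in>space (vecM p). \<forall>y\<in>space (vecM p). \<forall>m<p. \<forall>k<p.
            h x y m k = h y x m k \<and> h x y m k = h x y k m)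
     \<comment> \<open>E||h|| < infinity\<close>
     \<and> integrable (F \<Otimes>\<^sub>M F) (\<lambda>z. mnorm p (h (fst z) (snd z)))
     \<comment> \<open>non-degenerate\<close>
     \<and> (\<forall>m<p. \<forall>k<p. prob_space.variance F (\<lambda>x. gk F h x m k) > 0)
     \<comment> \<open>(GA.1')\<close>
     \<and> (\<forall>m<p. \<forall>k<p.
          ennreal C1 \<le> (\<integral>\<^sup>+x. ennreal ((gk F h x m k)\<^sup>2) \<partial>F)
        \<and> (\<forall>l\<in>{0,1,2::nat}.
             (\<integral>\<^sup>+z. ennreal (\<bar>h (fst z) (snd z) m k\<bar> ^ (2 + l) / Bn ^ l) \<partial>(F \<Otimes>\<^sub>M F)) \<le> 1)
        \<and> (\<integral>\<^sup>+z. ennreal ((mnorm p (h (fst z) (snd z)) / Bn) ^ 4) \<partial>(F \<Otimes>\<^sub>M F)) \<le> 1)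
     \<comment> \<open>(GA.2')\<close>
     \<and> Bn ^ 4 * (ln (real (p * n))) ^ 7 / real n \<le> C2 * real n powr (- K)
     \<comment> \<open>Z_1..Z_n iid N(0, Gamma_g)\<close>
     \<and> is_centered_gaussian (vidx p) (Gamma_g F h) G )
     \<longrightarrow> rho (sampleM n F) (T0stat n p F h) (sampleM n G) (Z0stat n p)
           \<le> C * real n powr (- K / 8)"
proof -
  define K0 where "K0 = 50400 * exp 2 + 1128960 + 126 + 5 * (5 * exp (3 / 2) + 1) / sqrt C1 + (1::real)"
  have K0: "K0 > 0" using assms by (simp add: K0_def add_pos_nonneg)
  \<comment> \<open>The witness multiplies the explicit constant by the eighth root of C2, which
    comes out of the rate after (GA.2').\<close>
  show ?thesis
  proof (intro exI[of _ "K0 * C2 powr (1 / 8)"] conjI allI impI; (elim conjE)?)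
    show "0 < K0 * C2 powr (1 / 8)" using K0 assms by simp
    fix K :: real and p n :: nat and F :: "vec measure" and h :: mkernel and Bn :: real
      and G :: "((nat \<times> nat) \<Rightarrow> real) measure"
    assume p: "3 \<le> p" and n: "2 \<le> n" and Bn: "1 \<le> Bn" and F: "prob_space F" "sets F = sets (vecM p)"
      and meas: "\<forall>m<p. \<forall>k<p. (\<lambda>z. h (fst z) (snd z) m k) \<in> borel_measurable (vecM p \<Otimes>\<^sub>M vecM p)"
      and sym: "\<forall>x\<in>space (vecM p). \<forall>y\<in>space (vecM p). \<forall>m<p. \<forall>k<p. h x y m k = h y x m k \<and> h x y m k = h x y k m"
      and int: "integrable (F \<Otimes>\<^sub>M F) (\<lambda>z. mnorm p (h (fst z) (snd z)))"
      and GA1: "\<forall>m<p. \<forall>k<p. ennreal C1 \<le> (\<integral>\<^sup>+x. ennreal ((gk F h x m k)\<^sup>2) \<partial>F)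
        \<and> (\<forall>l\<in>{0,1,2::nat}. (\<integral>\<^sup>+z. ennreal (\<bar>h (fst z) (snd z) m k\<bar> ^ (2 + l) / Bn ^ l) \<partial>(F \<Otimes>\<^sub>M F)) \<le> 1)
        \<and> (\<integral>\<^sup>+z. ennreal ((mnorm p (h (fst z) (snd z)) / Bn) ^ 4) \<partial>(F \<Otimes>\<^sub>M F)) \<le> 1"
      and GA2: "Bn ^ 4 * (ln (real (p * n))) ^ 7 / real n \<le> C2 * real n powr (- K)"
      and G: "is_centered_gaussian (vidx p) (Gamma_g F h) G"
    \<comment> \<open>The envelope moment bound sits under the quantifiers over m and k; the entry
      (0, 0) releases it.\<close>
    have p0: "0 < p" using p by simp
    have "rho (sampleM n F) (T0stat n p F h) (sampleM n G) (Z0stat n p)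
      \<le> K0 * (Bn ^ 4 * ln (real (p * n)) ^ 7 / real n) powr (1 / 8)"
      unfolding K0_def
    proof (rule rho_bound_explicit[OF assms(1) p n Bn F _ _ int _ _ _ G])
      show "(\<lambda>z. h (fst z) (snd z) m k) \<in> borel_measurable (vecM p \<Otimes>\<^sub>M vecM p)" if "m < p" "k < p" for m k
        using meas that by blast
      show "h x y m k = h y x m k \<and> h x y m k = h x y k m"
        if "x \<in> space (vecM p)" "y \<in> space (vecM p)" "m < p" "k < p" for x y m k
        using sym that by blast
      show "ennreal C1 \<le> (\<integral>\<^sup>+x. ennreal ((gk F h x m k)\<^sup>2) \<partial>F)" if "m < p" "k < p" for m k
        using GA1 that by blast
      show "(\<integral>\<^sup>+z. ennreal (\<bar>h (fst z) (snd z) m k\<bar> ^ (2 + l) / Bn ^ l) \<partial>(F \<Otimes>\<^sub>M F)) \<le> 1"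
        if "m < p" "k < p" "l \<in> {0, 1, 2}" for m k l
        using GA1 that by blast
      show "(\<integral>\<^sup>+z. ennreal ((mnorm p (h (fst z) (snd z)) / Bn) ^ 4) \<partial>(F \<Otimes>\<^sub>M F)) \<le> 1"
        using GA1 p0 by blast
    qed
    \<comment> \<open>(GA.2') enters only here, through monotonicity of the eighth root.\<close>
    also have "\<dots> \<le> K0 * (C2 * real n powr (- K)) powr (1 / 8)"
    proof (intro mult_left_mono powr_mono2 GA2)
      have "1 * 1 \<le> p * n" using p n by (intro mult_mono) auto
      then show "0 \<le> Bn ^ 4 * ln (real (p * n)) ^ 7 / real n" using Bn
        by (intro divide_nonneg_nonneg mult_nonneg_nonneg zero_le_power ln_ge_zero) linarith+
    qed (use K0 in auto)
    also have "\<dots> = K0 * C2 powr (1 / 8) * real n powr (- K / 8)"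
      using assms by (simp add: powr_mult powr_powr)
    finally show "rho (sampleM n F) (T0stat n p F h) (sampleM n G) (Z0stat n p)
      \<le> K0 * C2 powr (1 / 8) * real n powr (- K / 8)" .
  qed
qed

end
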